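(* Assume that the Gram matrix $\mathcal{G}_A$ is invertible and Hermitian and that, if $m\geq2$, $[\mathcal{G}_A]_{\sigma,m-1;\sigma' m}=[\mathcal{G}_A]_{\sigma m;\sigma',m-1}$ for all $\sigma,\sigma'\in\mathcal{S}$. Then $$B_{\max}=A'_{\max}|_{\operatorname{dom}A_{\max}\cap\mathcal{H}^{\min}_A}\,\widehat{+}\,(\{0\}\times\mathcal{H}^\perp_A)$$ and $$B_{\min}=A_{\min}|_{\operatorname{dom}A_{\min}\cap\mathcal{H}^{\min}_A}\,\widehat{+}\,(\{0\}\times\mathcal{H}^\perp_A)=A'_{\min}|_{\operatorname{dom}A_{\min}\cap\mathcal{H}^{\min}_A}\,\widehat{+}\,(\{0\}\times\mathcal{H}^\perp_A).$$ Moreover, $B_{\min}$ is a closed symmetric linear relation in $\mathcal{H}_A$, whose adjoint in $\mathcal{H}_A$ is the linear relation $B_{\min}^*=B_{\max}$.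
   Context: Setting. $L$ is a lower semibounded self-adjoint operator in a Hilbert space $\mathfrak{H}_0$; scalar products are conjugate linear in the first factor; $\operatorname{res}$ denotes the resolvent set. Fix a real $z_1\in\operatorname{res}L$ lying strictly below the spectrum of $L$ and put $b_n(L):=(L-z_1)^n$. $(\mathfrak{H}_n)_{n\in\mathbb{Z}}$ is the scale of Hilbert spaces of $L$ with $\langle\cdot,\cdot\rangle_n:=\langle b_n(L)^{1/2}\cdot,b_n(L)^{1/2}\cdot\rangle_0$ ($\mathfrak{H}_n=\operatorname{dom}(L-z_1)^{n/2}$ for $n\ge0$, completion of $\mathfrak{H}_0$ for $n<0$). $L$ acts from $\mathfrak{H}_{n+2}$ to $\mathfrak{H}_n$ for all $n$; as an operator in $\mathfrak{H}_n$ with domain $\mathfrak{H}_{n+2}$ it is self-adjoint, is denoted $L_n$ (or just $L$), and $\operatorname{res}L_n=\operatorname{res}L$. $\langle\cdot,\cdot\rangle$ is the duality pairing between $\mathfrak{H}_{-n}$ and $\mathfrak{H}_n$ induced by $\langle\cdot,\cdot\rangle_0$. Fix $m,d\in\mathbb{N}=\{1,2,\dots\}$, an index set $\mathcal{S}$ with $d$ elements, $J:=\{1,\dots,m\}$, and functionals $\varphi_\sigma\in\mathfrak{H}_{-m-2}\setminus\mathfrak{H}_{-m-1}$ ($\sigma\in\mathcal{S}$) that are linearly independent modulo $\mathfrak{H}_{-m-1}$. Put $\langle\varphi,f\rangle:=(\langle\varphi_\sigma,f\rangle)_\sigma\in\mathbb{C}^d$ for $f\in\mathfrak{H}_{m+2}$;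 $h_{\sigma j}:=b_j(L)^{-1}\varphi_\sigma\in\mathfrak{H}_{-m-2+2j}\setminus\mathfrak{H}_{-m-1+2j}$ for $j\in\{1,\dots,m+1\}$; $h_m(c):=\sum_\sigma c_\sigma h_{\sigma m}$, $h_{m+1}(c):=\sum_\sigma c_\sigma h_{\sigma,m+1}$ for $c\in\mathbb{C}^d$. $\mathfrak{K}_A:=\operatorname{span}\{h_{\sigma j}\mid(\sigma,j)\in\mathcal{S}\times J\}$ has dimension $md$; for $k\in\mathfrak{K}_A$, $d(k)=(d_{\sigma j}(k))\in\mathbb{C}^{md}$ is its coordinate vector, $k=\sum d_{\sigma j}(k)h_{\sigma j}$. $\mathfrak{K}^{\min}_A:=\mathfrak{K}_A\cap\mathfrak{H}_{m-2}=h_m(\mathbb{C}^d)$, and $d(h_m(c))=\eta(c):=(\delta_{jm}c_\sigma)_{\sigma j}$. $\mathcal{G}_A=([\mathcal{G}_A]_{\sigma j,\sigma'j'})$ is an invertible Hermitian $md\times md$ matrix; $\mathcal{H}_A:=\mathfrak{H}_m\dotplus\mathfrak{K}_A$ (direct sum, with the Hilbert sum topology, $\mathfrak{K}_A$ finite-dimensional) has the indefinite inner product $[f+k,f'+k']_A:=\langle f,f'\rangle_m+\langle d(k),\mathcal{G}_Ad(k')\rangle_{\mathbb{C}^{md}}$. Put $[\mathcal{G}_Ad(k)]_m:=([\mathcal{G}_Ad(k)]_{\sigma m})_\sigma\in\mathbb{C}^d$. $\mathcal{H}^{\min}_A:=\mathfrak{H}_m\dotplus\mathfrak{K}^{\min}_A\subseteq\mathcal{H}_A$,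 and $\mathcal{H}^\perp_A$ is the $[\cdot,\cdot]_A$-orthogonal complement of $\mathcal{H}^{\min}_A$ in $\mathcal{H}_A$. $\mathfrak{M}$ is the $m\times m$ matrix with $z_1$ on the diagonal, $1$ on the first superdiagonal ($\mathfrak{M}_{j,j+1}=1$) and $0$ elsewhere; $[\mathfrak{M}_d]_{\sigma j,\sigma'j'}:=\delta_{\sigma\sigma'}\mathfrak{M}_{jj'}$; $\mathcal{G}_{\mathfrak{M}}:=\mathcal{G}_A\mathfrak{M}_d$. Operators are identified with their graphs. The operators $A_{\max}$, $A'_{\max}$ in $\mathcal{H}_A$ are $$A_{\max}=\{(f^\#+h_{m+1}(c)+k,\ L_mf^\#+z_1h_{m+1}(c)+\widetilde k)\mid f^\#\in\mathfrak{H}_{m+2},\ c\in\mathbb{C}^d,\ k,\widetilde k\in\mathfrak{K}_A,\ d(\widetilde k)=\mathfrak{M}_dd(k)+\eta(c)\},$$ and $A'_{\max}$ is defined in the same way but with $d(\widetilde k)=\mathcal{G}_A^{-1}\mathcal{G}_{\mathfrak{M}}^*d(k)+\eta(c)$; they have the same domain. On $\operatorname{dom}A_{\max}$ define $\Gamma=(\Gamma_0,\Gamma_1)$ by $\Gamma_0(f^\#+h_{m+1}(c)+k):=c$, $\Gamma_1(f^\#+h_{m+1}(c)+k):=\langle\varphi,f^\#\rangle-[\mathcal{G}_Ad(k)]_m$. The adjoint in $\mathcal{H}_A$ of a relation $T$ is $T^*=\{(g,g')\mid[f,g']_A=[f',g]_A\ \forall(f,f')\in T\}$; $T$ is symmetric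 if $T\subseteq T^*$. Put $A_{\min}:=A_{\max}^*$ (which equals $A'_{\max}|_{\ker\Gamma}$) and $A'_{\min}:=A_{\max}|_{\ker\Gamma}$, so that $\operatorname{dom}A_{\min}=\operatorname{dom}A'_{\min}=\ker\Gamma$. With $\widehat{+}$ the componentwise sum of relations, $$B_{\max}:=A_{\max}|_{\operatorname{dom}A_{\max}\cap\mathcal{H}^{\min}_A}\,\widehat{+}\,(\{0\}\times\mathcal{H}^\perp_A),\qquad B_{\min}:=B_{\max}^*.$$ *)

theory Defs
  imports "HOL-Analysis.Analysis"
begin

section \<open>Complex vector spaces and Hilbert spaces on carrier sets\<close>

class complex_vector = ab_group_add +
  fixes scaleC :: "complex \<Rightarrow> 'a \<Rightarrow> 'a"  (infixr \<open>*\<^sub>C\<close> 75)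
  assumes scaleC_add_right: "a *\<^sub>C (x + y) = a *\<^sub>C x + a *\<^sub>C y"
    and scaleC_add_left: "(a + b) *\<^sub>C x = a *\<^sub>C x + b *\<^sub>C x"
    and scaleC_scaleC: "a *\<^sub>C b *\<^sub>C x = (a * b) *\<^sub>C x"
    and scaleC_one: "1 *\<^sub>C x = x"

interpretation complex_vector: vector_space "scaleC :: complex \<Rightarrow> 'a \<Rightarrow> 'a::complex_vector"
  by unfold_locales (simp_all add: scaleC_add_right scaleC_add_left scaleC_scaleC scaleC_one)

text \<open>All spaces are linear subspaces \<open>U\<close> of one complex vector space, equipped with a form \<open>g\<close>
  whose values matter only on \<open>U\<close>.\<close>

definition inner_product_on :: "'v::complex_vector set \<Rightarrow> ('v \<Rightarrow> 'v \<Rightarrow> complex) \<Rightarrow> bool" where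
  "inner_product_on U g \<longleftrightarrow>
     complex_vector.subspace U \<and>
     (\<forall>x\<in>U. \<forall>y\<in>U. \<forall>z\<in>U. g x (y + z) = g x y + g x z) \<and>
     (\<forall>x\<in>U. \<forall>y\<in>U. \<forall>a. g x (a *\<^sub>C y) = a * g x y) \<and>
     (\<forall>x\<in>U. \<forall>y\<in>U. g y x = cnj (g x y)) \<and>
     (\<forall>x\<in>U. x \<noteq> 0 \<longrightarrow> 0 < Re (g x x))"

definition ip_norm :: "('v \<Rightarrow> 'v \<Rightarrow> complex) \<Rightarrow> 'v \<Rightarrow> real" where
  "ip_norm g x = sqrt (Re (g x x))"

text \<open>The case distinction is needed because the locale \<open>Metric_space\<close> requires nonnegativity and
  symmetry of the distance also outside the carrier.\<close>

definition ip_dist :: "'v::complex_vector set \<Rightarrow> ('v \<Rightarrow> 'v \<Rightarrow> complex) \<Rightarrow> 'v \<Rightarrow> 'v \<Rightarrow> real" where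
  "ip_dist U g x y = (if x \<in> U \<and> y \<in> U then ip_norm g (x - y) else 0)"

definition ip_topology :: "'v::complex_vector set \<Rightarrow> ('v \<Rightarrow> 'v \<Rightarrow> complex) \<Rightarrow> 'v topology" where
  "ip_topology U g = Metric_space.mtopology U (ip_dist U g)"

definition hilbert_space_on :: "'v::complex_vector set \<Rightarrow> ('v \<Rightarrow> 'v \<Rightarrow> complex) \<Rightarrow> bool" where
  "hilbert_space_on U g \<longleftrightarrow> inner_product_on U g \<and> Metric_space.mcomplete U (ip_dist U g)"


section \<open>Linear relations and operators, identified with their graphs\<close>

definition linear_relation_on :: "'v::complex_vector set \<Rightarrow> ('v \<times> 'v) set \<Rightarrow> bool" where
  "linear_relation_on U T \<longleftrightarrow>
     T \<subseteq> U \<times> U \<and> (0, 0) \<in> T \<and>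
     (\<forall>(x, x')\<in>T. \<forall>(y, y')\<in>T. (x + y, x' + y') \<in> T) \<and>
     (\<forall>(x, x')\<in>T. \<forall>a. (a *\<^sub>C x, a *\<^sub>C x') \<in> T)"

text \<open>The form \<open>g\<close> may be indefinite here.\<close>

definition adjoint_rel ::
    "'v set \<Rightarrow> ('v \<Rightarrow> 'v \<Rightarrow> complex) \<Rightarrow> ('v \<times> 'v) set \<Rightarrow> ('v \<times> 'v) set" where
  "adjoint_rel U g T = {(y, y') \<in> U \<times> U. \<forall>(x, x')\<in>T. g x y' = g x' y}"

definition symmetric_rel :: "'v set \<Rightarrow> ('v \<Rightarrow> 'v \<Rightarrow> complex) \<Rightarrow> ('v \<times> 'v) set \<Rightarrow> bool" where
  "symmetric_rel U g T \<longleftrightarrow> T \<subseteq> adjoint_rel U g T"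

definition self_adjoint_operator ::
    "'v::complex_vector set \<Rightarrow> ('v \<Rightarrow> 'v \<Rightarrow> complex) \<Rightarrow> ('v \<times> 'v) set \<Rightarrow> bool" where
  "self_adjoint_operator U g T \<longleftrightarrow>
     linear_relation_on U T \<and> single_valued T \<and>
     ip_topology U g closure_of Domain T = U \<and> adjoint_rel U g T = T"

definition lower_semibounded :: "('v \<Rightarrow> 'v \<Rightarrow> complex) \<Rightarrow> ('v \<times> 'v) set \<Rightarrow> bool" where
  "lower_semibounded g T \<longleftrightarrow> (\<exists>\<gamma>::real. \<forall>(x, x')\<in>T. \<gamma> * Re (g x x) \<le> Re (g x x'))"

text \<open>The graph of \<open>T - z\<close>.\<close>

definition rel_shift :: "('v::complex_vector \<times> 'v) set \<Rightarrow> complex \<Rightarrow> ('v \<times> 'v) set" where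
  "rel_shift T z = {(x, x' - z *\<^sub>C x) | x x'. (x, x') \<in> T}"

definition resolvent_set ::
    "'v::complex_vector set \<Rightarrow> ('v \<Rightarrow> 'v \<Rightarrow> complex) \<Rightarrow> ('v \<times> 'v) set \<Rightarrow> complex set" where
  "resolvent_set U g T =
     {z. (\<forall>y\<in>U. \<exists>!x. (x, y) \<in> rel_shift T z) \<and>
         (\<exists>C. \<forall>(x, y)\<in>rel_shift T z. ip_norm g x \<le> C * ip_norm g y)}"

definition rel_restrict :: "('v \<times> 'w) set \<Rightarrow> 'v set \<Rightarrow> ('v \<times> 'w) set" where
  "rel_restrict T D = {(x, x') \<in> T. x \<in> D}"

definition rel_sum ::
    "('v::plus \<times> 'v) set \<Rightarrow> ('v \<times> 'v) set \<Rightarrow> ('v \<times> 'v) set"  (infixl \<open>\<oplus>\<^sub>r\<close> 65) where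
  "S \<oplus>\<^sub>r T = {(x + y, x' + y') | x x' y y'. (x, x') \<in> S \<and> (y, y') \<in> T}"

definition positive_root ::
    "'v::complex_vector set \<Rightarrow> ('v \<Rightarrow> 'v \<Rightarrow> complex) \<Rightarrow> ('v \<times> 'v) set \<Rightarrow> ('v \<times> 'v) set \<Rightarrow> bool" where
  "positive_root U g T R \<longleftrightarrow>
     self_adjoint_operator U g R \<and> (\<forall>(x, x')\<in>R. 0 \<le> Re (g x x')) \<and> R O R = T"


section \<open>Matrices with rows and columns indexed by a finite set\<close>

definition mat_vec :: "'i set \<Rightarrow> ('i \<Rightarrow> 'i \<Rightarrow> complex) \<Rightarrow> ('i \<Rightarrow> complex) \<Rightarrow> 'i \<Rightarrow> complex" where
  "mat_vec I A v i = (\<Sum>j\<in>I. A i j * v j)"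

definition mat_mult ::
    "'i set \<Rightarrow> ('i \<Rightarrow> 'i \<Rightarrow> complex) \<Rightarrow> ('i \<Rightarrow> 'i \<Rightarrow> complex) \<Rightarrow> 'i \<Rightarrow> 'i \<Rightarrow> complex" where
  "mat_mult I A B i k = (\<Sum>j\<in>I. A i j * B j k)"

definition mat_adj :: "('i \<Rightarrow> 'i \<Rightarrow> complex) \<Rightarrow> 'i \<Rightarrow> 'i \<Rightarrow> complex" where
  "mat_adj A i j = cnj (A j i)"

definition mat_hermitian :: "'i set \<Rightarrow> ('i \<Rightarrow> 'i \<Rightarrow> complex) \<Rightarrow> bool" where
  "mat_hermitian I A \<longleftrightarrow> (\<forall>i\<in>I. \<forall>j\<in>I. mat_adj A i j = A i j)"

definition mat_inverse_of ::
    "'i set \<Rightarrow> ('i \<Rightarrow> 'i \<Rightarrow> complex) \<Rightarrow> ('i \<Rightarrow> 'i \<Rightarrow> complex) \<Rightarrow> bool" where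
  "mat_inverse_of I A B \<longleftrightarrow>
     (\<forall>i\<in>I. \<forall>j\<in>I. mat_mult I A B i j = of_bool (i = j) \<and> mat_mult I B A i j = of_bool (i = j))"

definition mat_invertible :: "'i set \<Rightarrow> ('i \<Rightarrow> 'i \<Rightarrow> complex) \<Rightarrow> bool" where
  "mat_invertible I A \<longleftrightarrow> (\<exists>B. mat_inverse_of I A B)"

text \<open>The choice is unique on \<open>I \<times> I\<close>; the entries outside are never used.\<close>

definition mat_inv :: "'i set \<Rightarrow> ('i \<Rightarrow> 'i \<Rightarrow> complex) \<Rightarrow> 'i \<Rightarrow> 'i \<Rightarrow> complex" where
  "mat_inv I A = (SOME B. mat_inverse_of I A B)"


section \<open>The scale of Hilbert spaces of a semibounded self-adjoint operator\<close>

context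
  fixes H :: "int \<Rightarrow> 'v::complex_vector set"
    and ip :: "int \<Rightarrow> 'v \<Rightarrow> 'v \<Rightarrow> complex"
    and L :: "('v \<times> 'v) set"
    and z1 :: real
begin

text \<open>The operator \<open>(L - z1)\<^sup>n\<close> in \<open>H 0\<close> for an integer \<open>n\<close>, the identity of \<open>H 0\<close> for \<open>n = 0\<close>.\<close>

definition b_op :: "int \<Rightarrow> ('v \<times> 'v) set" where
  "b_op n = (if 0 \<le> n then Restr (rel_shift L z1 ^^ nat n) (H 0)
             else (Restr (rel_shift L z1 ^^ nat (- n)) (H 0))\<inverse>)"

text \<open>The completions for negative \<open>n\<close> are determined only up to isomorphism; a scale is any
  choice of them inside one vector space in which the canonical maps \<open>H (n + 1) \<rightarrow> H n\<close> (the continuous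
  extensions of the identity of \<open>H 0\<close>) are set inclusions.  For \<open>n < 0\<close> the operator \<open>R\<close> is
  everywhere defined on \<open>H 0\<close>.\<close>

definition hilbert_scale :: bool where
  "hilbert_scale \<longleftrightarrow>
     (\<forall>n. hilbert_space_on (H n) (ip n)) \<and>
     (\<forall>n. \<exists>R. positive_root (H 0) (ip 0) (b_op n) R \<and>
        (0 \<le> n \<longrightarrow> H n = Domain R) \<and>
        (\<forall>(x, x')\<in>R. \<forall>(y, y')\<in>R. ip n x y = ip 0 x' y')) \<and>
     (\<forall>n<0. H 0 \<subseteq> H n \<and> ip_topology (H n) (ip n) closure_of H 0 = H n) \<and>
     (\<forall>n<0. H (n + 1) \<subseteq> H n \<and> (\<exists>C. \<forall>x\<in>H (n + 1). ip_norm (ip n) x \<le> C * ip_norm (ip (n + 1)) x))"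

text \<open>\<open>L\<close> as an operator in \<open>H n\<close> with domain \<open>H (n + 2)\<close>.  Since \<open>L\<close> is bounded from \<open>H (n + 2)\<close> to
  \<open>H n\<close>, the graph of its continuous extension is the closure of the graph in
  \<open>H (n + 2) \<times> H n\<close>; for \<open>n \<ge> 0\<close> it is the plain restriction.\<close>

definition L_scale :: "int \<Rightarrow> ('v \<times> 'v) set" where
  "L_scale n =
     prod_topology (ip_topology (H (n + 2)) (ip (n + 2))) (ip_topology (H n) (ip n))
       closure_of (L \<inter> H (n + 2) \<times> H n)"

definition L_ext :: "('v \<times> 'v) set" where
  "L_ext = (\<Union>n. L_scale n)"

text \<open>The pairing of \<open>H (-n)\<close> and \<open>H n\<close>, the continuous extension of \<open>ip 0\<close> in the first argument.\<close>

definition pairing :: "int \<Rightarrow> 'v \<Rightarrow> 'v \<Rightarrow> complex" where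
  "pairing n \<psi> f =
     (THE l. \<forall>u. range u \<subseteq> H 0 \<and> limitin (ip_topology (H (- n)) (ip (- n))) u \<psi> sequentially
        \<longrightarrow> (\<lambda>k. ip 0 (u k) f) \<longlonglongrightarrow> l)"


section \<open>The space \<open>H_A\<close> and the operators and relations in it\<close>

context
  fixes m :: nat
    and \<phi> :: "'s::finite \<Rightarrow> 'v"
    and G :: "'s \<times> nat \<Rightarrow> 's \<times> nat \<Rightarrow> complex"
begin

definition h_elem :: "'s \<Rightarrow> nat \<Rightarrow> 'v" where
  "h_elem \<sigma> j = (THE x. (x, \<phi> \<sigma>) \<in> rel_shift L_ext z1 ^^ j)"

definition h_comb :: "nat \<Rightarrow> complex ^ 's \<Rightarrow> 'v" where
  "h_comb j c = (\<Sum>\<sigma>\<in>UNIV. (c $ \<sigma>) *\<^sub>C h_elem \<sigma> j)"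

definition idx_A :: "('s \<times> nat) set" where
  "idx_A = UNIV \<times> {1..m}"

definition K_A :: "'v set" where
  "K_A = complex_vector.span {h_elem \<sigma> j | \<sigma> j. (\<sigma>, j) \<in> idx_A}"

text \<open>Vectors in \<open>\<complex>\<^sup>m\<^sup>d\<close> are functions on \<open>'s \<times> nat\<close> of which only the values on \<open>idx_A\<close> matter;
  coordinate vectors are normalised to vanish elsewhere.\<close>

definition coord :: "'v \<Rightarrow> 's \<times> nat \<Rightarrow> complex" where
  "coord k = (THE d. (\<forall>i. i \<notin> idx_A \<longrightarrow> d i = 0) \<and> k = (\<Sum>(\<sigma>, j)\<in>idx_A. d (\<sigma>, j) *\<^sub>C h_elem \<sigma> j))"

definition eta_vec :: "complex ^ 's \<Rightarrow> 's \<times> nat \<Rightarrow> complex" where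
  "eta_vec c = (\<lambda>(\<sigma>, j). if j = m then c $ \<sigma> else 0)"

definition K_min :: "'v set" where
  "K_min = K_A \<inter> H (int m - 2)"

definition H_A :: "'v set" where
  "H_A = {f + k | f k. f \<in> H (int m) \<and> k \<in> K_A}"

definition H_part :: "'v \<Rightarrow> 'v" where
  "H_part x = (THE f. f \<in> H (int m) \<and> x - f \<in> K_A)"

definition K_part :: "'v \<Rightarrow> 'v" where
  "K_part x = x - H_part x"

definition ip_A :: "'v \<Rightarrow> 'v \<Rightarrow> complex" where
  "ip_A x y = ip (int m) (H_part x) (H_part y) +
     (\<Sum>i\<in>idx_A. cnj (coord (K_part x) i) * mat_vec idx_A G (coord (K_part y)) i)"

text \<open>The definite inner product that defines the Hilbert sum topology of \<open>H_A\<close>.\<close>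

definition ip_sum :: "'v \<Rightarrow> 'v \<Rightarrow> complex" where
  "ip_sum x y = ip (int m) (H_part x) (H_part y) +
     (\<Sum>i\<in>idx_A. cnj (coord (K_part x) i) * coord (K_part y) i)"

definition closed_rel_A :: "('v \<times> 'v) set \<Rightarrow> bool" where
  "closed_rel_A T \<longleftrightarrow>
     closedin (prod_topology (ip_topology H_A ip_sum) (ip_topology H_A ip_sum)) T"

definition H_A_min :: "'v set" where
  "H_A_min = {f + k | f k. f \<in> H (int m) \<and> k \<in> K_min}"

definition H_A_perp :: "'v set" where
  "H_A_perp = {y \<in> H_A. \<forall>x\<in>H_A_min. ip_A x y = 0}"

definition M_mat :: "nat \<Rightarrow> nat \<Rightarrow> complex" where
  "M_mat i j = (if i = j then of_real z1 else if j = Suc i then 1 else 0)"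

definition M_d :: "'s \<times> nat \<Rightarrow> 's \<times> nat \<Rightarrow> complex" where
  "M_d = (\<lambda>(\<sigma>, j) (\<sigma>', j'). of_bool (\<sigma> = \<sigma>') * M_mat j j')"

definition G_M :: "'s \<times> nat \<Rightarrow> 's \<times> nat \<Rightarrow> complex" where
  "G_M = mat_mult idx_A G M_d"

text \<open>The common form of \<open>A_max\<close> and \<open>A_max'\<close>, with the matrix \<open>N\<close> acting on the coordinates.\<close>

definition A_op :: "('s \<times> nat \<Rightarrow> 's \<times> nat \<Rightarrow> complex) \<Rightarrow> ('v \<times> 'v) set" where
  "A_op N =
     {(f + h_comb (m + 1) c + k, f' + z1 *\<^sub>C h_comb (m + 1) c + k') | f f' c k k'.
        f \<in> H (int m + 2) \<and> (f, f') \<in> L_scale (int m) \<and> k \<in> K_A \<and> k' \<in> K_A \<and>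
        (\<forall>i\<in>idx_A. coord k' i = mat_vec idx_A N (coord k) i + eta_vec c i)}"

definition A_max :: "('v \<times> 'v) set" where
  "A_max = A_op M_d"

definition A_max' :: "('v \<times> 'v) set" where
  "A_max' = A_op (mat_mult idx_A (mat_inv idx_A G) (mat_adj G_M))"

text \<open>The graph of \<open>\<Gamma> = (\<Gamma>\<^sub>0, \<Gamma>\<^sub>1)\<close>.\<close>

definition Gamma_rel :: "('v \<times> (complex ^ 's) \<times> (complex ^ 's)) set" where
  "Gamma_rel =
     {(f + h_comb (m + 1) c + k,
       (c, \<chi> \<sigma>. pairing (int m + 2) (\<phi> \<sigma>) f - mat_vec idx_A G (coord k) (\<sigma>, m))) | f c k.
        f \<in> H (int m + 2) \<and> k \<in> K_A}"

definition ker_Gamma :: "'v set" where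
  "ker_Gamma = {x. (x, (0, 0)) \<in> Gamma_rel}"

definition A_min :: "('v \<times> 'v) set" where
  "A_min = adjoint_rel H_A ip_A A_max"

definition A_min' :: "('v \<times> 'v) set" where
  "A_min' = rel_restrict A_max ker_Gamma"

definition B_max :: "('v \<times> 'v) set" where
  "B_max = rel_restrict A_max (Domain A_max \<inter> H_A_min) \<oplus>\<^sub>r ({0} \<times> H_A_perp)"

definition B_min :: "('v \<times> 'v) set" where
  "B_min = adjoint_rel H_A ip_A B_max"

end

end

end

(*
  The scale is reduced to the bounded operator (L - z1)^-1 on H 0: a self-adjoint square root R of
  (L - z1)^n has as its domain the closure of dom (L - z1)^n in the form norm, so the spaces H n are
  determined without the uniqueness of the positive root.  As an isometry between dense subspaces,
  L - z1 extends to a unitary map H (n + 2) -> H n for every integer n, and J denotes its inverse for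
  n = m.

  In terms of J every element of dom A_max is J w + h_{m+1}(c) + k.  An element of B_max adds to the
  graph over H_A_min only vectors k' for which the m-th block of G d(k') vanishes, so B_max depends on
  the matrix M_d only through the corner [G_M]_{m,m}.  The hypothesis on G makes this corner Hermitian,
  which is why M_d and G^-1 G_M^* give the same B_max.  The adjoints of B_max and B_min are computed
  from the definition; in the second one, u ranges only over a subspace of finite codimension, the
  orthogonal complement of the h_{sigma,m+1}, and this produces the term h_{m+1}(c).
*)

theory Submission
  imports Defs
begin

section \<open>Inner product spaces on carrier sets\<close>

text \<open>Two features of the setting shape the proof. The spaces of negative index are
  completions given only up to isomorphism, so their vectors can be reached only as limits from
  \<open>H 0\<close>. Facts about them are proved on \<open>H 0\<close>, where the inner products
  are expressed by powers of the resolvent, and are carried over by closure. The vectors h_{sigma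
  j}, on the other hand, are defined through the union of all extensions of L - z1. These extensions
  are shown to be compatible, and a preimage of a vector of \<open>H n\<close> then lies in
  \<open>H (n + 2)\<close> automatically. This regularity passes the independence of the functionals
  modulo H (-m-1) on to the h_{sigma j}: it makes the sum H_A direct, identifies K_min and separates
  h_{m+1}(c) from H (m+2). Finally, the indefinite form arises from the definite one by applying G
  to the coordinates, so every adjoint is closed in the Hilbert sum topology, and it is enough to
  recognise B_max and B_min as adjoints of each other.\<close>

lemma null_squeeze:
  fixes f h :: "nat \<Rightarrow> real"
  shows "h \<longlonglongrightarrow> 0 \<Longrightarrow> (\<And>k. \<bar>f k\<bar> \<le> h k) \<Longrightarrow> f \<longlonglongrightarrow> 0"
  using Lim_null_comparison[of f h sequentially] by simp

text \<open>The form in which continuity is used throughout: \<open>p\<close> and \<open>q\<close>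
  are arbitrary functions, so \<open>q\<close> may be the norm of another space or a norm composed
  with an operator such as \<open>Bi\<close> or \<open>J\<close>.\<close>

lemma tendsto_0_of_bounded:
  assumes "\<forall>v\<in>V. q v \<le> C * p v" "\<And>k. a k \<in> V" "\<And>v. v \<in> V \<Longrightarrow> 0 \<le> q v" "(\<lambda>k. p (a k)) \<longlonglongrightarrow> 0"
  shows "(\<lambda>k. q (a k :: 'a) :: real) \<longlonglongrightarrow> 0"
proof (rule null_squeeze)
  show "(\<lambda>k. C * p (a k)) \<longlonglongrightarrow> 0" using tendsto_mult_right_zero[OF assms(4)] .
qed (use assms in auto)

locale ip_space =
  fixes U :: "'v::complex_vector set" and g :: "'v \<Rightarrow> 'v \<Rightarrow> complex"
  assumes inner_product: "inner_product_on U g"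
begin

abbreviation nrm :: "'v \<Rightarrow> real" where "nrm \<equiv> ip_norm g"

lemma subspace: "complex_vector.subspace U"
  using inner_product unfolding inner_product_on_def by blast

lemma zero_mem [simp]: "0 \<in> U"
  and add_mem [intro]: "x \<in> U \<Longrightarrow> y \<in> U \<Longrightarrow> x + y \<in> U"
  and diff_mem [intro]: "x \<in> U \<Longrightarrow> y \<in> U \<Longrightarrow> x - y \<in> U"
  and scale_mem [intro]: "x \<in> U \<Longrightarrow> a *\<^sub>C x \<in> U"
  by (simp_all add: complex_vector.subspace_0 complex_vector.subspace_add complex_vector.subspace_diff
      complex_vector.subspace_scale subspace)

lemma sum_mem: "(\<And>i. i \<in> I \<Longrightarrow> f i \<in> U) \<Longrightarrow> sum f I \<in> U"
  by (rule complex_vector.subspace_sum[OF subspace])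

lemma ip_add_right: "x \<in> U \<Longrightarrow> y \<in> U \<Longrightarrow> z \<in> U \<Longrightarrow> g x (y + z) = g x y + g x z"
  using inner_product unfolding inner_product_on_def by meson

lemma ip_scale_right: "x \<in> U \<Longrightarrow> y \<in> U \<Longrightarrow> g x (a *\<^sub>C y) = a * g x y"
  using inner_product unfolding inner_product_on_def by meson

lemma ip_commute: "x \<in> U \<Longrightarrow> y \<in> U \<Longrightarrow> g y x = cnj (g x y)"
  using inner_product unfolding inner_product_on_def by meson

lemma ip_pos: "x \<in> U \<Longrightarrow> x \<noteq> 0 \<Longrightarrow> 0 < Re (g x x)"
  using inner_product unfolding inner_product_on_def by meson

lemma ip_add_left: "x \<in> U \<Longrightarrow> y \<in> U \<Longrightarrow> z \<in> U \<Longrightarrow> g (x + y) z = g x z + g y z"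
  by (metis add_mem complex_cnj_add ip_add_right ip_commute)

lemma ip_scale_left: "x \<in> U \<Longrightarrow> y \<in> U \<Longrightarrow> g (a *\<^sub>C x) y = cnj a * g x y"
  by (metis complex_cnj_mult ip_commute ip_scale_right scale_mem)

lemma ip_diff_right: "x \<in> U \<Longrightarrow> y \<in> U \<Longrightarrow> z \<in> U \<Longrightarrow> g x (y - z) = g x y - g x z"
  by (metis add_diff_cancel_right' diff_add_cancel diff_mem ip_add_right)

lemma ip_diff_left: "x \<in> U \<Longrightarrow> y \<in> U \<Longrightarrow> z \<in> U \<Longrightarrow> g (x - y) z = g x z - g y z"
  by (metis add_diff_cancel_right' diff_add_cancel diff_mem ip_add_left)

lemma ip_zero_right [simp]: "x \<in> U \<Longrightarrow> g x 0 = 0"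
  using ip_diff_right[of x x x] by simp

lemma ip_zero_left [simp]: "x \<in> U \<Longrightarrow> g 0 x = 0"
  using ip_diff_left[of x x x] by simp

lemma ip_sum_right:
  "x \<in> U \<Longrightarrow> (\<And>i. i \<in> I \<Longrightarrow> f i \<in> U) \<Longrightarrow> g x (\<Sum>i\<in>I. f i) = (\<Sum>i\<in>I. g x (f i))"
  by (induction I rule: infinite_finite_induct) (auto simp: ip_add_right sum_mem)

lemma ip_sum_left:
  "x \<in> U \<Longrightarrow> (\<And>i. i \<in> I \<Longrightarrow> f i \<in> U) \<Longrightarrow> g (\<Sum>i\<in>I. f i) x = (\<Sum>i\<in>I. g (f i) x)"
  by (induction I rule: infinite_finite_induct) (auto simp: ip_add_left sum_mem)

lemma ip_self: "x \<in> U \<Longrightarrow> g x x = of_real (Re (g x x))"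
  by (metis Reals_cnj_iff ip_commute of_real_Re)

lemma Re_ip_self_nonneg: "x \<in> U \<Longrightarrow> 0 \<le> Re (g x x)"
  by (metis ip_pos ip_zero_left less_eq_real_def zero_complex.simps(1))

lemma ip_self_eq_0: "x \<in> U \<Longrightarrow> g x x = 0 \<Longrightarrow> x = 0"
  using ip_pos by fastforce

lemma nrm_nonneg: "x \<in> U \<Longrightarrow> 0 \<le> nrm x"
  by (simp add: Re_ip_self_nonneg ip_norm_def)

lemma nrm_sq: "x \<in> U \<Longrightarrow> (nrm x)\<^sup>2 = Re (g x x)"
  by (simp add: Re_ip_self_nonneg ip_norm_def)

lemma ip_self_nrm: "x \<in> U \<Longrightarrow> g x x = of_real ((nrm x)\<^sup>2)"
  using ip_self nrm_sq by metis

lemma nrm_zero [simp]: "nrm 0 = 0"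
  by (simp add: ip_norm_def)

lemma nrm_eq_0: "x \<in> U \<Longrightarrow> nrm x = 0 \<longleftrightarrow> x = 0"
  using ip_pos[of x] by (cases "x = 0") (auto simp: ip_norm_def)

lemma nrm_scale: assumes "x \<in> U" shows "nrm (a *\<^sub>C x) = cmod a * nrm x"
proof -
  have "g (a *\<^sub>C x) (a *\<^sub>C x) = cnj a * a * g x x"
    using assms by (simp add: ip_scale_left ip_scale_right scale_mem)
  also have "\<dots> = of_real ((cmod a)\<^sup>2 * (nrm x)\<^sup>2)"
    using ip_self_nrm[OF assms] complex_norm_square[of a] by (simp add: mult.commute)
  finally have "(nrm (a *\<^sub>C x))\<^sup>2 = (cmod a * nrm x)\<^sup>2"
    using nrm_sq[OF scale_mem[OF assms]] by (simp add: power_mult_distrib)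
  thus ?thesis using nrm_nonneg[OF assms] nrm_nonneg[OF scale_mem[OF assms]] by simp
qed

lemma nrm_minus_commute: "x \<in> U \<Longrightarrow> y \<in> U \<Longrightarrow> nrm (x - y) = nrm (y - x)"
  using nrm_scale[of "x - y" "-1"] complex_vector.scale_minus_left[of 1 "x - y"]
  by (simp add: scaleC_one diff_mem)

lemma Cauchy_Schwarz: assumes x: "x \<in> U" and y: "y \<in> U" shows "cmod (g x y) \<le> nrm x * nrm y"
proof (cases "x = 0")
  case True thus ?thesis using y by simp
next
  case False
  define n where "n = Re (g x x)"
  have n: "n > 0" "g x x = of_real n" unfolding n_def using ip_pos[OF x False] ip_self[OF x] by auto
  define a where "a = g x y / of_real n"
  define z where "z = y - a *\<^sub>C x"
  have z: "z \<in> U" unfolding z_def using x y by auto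
  have xz: "g x z = 0"
    unfolding z_def using x y n by (simp add: ip_diff_right ip_scale_right scale_mem a_def)
  have yx: "g y x = cnj (g x y)" using ip_commute x y by blast
  have "g z z = g y z" using xz z x y unfolding z_def
    by (simp add: ip_diff_left ip_scale_left scale_mem diff_mem)
  also have "\<dots> = g y y - a * cnj (g x y)"
    unfolding z_def using x y by (simp add: ip_diff_right ip_scale_right scale_mem yx)
  also have "a * cnj (g x y) = of_real ((cmod (g x y))\<^sup>2 / n)"
    unfolding a_def using complex_norm_square[of "g x y"] by simp
  finally have "Re (g z z) = Re (g y y) - (cmod (g x y))\<^sup>2 / n" by simp
  hence "(cmod (g x y))\<^sup>2 / n \<le> Re (g y y)" using Re_ip_self_nonneg[OF z] by simp
  hence "(cmod (g x y))\<^sup>2 \<le> n * Re (g y y)" using n by (simp add: divide_simps mult.commute)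
  hence "(cmod (g x y))\<^sup>2 \<le> (nrm x * nrm y)\<^sup>2"
    unfolding power_mult_distrib nrm_sq[OF x] nrm_sq[OF y] n_def .
  thus ?thesis by (rule power2_le_imp_le) (simp add: nrm_nonneg x y)
qed

lemma nrm_triangle: assumes x: "x \<in> U" and y: "y \<in> U" shows "nrm (x + y) \<le> nrm x + nrm y"
proof -
  have "Re (g (x + y) (x + y)) = Re (g x x) + Re (g y y) + Re (g x y) + Re (g y x)"
    using x y by (simp add: ip_add_left ip_add_right add_mem)
  moreover have "Re (g y x) = Re (g x y)" using ip_commute[OF x y] by simp
  moreover have "Re (g x y) \<le> nrm x * nrm y"
    using Cauchy_Schwarz[OF x y] complex_Re_le_cmod[of "g x y"] by linarith
  ultimately have "(nrm (x + y))\<^sup>2 \<le> (nrm x + nrm y)\<^sup>2"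
    using nrm_sq[OF x] nrm_sq[OF y] nrm_sq[OF add_mem[OF x y]] by (simp add: power2_sum)
  thus ?thesis by (rule power2_le_imp_le) (simp add: nrm_nonneg x y)
qed

lemma nrm_triangle_diff:
  assumes "x \<in> U" "y \<in> U" "z \<in> U" shows "nrm (x - z) \<le> nrm (x - y) + nrm (y - z)"
  using nrm_triangle[of "x - y" "y - z"] assms by (simp add: diff_mem)

sublocale M: Metric_space U "ip_dist U g"
proof
  fix x y z
  show "0 \<le> ip_dist U g x y" by (simp add: ip_dist_def diff_mem nrm_nonneg)
  show "ip_dist U g x y = ip_dist U g y x" by (simp add: ip_dist_def nrm_minus_commute)
  assume "x \<in> U" "y \<in> U"
  thus "(ip_dist U g x y = 0) = (x = y)" by (simp add: ip_dist_def diff_mem nrm_eq_0)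
  assume "z \<in> U"
  with \<open>x \<in> U\<close> \<open>y \<in> U\<close> show "ip_dist U g x z \<le> ip_dist U g x y + ip_dist U g y z"
    by (simp add: ip_dist_def nrm_triangle_diff)
qed

lemma ip_topology_eq: "ip_topology U g = M.mtopology"
  by (simp add: ip_topology_def)

lemma topspace_ip_topology [simp]: "topspace (ip_topology U g) = U"
  by (simp add: ip_topology_eq)

lemma in_closure_iff:
  "x \<in> ip_topology U g closure_of S \<longleftrightarrow> x \<in> U \<and> (\<forall>e>0. \<exists>y\<in>S. y \<in> U \<and> nrm (x - y) < e)"
  unfolding ip_topology_eq M.metric_closure_of by (auto simp: ip_dist_def)

lemma dense_iff:
  "ip_topology U g closure_of S = U \<longleftrightarrow> (\<forall>x\<in>U. \<forall>e>0. \<exists>y\<in>S. y \<in> U \<and> nrm (x - y) < e)"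
  using in_closure_iff by blast

lemma limitin_iff:
  assumes "range u \<subseteq> U"
  shows "limitin (ip_topology U g) u x sequentially \<longleftrightarrow> x \<in> U \<and> (\<lambda>k. nrm (u k - x)) \<longlonglongrightarrow> 0"
proof -
  have u: "u k \<in> U" for k using assms by blast
  show ?thesis
    unfolding ip_topology_eq M.limitin_metric_dist_null
    using u by (auto simp: ip_dist_def cong: conj_cong)
qed

lemma ip_tendsto:
  assumes a: "\<And>k. a k \<in> U" and b: "\<And>k. b k \<in> U" and x: "x \<in> U" and y: "y \<in> U"
    and ax: "(\<lambda>k. nrm (a k - x)) \<longlonglongrightarrow> 0" and b0: "(\<lambda>k. nrm (b k - y)) \<longlonglongrightarrow> 0"
  shows "(\<lambda>k. g (a k) (b k)) \<longlonglongrightarrow> g x y"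
proof -
  have le: "cmod (g (a k) (b k) - g x y) \<le>
      nrm (a k - x) * nrm (b k - y) + nrm (a k - x) * nrm y + nrm x * nrm (b k - y)" for k
  proof -
    have eq: "g (a k) (b k) - g x y = g (a k - x) (b k - y) + g (a k - x) y + g x (b k - y)"
      using a b x y by (simp add: ip_diff_left ip_diff_right diff_mem)
    have "cmod (g (a k - x) (b k - y)) \<le> nrm (a k - x) * nrm (b k - y)"
      "cmod (g (a k - x) y) \<le> nrm (a k - x) * nrm y" "cmod (g x (b k - y)) \<le> nrm x * nrm (b k - y)"
      using a b x y by (simp_all add: Cauchy_Schwarz diff_mem)
    thus ?thesis unfolding eq
      using norm_triangle_ineq[of "g (a k - x) (b k - y) + g (a k - x) y" "g x (b k - y)"]
        norm_triangle_ineq[of "g (a k - x) (b k - y)" "g (a k - x) y"] by linarith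
  qed
  have "(\<lambda>k. nrm (a k - x) * nrm (b k - y) + nrm (a k - x) * nrm y + nrm x * nrm (b k - y))
      \<longlonglongrightarrow> 0 * 0 + 0 * nrm y + nrm x * 0"
    by (intro tendsto_intros ax b0)
  hence "(\<lambda>k. nrm (a k - x) * nrm (b k - y) + nrm (a k - x) * nrm y + nrm x * nrm (b k - y)) \<longlonglongrightarrow> 0"
    by simp
  hence "(\<lambda>k. g (a k) (b k) - g x y) \<longlonglongrightarrow> 0"
    by (rule Lim_null_comparison[rotated]) (use le in simp)
  thus ?thesis by (simp add: LIM_zero_iff)
qed

lemma tendsto_unique_nrm:
  assumes a: "\<And>k. a k \<in> U" and "x \<in> U" "y \<in> U"
    and "(\<lambda>k. nrm (a k - x)) \<longlonglongrightarrow> 0" "(\<lambda>k. nrm (a k - y)) \<longlonglongrightarrow> 0"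
  shows "x = y"
proof -
  have "(\<lambda>k. nrm (a k - x) + nrm (a k - y)) \<longlonglongrightarrow> 0 + 0" by (intro tendsto_add assms)
  moreover have "nrm (x - y) \<le> nrm (a k - x) + nrm (a k - y)" for k
    using nrm_triangle_diff[of x "a k" y] a[of k] assms(2,3) nrm_minus_commute[of x "a k"] by simp
  ultimately have "nrm (x - y) \<le> 0" using LIMSEQ_le_const[of "\<lambda>k. nrm (a k - x) + nrm (a k - y)"] by auto
  thus ?thesis using nrm_nonneg[of "x - y"] nrm_eq_0[of "x - y"] assms by (simp add: diff_mem)
qed

lemma complete_sequence:
  assumes "hilbert_space_on U g" and u: "\<And>k. u k \<in> U"
    and c: "\<And>e. e > 0 \<Longrightarrow> \<exists>N. \<forall>i\<ge>N. \<forall>j\<ge>N. nrm (u i - u j) < e"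
  shows "\<exists>x\<in>U. (\<lambda>k. nrm (u k - x)) \<longlonglongrightarrow> 0"
proof -
  have "M.MCauchy u" unfolding M.MCauchy_def using u c by (auto simp: ip_dist_def)
  then obtain x where "limitin M.mtopology u x sequentially"
    using assms(1) unfolding hilbert_space_on_def M.mcomplete_def by blast
  thus ?thesis using limitin_iff[of u x] u unfolding ip_topology_eq by blast
qed

lemma dense_sequence:
  assumes "\<forall>e>0. \<exists>y\<in>S. nrm (x - y) < e" "x \<in> U" "S \<subseteq> U"
  shows "\<exists>u. (\<forall>k. u k \<in> S) \<and> (\<lambda>k. nrm (u k - x)) \<longlonglongrightarrow> 0"
proof -
  have "\<forall>k. \<exists>y\<in>S. nrm (x - y) < 1 / real (Suc k)" using assms(1) by simp
  then obtain u where u: "\<And>k. u k \<in> S" "\<And>k. nrm (x - u k) < 1 / real (Suc k)" by metis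
  have "(\<lambda>k. nrm (u k - x)) \<longlonglongrightarrow> 0"
  proof (rule Lim_null_comparison[OF always_eventually])
    show "\<forall>k. norm (nrm (u k - x)) \<le> 1 / real (Suc k)"
    proof
      fix k
      have "u k \<in> U" using u(1) assms(3) by blast
      thus "norm (nrm (u k - x)) \<le> 1 / real (Suc k)"
        using u(2)[of k] nrm_minus_commute[of x "u k"] assms(2) nrm_nonneg[of "u k - x"]
        by (simp add: diff_mem less_imp_le)
    qed
    show "(\<lambda>k. 1 / real (Suc k)) \<longlonglongrightarrow> 0"
      using LIMSEQ_inverse_real_of_nat by (simp add: inverse_eq_divide)
  qed
  thus ?thesis using u(1) by blast
qed

text \<open>Gram-Schmidt by induction on \<open>I\<close>: both \<open>x\<close> and the new vector
  \<open>a j\<close> are made orthogonal to the old vectors before the coefficient of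
  \<open>a j\<close> is chosen. The \<open>a i\<close> may be linearly dependent.\<close>

lemma projection_on_span:
  assumes "finite I" "\<And>i. i \<in> I \<Longrightarrow> a i \<in> U" "x \<in> U"
  shows "\<exists>c. \<forall>i\<in>I. g (a i) (x - (\<Sum>i\<in>I. c i *\<^sub>C a i)) = 0"
  using assms
proof (induction I arbitrary: x rule: finite_induct)
  case empty
  thus ?case by simp
next
  case (insert j I)
  have a: "a i \<in> U" if "i \<in> insert j I" for i using insert.prems that by blast
  have sU: "(\<Sum>i\<in>I. c i *\<^sub>C a i) \<in> U" for c using a by (intro sum_mem) auto
  obtain c where c: "\<forall>i\<in>I. g (a i) (x - (\<Sum>i\<in>I. c i *\<^sub>C a i)) = 0"
    using insert.IH[of x] insert.prems by blast
  obtain b where b: "\<forall>i\<in>I. g (a i) (a j - (\<Sum>i\<in>I. b i *\<^sub>C a i)) = 0"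
    using insert.IH[of "a j"] insert.prems by blast
  define a' where "a' = a j - (\<Sum>i\<in>I. b i *\<^sub>C a i)"
  define y where "y = x - (\<Sum>i\<in>I. c i *\<^sub>C a i)"
  \<comment> \<open>If \<open>a j\<close> depends on the other vectors, then \<open>a' = 0\<close>,
    and division by zero gives \<open>t = 0\<close>; orthogonality to \<open>a'\<close> is trivial
    in that case.\<close>
  define t where "t = g a' y / g a' a'"
  have mem: "a' \<in> U" "y \<in> U" unfolding a'_def y_def using a sU insert.prems by auto
  define d where "d i = (if i = j then t else c i - t * b i)" for i
  have "(\<Sum>i\<in>I. d i *\<^sub>C a i) = (\<Sum>i\<in>I. c i *\<^sub>C a i) - t *\<^sub>C (\<Sum>i\<in>I. b i *\<^sub>C a i)"
  proof -
    have "(\<Sum>i\<in>I. d i *\<^sub>C a i) = (\<Sum>i\<in>I. c i *\<^sub>C a i - t *\<^sub>C b i *\<^sub>C a i)"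
      unfolding d_def using insert.hyps
      by (intro sum.cong) (auto simp: complex_vector.scale_left_diff_distrib)
    thus ?thesis by (simp add: sum_subtractf complex_vector.scale_sum_right)
  qed
  hence d: "x - (\<Sum>i\<in>insert j I. d i *\<^sub>C a i) = y - t *\<^sub>C a'"
    using insert.hyps unfolding y_def a'_def
    by (simp add: d_def complex_vector.scale_right_diff_distrib)
  have I: "g (a i) (y - t *\<^sub>C a') = 0" if "i \<in> I" for i
    using that b c a mem unfolding a'_def[symmetric] y_def[symmetric]
    by (simp add: ip_diff_right ip_scale_right scale_mem)
  have "g a' (y - t *\<^sub>C a') = 0"
  proof (cases "a' = 0")
    case False
    hence "g a' a' \<noteq> 0" using ip_self_eq_0 mem by blast
    thus ?thesis using mem by (simp add: ip_diff_right ip_scale_right scale_mem t_def)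
  qed (use mem in auto)
  moreover have "g (\<Sum>i\<in>I. b i *\<^sub>C a i) (y - t *\<^sub>C a') = 0"
    using I a mem by (simp add: ip_sum_left ip_scale_left scale_mem diff_mem)
  moreover have "g (a j) (y - t *\<^sub>C a') = g a' (y - t *\<^sub>C a') + g (\<Sum>i\<in>I. b i *\<^sub>C a i) (y - t *\<^sub>C a')"
    using ip_add_left[of a' "\<Sum>i\<in>I. b i *\<^sub>C a i" "y - t *\<^sub>C a'"] mem sU
    by (simp add: a'_def diff_mem scale_mem)
  ultimately have "g (a j) (y - t *\<^sub>C a') = 0" by simp
  with I show ?case unfolding d[symmetric] by blast
qed

text \<open>Builds a dual basis: the part of \<open>a j\<close> orthogonal to the other vectors is
  nonzero by independence and is divided by its squared norm. Applied to the h_{sigma,m+1}, this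
  shows that every boundary value is attained.\<close>

lemma prescribed_products:
  assumes fin: "finite I" and a: "\<And>i. i \<in> I \<Longrightarrow> a i \<in> U"
    and indep: "\<And>c. (\<Sum>i\<in>I. c i *\<^sub>C a i) = 0 \<Longrightarrow> \<forall>i\<in>I. c i = 0"
  shows "\<exists>w\<in>U. \<forall>i\<in>I. g (a i) w = v i"
proof -
  have "\<exists>w\<in>U. \<forall>i\<in>I. g (a i) w = of_bool (i = j)" if j: "j \<in> I" for j
  proof -
    obtain c where c: "\<forall>i\<in>I - {j}. g (a i) (a j - (\<Sum>i\<in>I - {j}. c i *\<^sub>C a i)) = 0"
      using projection_on_span[of "I - {j}" a "a j"] fin a j by blast
    define y where "y = a j - (\<Sum>i\<in>I - {j}. c i *\<^sub>C a i)"
    have sU: "(\<Sum>i\<in>I - {j}. c i *\<^sub>C a i) \<in> U" using a by (intro sum_mem) auto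
    have y: "y \<in> U" unfolding y_def using a j sU by auto
    have "y \<noteq> 0"
    proof
      assume "y = 0"
      have "(\<Sum>i\<in>I. (if i = j then 1 else - c i) *\<^sub>C a i) =
          a j + (\<Sum>i\<in>I - {j}. (if i = j then 1 else - c i) *\<^sub>C a i)"
        using fin j by (simp add: sum.remove[of I j] scaleC_one)
      also have "(\<Sum>i\<in>I - {j}. (if i = j then 1 else - c i) *\<^sub>C a i) = - (\<Sum>i\<in>I - {j}. c i *\<^sub>C a i)"
        unfolding sum_negf[symmetric] by (intro sum.cong) auto
      finally show False using indep[of "\<lambda>i. if i = j then 1 else - c i"] \<open>y = 0\<close> j
        unfolding y_def by force
    qed
    hence yy: "g y y \<noteq> 0" using ip_self_eq_0 y by blast
    have 0: "g (a i) y = 0" if "i \<in> I" "i \<noteq> j" for i using c that unfolding y_def by blast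
    have "g (\<Sum>i\<in>I - {j}. c i *\<^sub>C a i) y = 0"
      using 0 a y by (subst ip_sum_left) (auto simp: ip_scale_left)
    moreover have "g (a j) y = g y y + g (\<Sum>i\<in>I - {j}. c i *\<^sub>C a i) y"
      using ip_add_left[OF y sU y] by (simp add: y_def)
    ultimately have "g (a j) y = g y y" by simp
    hence "\<forall>i\<in>I. g (a i) ((1 / g y y) *\<^sub>C y) = of_bool (i = j)"
      using 0 yy a y by (auto simp: ip_scale_right)
    thus ?thesis using y by blast
  qed
  then obtain w where w: "\<And>j. j \<in> I \<Longrightarrow> w j \<in> U \<and> (\<forall>i\<in>I. g (a i) (w j) = of_bool (i = j))" by metis
  have "g (a i) (\<Sum>j\<in>I. v j *\<^sub>C w j) = v i" if "i \<in> I" for i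
  proof -
    have "g (a i) (\<Sum>j\<in>I. v j *\<^sub>C w j) = (\<Sum>j\<in>I. v j * of_bool (i = j))"
      using that a w by (subst ip_sum_right) (auto simp: ip_scale_right intro!: sum.cong)
    thus ?thesis using fin that by simp
  qed
  moreover have "(\<Sum>j\<in>I. v j *\<^sub>C w j) \<in> U" using w by (intro sum_mem) auto
  ultimately show ?thesis by blast
qed

end

text \<open>Relations between two spaces \<open>X\<close> and \<open>Y\<close>, which \<open>linear_relation_on\<close> does not cover.\<close>

definition lin_rel :: "('v::complex_vector \<times> 'v) set \<Rightarrow> bool" where
  "lin_rel T \<longleftrightarrow> (0, 0) \<in> T \<and> (\<forall>(x, x')\<in>T. \<forall>(y, y')\<in>T. (x + y, x' + y') \<in> T) \<and>
     (\<forall>(x, x')\<in>T. \<forall>a. (a *\<^sub>C x, a *\<^sub>C x') \<in> T)"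

lemma lin_relI:
  assumes "(0, 0) \<in> T" "\<And>x x' y y'. (x, x') \<in> T \<Longrightarrow> (y, y') \<in> T \<Longrightarrow> (x + y, x' + y') \<in> T"
    "\<And>x x' a. (x, x') \<in> T \<Longrightarrow> (a *\<^sub>C x, a *\<^sub>C x') \<in> T"
  shows "lin_rel T"
  unfolding lin_rel_def using assms by blast

lemma lin_rel_zero: "lin_rel T \<Longrightarrow> (0, 0) \<in> T"
  and lin_rel_add: "lin_rel T \<Longrightarrow> (x, x') \<in> T \<Longrightarrow> (y, y') \<in> T \<Longrightarrow> (x + y, x' + y') \<in> T"
  and lin_rel_scale: "lin_rel T \<Longrightarrow> (x, x') \<in> T \<Longrightarrow> (a *\<^sub>C x, a *\<^sub>C x') \<in> T"
  unfolding lin_rel_def by blast+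

lemma scaleC_minus_one: "(-1) *\<^sub>C x = - (x :: 'v::complex_vector)"
  using complex_vector.scale_minus_left[of 1 x] by (simp add: scaleC_one)

lemma lin_rel_diff: "lin_rel T \<Longrightarrow> (x, x') \<in> T \<Longrightarrow> (y, y') \<in> T \<Longrightarrow> (x - y, x' - y') \<in> T"
  using lin_rel_add[of T x x' "- y" "- y'"] lin_rel_scale[of T y y' "-1"]
  by (simp add: scaleC_minus_one)

lemma lin_rel_sum:
  "lin_rel T \<Longrightarrow> (\<And>i. i \<in> I \<Longrightarrow> (f i, f' i) \<in> T) \<Longrightarrow> (\<Sum>i\<in>I. f i, \<Sum>i\<in>I. f' i) \<in> T"
  by (induction I rule: infinite_finite_induct) (auto simp: lin_rel_zero lin_rel_add)

lemma linear_relation_on_iff: "linear_relation_on U T \<longleftrightarrow> T \<subseteq> U \<times> U \<and> lin_rel T"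
  unfolding linear_relation_on_def lin_rel_def by blast

lemma lin_rel_converse: "lin_rel T \<Longrightarrow> lin_rel (T\<inverse>)"
  unfolding lin_rel_def by blast

section \<open>Isometric relations between two spaces and their closures\<close>

definition isometric_rel ::
    "('v \<Rightarrow> 'v \<Rightarrow> complex) \<Rightarrow> ('v \<Rightarrow> 'v \<Rightarrow> complex) \<Rightarrow> ('v \<times> 'v) set \<Rightarrow> bool" where
  "isometric_rel p q T \<longleftrightarrow> (\<forall>(x, x')\<in>T. \<forall>(y, y')\<in>T. q x' y' = p x y)"

lemma isometric_relD: "isometric_rel p q T \<Longrightarrow> (x, x') \<in> T \<Longrightarrow> (y, y') \<in> T \<Longrightarrow> q x' y' = p x y"
  unfolding isometric_rel_def by blast

text \<open>Beyond linearity and isometry only domain and range are prescribed: as inner products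
  are definite, such a relation is automatically single valued and injective.\<close>

definition unitary_rel ::
    "'v::complex_vector set \<Rightarrow> ('v \<Rightarrow> 'v \<Rightarrow> complex) \<Rightarrow> 'v set \<Rightarrow> ('v \<Rightarrow> 'v \<Rightarrow> complex) \<Rightarrow>
      ('v \<times> 'v) set \<Rightarrow> bool" where
  "unitary_rel X p Y q T \<longleftrightarrow> lin_rel T \<and> isometric_rel p q T \<and> Domain T = X \<and> Range T = Y"

locale ip_space_pair = X: ip_space X p + Y: ip_space Y q
  for X Y :: "'v::complex_vector set" and p q :: "'v \<Rightarrow> 'v \<Rightarrow> complex"
begin

abbreviation topology_pair where
  "topology_pair \<equiv> prod_topology (ip_topology X p) (ip_topology Y q)"

lemma in_pair_closure_iff:
  assumes "S \<subseteq> X \<times> Y"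
  shows "(x, y) \<in> topology_pair closure_of S \<longleftrightarrow> x \<in> X \<and> y \<in> Y \<and>
    (\<forall>e>0. \<exists>(a, b)\<in>S. ip_norm p (x - a) < e \<and> ip_norm q (y - b) < e)" (is "?L \<longleftrightarrow> ?R")
proof
  assume L: ?L
  have xy: "x \<in> X" "y \<in> Y" using L in_closure_of[of "(x, y)"] by auto
  moreover have "\<exists>(a, b)\<in>S. ip_norm p (x - a) < e \<and> ip_norm q (y - b) < e" if e: "e > 0" for e
  proof -
    have "openin topology_pair (X.M.mball x e \<times> Y.M.mball y e)"
      unfolding X.ip_topology_eq Y.ip_topology_eq by (simp add: openin_prod_Times_iff)
    moreover have "(x, y) \<in> X.M.mball x e \<times> Y.M.mball y e" using xy e by simp
    ultimately have "\<exists>s. s \<in> S \<and> s \<in> X.M.mball x e \<times> Y.M.mball y e"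
      using L unfolding in_closure_of by meson
    then obtain a b where "(a, b) \<in> S" "a \<in> X.M.mball x e" "b \<in> Y.M.mball y e" by auto
    thus ?thesis using xy by (intro bexI[of _ "(a, b)"]) (auto simp: ip_dist_def)
  qed
  ultimately show ?R by blast
next
  assume R: ?R
  show ?L unfolding in_closure_of
  proof (intro conjI allI impI)
    show "(x, y) \<in> topspace topology_pair" using R by simp
    fix T assume T: "(x, y) \<in> T \<and> openin topology_pair T"
    then obtain A B where AB: "openin (ip_topology X p) A" "openin (ip_topology Y q) B"
      "x \<in> A" "y \<in> B" "A \<times> B \<subseteq> T" unfolding openin_prod_topology_alt by blast
    obtain r where r: "r > 0" "X.M.mball x r \<subseteq> A"
      using AB unfolding X.ip_topology_eq X.M.openin_mtopology by blast
    obtain s where s: "s > 0" "Y.M.mball y s \<subseteq> B"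
      using AB unfolding Y.ip_topology_eq Y.M.openin_mtopology by blast
    obtain a b where ab: "(a, b) \<in> S" "ip_norm p (x - a) < min r s" "ip_norm q (y - b) < min r s"
      using R r(1) s(1) by (metis (no_types, lifting) case_prodE min_less_iff_conj)
    have "a \<in> X.M.mball x r" "b \<in> Y.M.mball y s" using ab R assms by (auto simp: ip_dist_def)
    hence "a \<in> A" "b \<in> B" using r s by auto
    thus "\<exists>z. z \<in> S \<and> z \<in> T" using ab AB by blast
  qed
qed

lemma in_pair_closure_sequence:
  assumes "S \<subseteq> X \<times> Y" "(x, y) \<in> topology_pair closure_of S"
  shows "x \<in> X \<and> y \<in> Y \<and> (\<exists>a b. (\<forall>k. (a k, b k) \<in> S) \<and>
    (\<lambda>k. ip_norm p (a k - x)) \<longlonglongrightarrow> 0 \<and> (\<lambda>k. ip_norm q (b k - y)) \<longlonglongrightarrow> 0)"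
proof -
  note R = assms(2)[unfolded in_pair_closure_iff[OF assms(1)]]
  have "\<forall>k. \<exists>a b. (a, b) \<in> S \<and> ip_norm p (x - a) < 1 / real (Suc k) \<and> ip_norm q (y - b) < 1 / real (Suc k)"
  proof
    fix k show "\<exists>a b. (a, b) \<in> S \<and> ip_norm p (x - a) < 1 / real (Suc k) \<and> ip_norm q (y - b) < 1 / real (Suc k)"
      using R[THEN conjunct2, THEN conjunct2, rule_format, of "1 / real (Suc k)"] by auto
  qed
  then obtain a b where ab: "\<And>k. (a k, b k) \<in> S" "\<And>k. ip_norm p (x - a k) < 1 / real (Suc k)"
    "\<And>k. ip_norm q (y - b k) < 1 / real (Suc k)" by metis
  have lim: "(\<lambda>k. 1 / real (Suc k)) \<longlonglongrightarrow> 0"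
    using LIMSEQ_inverse_real_of_nat by (simp add: inverse_eq_divide)
  have mem: "a k \<in> X" "b k \<in> Y" for k using ab(1)[of k] assms(1) by auto
  have "\<forall>k. norm (ip_norm p (a k - x)) \<le> 1 / real (Suc k)"
    using ab(2) X.nrm_minus_commute[of x] X.nrm_nonneg mem R
    by (metis X.diff_mem less_imp_le real_norm_def abs_of_nonneg)
  hence 1: "(\<lambda>k. ip_norm p (a k - x)) \<longlonglongrightarrow> 0"
    by (intro null_squeeze[OF lim]) auto
  have "\<forall>k. norm (ip_norm q (b k - y)) \<le> 1 / real (Suc k)"
    using ab(3) Y.nrm_minus_commute[of y] Y.nrm_nonneg mem R
    by (metis Y.diff_mem less_imp_le real_norm_def abs_of_nonneg)
  hence 2: "(\<lambda>k. ip_norm q (b k - y)) \<longlonglongrightarrow> 0"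
    by (intro null_squeeze[OF lim]) auto
  show ?thesis using R ab(1) 1 2 by blast
qed

lemma sequence_in_pair_closure:
  assumes "S \<subseteq> X \<times> Y" "x \<in> X" "y \<in> Y" "\<And>k. (a k, b k) \<in> S"
    "(\<lambda>k. ip_norm p (a k - x)) \<longlonglongrightarrow> 0" "(\<lambda>k. ip_norm q (b k - y)) \<longlonglongrightarrow> 0"
  shows "(x, y) \<in> topology_pair closure_of S"
  unfolding in_pair_closure_iff[OF assms(1)]
proof (intro conjI allI impI)
  fix e :: real assume e: "e > 0"
  have mem: "a k \<in> X" "b k \<in> Y" for k using assms(1) assms(4)[of k] by auto
  have "\<forall>\<^sub>F k in sequentially. ip_norm p (a k - x) < e" "\<forall>\<^sub>F k in sequentially. ip_norm q (b k - y) < e"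
    using order_tendstoD(2)[OF assms(5) e] order_tendstoD(2)[OF assms(6) e] .
  hence "\<forall>\<^sub>F k in sequentially. ip_norm p (a k - x) < e \<and> ip_norm q (b k - y) < e"
    by (rule eventually_conj)
  then obtain k where "ip_norm p (a k - x) < e" "ip_norm q (b k - y) < e"
    using eventually_happens'[OF sequentially_bot] by blast
  hence "ip_norm p (x - a k) < e" "ip_norm q (y - b k) < e"
    using X.nrm_minus_commute[of x "a k"] Y.nrm_minus_commute[of y "b k"] mem assms by auto
  thus "\<exists>(a, b)\<in>S. ip_norm p (x - a) < e \<and> ip_norm q (y - b) < e" using assms(4)[of k] by blast
qed (use assms in auto)

lemma closure_lin_rel:
  assumes S: "S \<subseteq> X \<times> Y" and lin: "lin_rel S"
  shows "lin_rel (topology_pair closure_of S)"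
proof (rule lin_relI)
  show "(0, 0) \<in> topology_pair closure_of S"
    by (rule sequence_in_pair_closure[OF S, where a="\<lambda>_. 0" and b="\<lambda>_. 0"]) (auto simp: lin_rel_zero lin)
next
  fix x x' y y'
  assume "(x, x') \<in> topology_pair closure_of S" "(y, y') \<in> topology_pair closure_of S"
  then obtain a a' b b' where h: "x \<in> X" "x' \<in> Y" "y \<in> X" "y' \<in> Y"
    "\<And>k. (a k, a' k) \<in> S" "\<And>k. (b k, b' k) \<in> S"
    "(\<lambda>k. ip_norm p (a k - x)) \<longlonglongrightarrow> 0" "(\<lambda>k. ip_norm q (a' k - x')) \<longlonglongrightarrow> 0"
    "(\<lambda>k. ip_norm p (b k - y)) \<longlonglongrightarrow> 0" "(\<lambda>k. ip_norm q (b' k - y')) \<longlonglongrightarrow> 0"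
    using in_pair_closure_sequence[OF S] by metis
  have mem: "a k \<in> X" "b k \<in> X" "a' k \<in> Y" "b' k \<in> Y" for k using h(5,6)[of k] S by auto
  have "(\<lambda>k. ip_norm p (a k - x) + ip_norm p (b k - y)) \<longlonglongrightarrow> 0"
    using tendsto_add[OF h(7,9)] by simp
  moreover have "\<bar>ip_norm p ((a k + b k) - (x + y))\<bar> \<le> ip_norm p (a k - x) + ip_norm p (b k - y)" for k
    using X.nrm_triangle[of "a k - x" "b k - y"] X.nrm_nonneg[of "(a k - x) + (b k - y)"] mem h
    by (simp add: X.diff_mem X.add_mem algebra_simps)
  ultimately have 1: "(\<lambda>k. ip_norm p ((a k + b k) - (x + y))) \<longlonglongrightarrow> 0"
    by (rule null_squeeze)
  have "(\<lambda>k. ip_norm q (a' k - x') + ip_norm q (b' k - y')) \<longlonglongrightarrow> 0"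
    using tendsto_add[OF h(8,10)] by simp
  moreover have "\<bar>ip_norm q ((a' k + b' k) - (x' + y'))\<bar> \<le> ip_norm q (a' k - x') + ip_norm q (b' k - y')" for k
    using Y.nrm_triangle[of "a' k - x'" "b' k - y'"] Y.nrm_nonneg[of "(a' k - x') + (b' k - y')"] mem h
    by (simp add: Y.diff_mem Y.add_mem algebra_simps)
  ultimately have 2: "(\<lambda>k. ip_norm q ((a' k + b' k) - (x' + y'))) \<longlonglongrightarrow> 0"
    by (rule null_squeeze)
  show "(x + y, x' + y') \<in> topology_pair closure_of S"
    by (rule sequence_in_pair_closure[OF S _ _ _ 1 2]) (use h lin in \<open>auto intro: lin_rel_add\<close>)
next
  fix x x' c
  assume "(x, x') \<in> topology_pair closure_of S"
  then obtain a a' where h: "x \<in> X" "x' \<in> Y" "\<And>k. (a k, a' k) \<in> S"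
    "(\<lambda>k. ip_norm p (a k - x)) \<longlonglongrightarrow> 0" "(\<lambda>k. ip_norm q (a' k - x')) \<longlonglongrightarrow> 0"
    using in_pair_closure_sequence[OF S] by metis
  have mem: "a k \<in> X" "a' k \<in> Y" for k using h(3)[of k] S by auto
  have "ip_norm p (c *\<^sub>C a k - c *\<^sub>C x) = cmod c * ip_norm p (a k - x)"
    "ip_norm q (c *\<^sub>C a' k - c *\<^sub>C x') = cmod c * ip_norm q (a' k - x')" for k
    using X.nrm_scale[of "a k - x" c] Y.nrm_scale[of "a' k - x'" c] mem h
    by (simp_all add: X.diff_mem Y.diff_mem complex_vector.scale_right_diff_distrib)
  hence 1: "(\<lambda>k. ip_norm p (c *\<^sub>C a k - c *\<^sub>C x)) \<longlonglongrightarrow> 0" and 2: "(\<lambda>k. ip_norm q (c *\<^sub>C a' k - c *\<^sub>C x')) \<longlonglongrightarrow> 0"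
    using tendsto_mult_right_zero[OF h(4), of "cmod c"] tendsto_mult_right_zero[OF h(5), of "cmod c"] by simp_all
  show "(c *\<^sub>C x, c *\<^sub>C x') \<in> topology_pair closure_of S"
    by (rule sequence_in_pair_closure[OF S _ _ _ 1 2]) (use h lin in \<open>auto intro: lin_rel_scale\<close>)
qed

lemma closure_isometric:
  assumes S: "S \<subseteq> X \<times> Y" and iso: "isometric_rel p q S"
  shows "isometric_rel p q (topology_pair closure_of S)"
proof -
  have "q x' y' = p x y"
    if "(x, x') \<in> topology_pair closure_of S" "(y, y') \<in> topology_pair closure_of S" for x x' y y'
  proof -
    from that obtain a a' b b' where h: "x \<in> X" "x' \<in> Y" "y \<in> X" "y' \<in> Y"
      "\<And>k. (a k, a' k) \<in> S" "\<And>k. (b k, b' k) \<in> S"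
      "(\<lambda>k. ip_norm p (a k - x)) \<longlonglongrightarrow> 0" "(\<lambda>k. ip_norm q (a' k - x')) \<longlonglongrightarrow> 0"
      "(\<lambda>k. ip_norm p (b k - y)) \<longlonglongrightarrow> 0" "(\<lambda>k. ip_norm q (b' k - y')) \<longlonglongrightarrow> 0"
      using in_pair_closure_sequence[OF S] by metis
    have mem: "a k \<in> X" "b k \<in> X" "a' k \<in> Y" "b' k \<in> Y" for k using h(5,6)[of k] S by auto
    have "q (a' k) (b' k) = p (a k) (b k)" for k
      using iso h(5,6)[of k] unfolding isometric_rel_def by blast
    moreover have "(\<lambda>k. p (a k) (b k)) \<longlonglongrightarrow> p x y" "(\<lambda>k. q (a' k) (b' k)) \<longlonglongrightarrow> q x' y'"
      by (intro X.ip_tendsto Y.ip_tendsto mem h)+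
    ultimately show ?thesis using LIMSEQ_unique by simp
  qed
  thus ?thesis unfolding isometric_rel_def by blast
qed

text \<open>Extension of a densely defined isometry by continuity: \<open>S\<close> carries a
  sequence that approximates \<open>x\<close> to a Cauchy sequence, and completeness of
  \<open>Y\<close> supplies the image of \<open>x\<close>.\<close>

lemma closure_domain:
  assumes S: "S \<subseteq> X \<times> Y" and lin: "lin_rel S" and iso: "isometric_rel p q S"
    and compl: "hilbert_space_on Y q"
    and dense: "\<forall>x\<in>X. \<forall>e>0. \<exists>y\<in>Domain S. ip_norm p (x - y) < e"
  shows "Domain (topology_pair closure_of S) = X"
proof
  show "Domain (topology_pair closure_of S) \<subseteq> X"
    using in_pair_closure_sequence[OF S] by blast
  show "X \<subseteq> Domain (topology_pair closure_of S)"
  proof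
    fix x assume x: "x \<in> X"
    have "Domain S \<subseteq> X" using S by blast
    then obtain a where a: "\<And>k. a k \<in> Domain S" "(\<lambda>k. ip_norm p (a k - x)) \<longlonglongrightarrow> 0"
      using X.dense_sequence[of "Domain S" x] dense x by blast
    hence "\<forall>k. \<exists>y. (a k, y) \<in> S" by blast
    then obtain b where b: "\<And>k. (a k, b k) \<in> S" by metis
    have mem: "a k \<in> X" "b k \<in> Y" for k using b[of k] S by auto
    have nb: "ip_norm q (b i - b j) = ip_norm p (a i - a j)" for i j
      using iso lin_rel_diff[OF lin b[of i] b[of j]] unfolding isometric_rel_def ip_norm_def by fastforce
    have "\<exists>N. \<forall>i\<ge>N. \<forall>j\<ge>N. ip_norm q (b i - b j) < e" if "e > 0" for e
    proof -
      have "\<forall>\<^sub>F k in sequentially. ip_norm p (a k - x) < e / 2"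
        using order_tendstoD(2)[OF a(2), of "e / 2"] that by simp
      then obtain N where N: "\<And>k. k \<ge> N \<Longrightarrow> ip_norm p (a k - x) < e / 2"
        unfolding eventually_sequentially by blast
      have "ip_norm q (b i - b j) < e" if "i \<ge> N" "j \<ge> N" for i j
        using N[OF that(1)] N[OF that(2)] X.nrm_triangle_diff[of "a i" x "a j"]
          X.nrm_minus_commute[of x "a j"] mem x nb[of i j] by simp
      thus ?thesis by blast
    qed
    then obtain y where "y \<in> Y" "(\<lambda>k. ip_norm q (b k - y)) \<longlonglongrightarrow> 0"
      using Y.complete_sequence[OF compl, of b] mem by blast
    thus "x \<in> Domain (topology_pair closure_of S)"
      using sequence_in_pair_closure[OF S x _ b a(2)] by blast
  qed
qed

end

lemma pair_closure_converse:
  fixes X Y :: "'v::complex_vector set"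
  assumes "ip_space X p" "ip_space Y q" "S \<subseteq> X \<times> Y"
  shows "prod_topology (ip_topology Y q) (ip_topology X p) closure_of (S\<inverse>)
    = (prod_topology (ip_topology X p) (ip_topology Y q) closure_of S)\<inverse>"
proof -
  interpret XY: ip_space_pair X Y p q using assms by (simp add: ip_space_pair_def)
  interpret YX: ip_space_pair Y X q p using assms by (simp add: ip_space_pair_def)
  have S': "S\<inverse> \<subseteq> Y \<times> X" using assms by blast
  have "(y, x) \<in> YX.topology_pair closure_of (S\<inverse>) \<longleftrightarrow> (x, y) \<in> XY.topology_pair closure_of S" for x y
    unfolding XY.in_pair_closure_iff[OF assms(3)] YX.in_pair_closure_iff[OF S'] by fast
  thus ?thesis by (auto simp del: converse_iff simp: converse_def)
qed

text \<open>The statement on the range is the statement on the domain for the converse relation,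
  whose closure is the converse of the closure.\<close>

lemma closure_unitary:
  assumes X: "hilbert_space_on X p" and Y: "hilbert_space_on Y q"
    and S: "S \<subseteq> X \<times> Y" and lin: "lin_rel S" and iso: "isometric_rel p q S"
    and dense: "\<forall>x\<in>X. \<forall>e>0. \<exists>y\<in>Domain S. ip_norm p (x - y) < e"
      "\<forall>x\<in>Y. \<forall>e>0. \<exists>y\<in>Range S. ip_norm q (x - y) < e"
  shows "unitary_rel X p Y q (prod_topology (ip_topology X p) (ip_topology Y q) closure_of S)"
proof -
  have ips: "ip_space X p" "ip_space Y q" using X Y by (simp_all add: ip_space_def hilbert_space_on_def)
  interpret XY: ip_space_pair X Y p q using ips by (simp add: ip_space_pair_def)
  interpret YX: ip_space_pair Y X q p using ips by (simp add: ip_space_pair_def)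
  have S': "S\<inverse> \<subseteq> Y \<times> X" and iso': "isometric_rel q p (S\<inverse>)"
    using S iso unfolding isometric_rel_def by fastforce+
  have "Domain (YX.topology_pair closure_of (S\<inverse>)) = Y"
    by (rule YX.closure_domain[OF S' lin_rel_converse[OF lin] iso' X]) (use dense in simp)
  hence "Range (XY.topology_pair closure_of S) = Y"
    unfolding pair_closure_converse[OF ips S] by simp
  thus ?thesis unfolding unitary_rel_def
    using XY.closure_domain[OF S lin iso Y dense(1)] XY.closure_isometric[OF S iso]
      XY.closure_lin_rel[OF S lin] by blast
qed

lemma unitary_inj:
  assumes "unitary_rel X p Y q T" "inner_product_on X p" "(x, y) \<in> T" "(x', y) \<in> T"
  shows "x = x'"
proof -
  interpret ip_space X p using assms by (simp add: ip_space_def)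
  have T: "lin_rel T" "isometric_rel p q T" "Domain T = X" using assms unfolding unitary_rel_def by auto
  have d: "(x - x', 0) \<in> T" "(0, 0) \<in> T" using lin_rel_diff[OF T(1) assms(3,4)] lin_rel_zero[OF T(1)] by auto
  have "x - x' \<in> X" using d(1) T(3) by blast
  moreover have "p (x - x') (x - x') = p 0 0" using isometric_relD[OF T(2) d(1) d(1)] isometric_relD[OF T(2) d(2) d(2)] by simp
  ultimately show ?thesis using ip_self_eq_0[of "x - x'"] by simp
qed

lemma unitary_converse: "unitary_rel X p Y q T \<Longrightarrow> unitary_rel Y q X p (T\<inverse>)"
  unfolding unitary_rel_def isometric_rel_def by (fastforce simp: lin_rel_converse)

lemma unitary_single_valued:
  assumes "unitary_rel X p Y q T" "inner_product_on Y q" "(x, y) \<in> T" "(x, y') \<in> T"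
  shows "y = y'"
  using unitary_inj[OF unitary_converse[OF assms(1)] assms(2)] assms(3,4) by simp

lemma unitary_nrm: "unitary_rel X p Y q T \<Longrightarrow> (x, y) \<in> T \<Longrightarrow> ip_norm p x = ip_norm q y"
  unfolding unitary_rel_def isometric_rel_def ip_norm_def by fastforce

lemma unitary_sub: "unitary_rel X p Y q T \<Longrightarrow> T \<subseteq> X \<times> Y"
  unfolding unitary_rel_def by auto

section \<open>The Hilbert scale\<close>

locale hscale =
  fixes H :: "int \<Rightarrow> 'v::complex_vector set"
    and ip :: "int \<Rightarrow> 'v \<Rightarrow> 'v \<Rightarrow> complex"
    and L :: "('v \<times> 'v) set"
    and z1 :: real
  assumes self_adjoint: "self_adjoint_operator (H 0) (ip 0) L"
    and z1_res: "complex_of_real z1 \<in> resolvent_set (H 0) (ip 0) L"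
    and scale: "hilbert_scale H ip L z1"
begin

section \<open>The operator L - z1 and its bounded inverse in \<open>H 0\<close>\<close>

definition B :: "('v \<times> 'v) set" where "B = rel_shift L z1"

lemma hilbert: "hilbert_space_on (H n) (ip n)"
  using scale unfolding hilbert_scale_def by blast

lemma inner: "inner_product_on (H n) (ip n)"
  using hilbert unfolding hilbert_space_on_def by blast

sublocale H: ip_space "H n" "ip n" for n
  by unfold_locales (rule inner)

sublocale HH: ip_space_pair "H n" "H k" "ip n" "ip k" for n k
  by unfold_locales

abbreviation nrm :: "int \<Rightarrow> 'v \<Rightarrow> real" where "nrm n \<equiv> ip_norm (ip n)"

lemma L_lin: "lin_rel L" and L_sub: "L \<subseteq> H 0 \<times> H 0"
  using self_adjoint unfolding self_adjoint_operator_def linear_relation_on_iff by auto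

lemma L_symmetric: "(x, x') \<in> L \<Longrightarrow> (y, y') \<in> L \<Longrightarrow> ip 0 x y' = ip 0 x' y"
proof -
  assume "(x, x') \<in> L" "(y, y') \<in> L"
  moreover have "adjoint_rel (H 0) (ip 0) L = L" using self_adjoint unfolding self_adjoint_operator_def by blast
  ultimately show ?thesis unfolding adjoint_rel_def by blast
qed

lemma in_B: "(x, w) \<in> B \<longleftrightarrow> (x, w + z1 *\<^sub>C x) \<in> L"
  unfolding B_def rel_shift_def by force

lemma B_sub: "B \<subseteq> H 0 \<times> H 0"
proof (rule subrelI)
  fix x w assume "(x, w) \<in> B"
  hence "x \<in> H 0" "w + z1 *\<^sub>C x \<in> H 0" using L_sub in_B by auto
  thus "(x, w) \<in> H 0 \<times> H 0" using H.diff_mem[of "w + z1 *\<^sub>C x" 0 "z1 *\<^sub>C x"] H.scale_mem by auto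
qed

lemma B_lin: "lin_rel B"
proof (rule lin_relI)
  show "(0, 0) \<in> B" using lin_rel_zero[OF L_lin] by (simp add: in_B)
  show "(x + y, x' + y') \<in> B" if "(x, x') \<in> B" "(y, y') \<in> B" for x x' y y'
    using lin_rel_add[OF L_lin that[unfolded in_B]]
    by (simp add: in_B complex_vector.scale_right_distrib algebra_simps)
  show "(a *\<^sub>C x, a *\<^sub>C x') \<in> B" if "(x, x') \<in> B" for x x' a
    using lin_rel_scale[OF L_lin that[unfolded in_B], of a]
    by (simp add: in_B complex_vector.scale_right_distrib scaleC_scaleC mult.commute)
qed

lemma B_symmetric: assumes "(x, x') \<in> B" "(y, y') \<in> B" shows "ip 0 x y' = ip 0 x' y"
proof -
  have m: "x \<in> H 0" "x' \<in> H 0" "y \<in> H 0" "y' \<in> H 0" using assms B_sub by auto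
  have "ip 0 x (y' + z1 *\<^sub>C y) = ip 0 (x' + z1 *\<^sub>C x) y"
    using L_symmetric assms unfolding in_B by blast
  thus ?thesis using m by (simp add: H.ip_add_left H.ip_add_right H.ip_scale_left H.ip_scale_right H.scale_mem)
qed

lemma B_ex1: "y \<in> H 0 \<Longrightarrow> \<exists>!x. (x, y) \<in> B"
  using z1_res unfolding resolvent_set_def B_def by blast

definition Bi :: "'v \<Rightarrow> 'v" where "Bi y = (THE x. (x, y) \<in> B)"

lemma in_B_iff: "(x, y) \<in> B \<longleftrightarrow> y \<in> H 0 \<and> x = Bi y"
  using theI'[OF B_ex1] B_ex1 B_sub unfolding Bi_def by blast

lemma Bi_mem: "y \<in> H 0 \<Longrightarrow> Bi y \<in> H 0"
  using in_B_iff[of "Bi y" y] B_sub by blast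

lemma Bi_add: "x \<in> H 0 \<Longrightarrow> y \<in> H 0 \<Longrightarrow> Bi (x + y) = Bi x + Bi y"
  using lin_rel_add[OF B_lin, of "Bi x" x "Bi y" y] in_B_iff by auto

lemma Bi_scale: "x \<in> H 0 \<Longrightarrow> Bi (a *\<^sub>C x) = a *\<^sub>C Bi x"
  using lin_rel_scale[OF B_lin, of "Bi x" x a] in_B_iff by auto

lemma Bi_symmetric: "x \<in> H 0 \<Longrightarrow> y \<in> H 0 \<Longrightarrow> ip 0 (Bi x) y = ip 0 x (Bi y)"
  using B_symmetric in_B_iff by blast

lemma B_single_valued: "(x, y) \<in> B \<Longrightarrow> (x, y') \<in> B \<Longrightarrow> y = y'"
proof -
  assume "(x, y) \<in> B" "(x, y') \<in> B"
  moreover have "single_valued L" using self_adjoint unfolding self_adjoint_operator_def by blast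
  ultimately show ?thesis unfolding in_B by (metis add_right_cancel single_valuedD)
qed

lemma Bi_bounded: "\<exists>C\<ge>0. \<forall>y\<in>H 0. nrm 0 (Bi y) \<le> C * nrm 0 y"
proof -
  obtain C where "\<forall>(x, y)\<in>B. nrm 0 x \<le> C * nrm 0 y"
    using z1_res unfolding resolvent_set_def B_def by blast
  hence C: "nrm 0 (Bi y) \<le> C * nrm 0 y" if "y \<in> H 0" for y using that in_B_iff by blast
  have "nrm 0 (Bi y) \<le> \<bar>C\<bar> * nrm 0 y" if "y \<in> H 0" for y
    using C[OF that] mult_right_mono[OF abs_ge_self[of C] H.nrm_nonneg[OF that]] by linarith
  thus ?thesis by (intro exI[of _ "\<bar>C\<bar>"]) auto
qed

definition P :: "nat \<Rightarrow> 'v \<Rightarrow> 'v" where "P n = Bi ^^ n"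

lemma P_0 [simp]: "P 0 y = y"
  and P_Suc: "P (Suc n) y = Bi (P n y)"
  and P_Suc2: "P (Suc n) y = P n (Bi y)"
  and P_add: "P (n + k) y = P n (P k y)"
  by (simp_all add: P_def funpow_swap1 funpow_add)

lemma P_mem: "y \<in> H 0 \<Longrightarrow> P n y \<in> H 0"
  by (induction n) (auto simp: P_Suc Bi_mem)

text \<open>Linearity is stated for pairs of powers because such pairs form the core on which L - z1
  is shown to be isometric.\<close>

lemma P_linear: "lin_rel {(P n y, P k y) | y. y \<in> H 0}"
proof (rule lin_relI)
  have add: "P n (x + y) = P n x + P n y" if "x \<in> H 0" "y \<in> H 0" for n x y
    using that by (induction n) (auto simp: P_Suc Bi_add P_mem)
  have scale: "P n (a *\<^sub>C x) = a *\<^sub>C P n x" if "x \<in> H 0" for n a x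
    using that by (induction n) (auto simp: P_Suc Bi_scale P_mem)
  have "P n 0 = 0" for n using scale[of 0 n 0] by simp
  thus "(0, 0) \<in> {(P n y, P k y) | y. y \<in> H 0}" by (auto intro!: exI[of _ 0])
  show "(x + y, x' + y') \<in> {(P n y, P k y) | y. y \<in> H 0}"
    if "(x, x') \<in> {(P n y, P k y) | y. y \<in> H 0}" "(y, y') \<in> {(P n y, P k y) | y. y \<in> H 0}" for x x' y y'
    using that add by (auto intro: H.add_mem) (metis H.add_mem)
  show "(a *\<^sub>C x, a *\<^sub>C x') \<in> {(P n y, P k y) | y. y \<in> H 0}"
    if "(x, x') \<in> {(P n y, P k y) | y. y \<in> H 0}" for x x' a
    using that scale by (auto intro: H.scale_mem) (metis H.scale_mem)
qed

lemma P_bounded: "\<exists>C\<ge>0. \<forall>y\<in>H 0. nrm 0 (P n y) \<le> C * nrm 0 y"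
proof (induction n)
  case 0 show ?case by (intro exI[of _ 1]) auto
next
  case (Suc n)
  then obtain C where C: "C \<ge> 0" "\<forall>y\<in>H 0. nrm 0 (P n y) \<le> C * nrm 0 y" by blast
  obtain D where D: "D \<ge> 0" "\<forall>y\<in>H 0. nrm 0 (Bi y) \<le> D * nrm 0 y" using Bi_bounded by blast
  have "nrm 0 (P (Suc n) y) \<le> (D * C) * nrm 0 y" if "y \<in> H 0" for y
  proof -
    have "nrm 0 (P (Suc n) y) \<le> D * nrm 0 (P n y)" using D P_mem that by (simp add: P_Suc)
    also have "\<dots> \<le> D * (C * nrm 0 y)" using C D that by (intro mult_left_mono) auto
    finally show ?thesis by (simp add: mult.assoc)
  qed
  thus ?case using C D by (intro exI[of _ "D * C"]) auto
qed

text \<open>The condition \<open>y \<in> H 0\<close> stands on both sides for the sake of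
  \<open>n = 0\<close>, where \<open>B ^^ 0\<close> is the identity of the whole type.\<close>

lemma B_power: "(x, y) \<in> B ^^ n \<and> y \<in> H 0 \<longleftrightarrow> y \<in> H 0 \<and> x = P n y"
proof (induction n arbitrary: x y)
  case 0 thus ?case by auto
next
  case (Suc n)
  have "(x, y) \<in> B ^^ Suc n \<and> y \<in> H 0 \<longleftrightarrow> (\<exists>w. (x, w) \<in> B ^^ n \<and> (w, y) \<in> B) \<and> y \<in> H 0" by auto
  also have "\<dots> \<longleftrightarrow> (\<exists>w. ((x, w) \<in> B ^^ n \<and> w \<in> H 0) \<and> (w, y) \<in> B) \<and> y \<in> H 0"
    using B_sub by blast
  also have "\<dots> \<longleftrightarrow> y \<in> H 0 \<and> x = P (Suc n) y"
    unfolding Suc in_B_iff by (auto simp: P_Suc2 Bi_mem)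
  finally show ?case .
qed

section \<open>Square roots of the powers of L - z1 and the spaces that they define\<close>

lemma b_op_nonneg: "b_op H L z1 (int n) = {(P n y, y) | y. y \<in> H 0}"
proof -
  have "b_op H L z1 (int n) = Restr (B ^^ n) (H 0)" by (simp add: b_op_def B_def)
  also have "\<dots> = {(P n y, y) | y. y \<in> H 0}" using B_power P_mem by blast
  finally show ?thesis .
qed

lemma b_op_neg: "b_op H L z1 (- int n) = {(y, P n y) | y. y \<in> H 0}"
proof (cases "n = 0")
  case True thus ?thesis using b_op_nonneg[of 0] by simp
next
  case False
  hence "b_op H L z1 (- int n) = (b_op H L z1 (int n))\<inverse>" by (simp add: b_op_def)
  thus ?thesis unfolding b_op_nonneg by blast
qed

text \<open>The inverse of the root of \<open>(L - z1)\<^sup>n\<close> for \<open>n \<ge> 0\<close>, an everywhere defined operator in \<open>H 0\<close>.\<close>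

definition is_inv_root :: "nat \<Rightarrow> ('v \<Rightarrow> 'v) \<Rightarrow> bool" where
  "is_inv_root n S \<longleftrightarrow>
    (\<forall>y\<in>H 0. S y \<in> H 0 \<and> S (S y) = P n y) \<and>
    (\<forall>x\<in>H 0. \<forall>y\<in>H 0. ip 0 (S x) y = ip 0 x (S y) \<and> S (x - y) = S x - S y \<and>
      ip (int n) (S x) (S y) = ip 0 x y) \<and>
    H (int n) = S ` H 0 \<and> (\<forall>x\<in>H 0. \<forall>e>0. \<exists>y\<in>H 0. nrm 0 (x - S y) < e)"

text \<open>\<open>S\<close> is the inverse of a root \<open>R\<close>. As \<open>R O R\<close> is
  the graph of the inverse of \<open>P n\<close>, \<open>R\<close> is onto \<open>H 0\<close>, and
  its kernel vanishes because it lies in that of \<open>R O R\<close>. Symmetry of \<open>S\<close>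
  comes from self-adjointness of \<open>R\<close>, density of its range from density of the domain
  of \<open>R\<close>.\<close>

lemma ex_inv_root: "\<exists>S. is_inv_root n S"
proof -
  obtain R where R: "positive_root (H 0) (ip 0) (b_op H L z1 (int n)) R" "H (int n) = Domain R"
    "\<forall>(x, x')\<in>R. \<forall>(y, y')\<in>R. ip (int n) x y = ip 0 x' y'"
    using scale[unfolded hilbert_scale_def, THEN conjunct2, THEN conjunct1, rule_format, of "int n"] by auto
  have RR: "R O R = {(P n y, y) | y. y \<in> H 0}" and Radj: "adjoint_rel (H 0) (ip 0) R = R"
    and Rlin: "lin_rel R" and Rsub: "R \<subseteq> H 0 \<times> H 0"
    and Rdense: "ip_topology (H 0) (ip 0) closure_of Domain R = H 0"
    using R(1) unfolding positive_root_def self_adjoint_operator_def linear_relation_on_iff b_op_nonneg by auto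
  have surj: "\<exists>x. (x, y) \<in> R" if "y \<in> H 0" for y using RR that by blast
  have inj: "x = x'" if "(x, y) \<in> R" "(x', y) \<in> R" for x x' y
  proof -
    have "(x - x', 0) \<in> R" using lin_rel_diff[OF Rlin that] by simp
    hence "(x - x', 0) \<in> R O R" using lin_rel_zero[OF Rlin] by blast
    hence "x - x' = P n 0" using RR by blast
    moreover have "P n 0 = 0"
    proof -
      have "(0, 0) \<in> R O R" using lin_rel_zero[OF Rlin] by blast
      thus ?thesis using RR by auto
    qed
    ultimately show ?thesis by simp
  qed
  define S where "S y = (THE x. (x, y) \<in> R)" for y
  have RS: "(x, y) \<in> R \<longleftrightarrow> y \<in> H 0 \<and> x = S y" for x y
  proof
    assume "(x, y) \<in> R"
    thus "y \<in> H 0 \<and> x = S y" using Rsub inj unfolding S_def by (auto intro!: the_equality[symmetric])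
  next
    assume "y \<in> H 0 \<and> x = S y"
    thus "(x, y) \<in> R" using surj[of y] inj unfolding S_def by (metis theI)
  qed
  have 1: "S y \<in> H 0" if "y \<in> H 0" for y using RS[of "S y" y] Rsub that by auto
  have 2: "S (S y) = P n y" if y: "y \<in> H 0" for y
  proof -
    have "(S (S y), y) \<in> R O R" using RS 1 y by (auto intro!: relcompI)
    thus ?thesis unfolding RR by auto
  qed
  have 3: "ip 0 (S x) y = ip 0 x (S y)" if "x \<in> H 0" "y \<in> H 0" for x y
  proof -
    have "(S x, x) \<in> R" "(S y, y) \<in> adjoint_rel (H 0) (ip 0) R" using RS that Radj by auto
    thus ?thesis unfolding adjoint_rel_def by blast
  qed
  have 4: "S (x - y) = S x - S y" if "x \<in> H 0" "y \<in> H 0" for x y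
    using lin_rel_diff[OF Rlin, of "S x" x "S y" y] that by (simp add: RS)
  have 5: "H (int n) = S ` H 0" unfolding R(2) using RS by auto
  have 6: "ip (int n) (S x) (S y) = ip 0 x y" if "x \<in> H 0" "y \<in> H 0" for x y
  proof -
    have "(S x, x) \<in> R" "(S y, y) \<in> R" using RS that by auto
    thus ?thesis using R(3) by blast
  qed
  have 7: "\<exists>y\<in>H 0. nrm 0 (x - S y) < e" if "x \<in> H 0" "e > 0" for x e
    using Rdense[unfolded H.dense_iff, rule_format, OF that] RS by auto
  have "is_inv_root n S" unfolding is_inv_root_def using 1 2 3 4 5 6 7 by simp
  thus ?thesis by blast
qed

definition S :: "nat \<Rightarrow> 'v \<Rightarrow> 'v" where "S n = (SOME S. is_inv_root n S)"

lemma S_root: "is_inv_root n (S n)"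
  unfolding S_def by (rule someI_ex[OF ex_inv_root])

lemma S_mem: "y \<in> H 0 \<Longrightarrow> S n y \<in> H 0"
  and S_S: "y \<in> H 0 \<Longrightarrow> S n (S n y) = P n y"
  and S_symmetric: "x \<in> H 0 \<Longrightarrow> y \<in> H 0 \<Longrightarrow> ip 0 (S n x) y = ip 0 x (S n y)"
  and S_diff: "x \<in> H 0 \<Longrightarrow> y \<in> H 0 \<Longrightarrow> S n (x - y) = S n x - S n y"
  and H_eq_S: "H (int n) = S n ` H 0"
  and ip_S: "x \<in> H 0 \<Longrightarrow> y \<in> H 0 \<Longrightarrow> ip (int n) (S n x) (S n y) = ip 0 x y"
  and S_dense: "x \<in> H 0 \<Longrightarrow> e > 0 \<Longrightarrow> \<exists>y\<in>H 0. nrm 0 (x - S n y) < e"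
  using S_root[of n] unfolding is_inv_root_def by meson+

text \<open>With \<open>(x, x')\<close> and \<open>(y, y')\<close> in a root \<open>R\<close> of
  \<open>P n\<close>, symmetry moves one factor: the product of \<open>x'\<close> and
  \<open>y'\<close> is that of \<open>x\<close> with \<open>P n y\<close>, the image of
  \<open>y'\<close> under \<open>R\<close>. On \<open>H 0\<close> the result no longer depends on
  the root.\<close>

lemma ip_neg: assumes "x \<in> H 0" "y \<in> H 0" shows "ip (- int n) x y = ip 0 x (P n y)"
proof -
  obtain R where R: "positive_root (H 0) (ip 0) (b_op H L z1 (- int n)) R"
    "\<forall>(x, x')\<in>R. \<forall>(y, y')\<in>R. ip (- int n) x y = ip 0 x' y'"
    using scale[unfolded hilbert_scale_def, THEN conjunct2, THEN conjunct1, rule_format, of "- int n"] by auto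
  have RR: "R O R = {(y, P n y) | y. y \<in> H 0}" and Radj: "adjoint_rel (H 0) (ip 0) R = R"
    using R(1) unfolding positive_root_def self_adjoint_operator_def b_op_neg by auto
  have "(x, P n x) \<in> R O R" "(y, P n y) \<in> R O R" using RR assms by blast+
  then obtain x' y' where xy: "(x, x') \<in> R" "(y, y') \<in> R" "(y', P n y) \<in> R" by blast
  have "(y', P n y) \<in> adjoint_rel (H 0) (ip 0) R" using xy Radj by simp
  hence "ip 0 x (P n y) = ip 0 x' y'" using xy(1) unfolding adjoint_rel_def by blast
  thus ?thesis using R(2) xy by fastforce
qed

lemma S_mem_H: "y \<in> H 0 \<Longrightarrow> S n y \<in> H (int n)"
  by (simp add: H_eq_S)

lemma nrm_S: "y \<in> H 0 \<Longrightarrow> nrm (int n) (S n y) = nrm 0 y"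
  by (simp add: ip_norm_def ip_S)

lemma P_mem_H: "y \<in> H 0 \<Longrightarrow> P n y \<in> H (int n)"
  using S_mem_H[OF S_mem] S_S by metis

lemma H_nonneg_sub: "H (int n) \<subseteq> H 0"
  using S_mem by (auto simp: H_eq_S)

text \<open>\<open>P n x\<close> is the Riesz representative in \<open>H n\<close> of the functional
  that \<open>x\<close> defines through \<open>ip 0\<close>. With \<open>v = S n w\<close> and
  \<open>P n\<close> the square of \<open>S n\<close>, one root is cancelled by \<open>ip_S\<close>
  and the other is moved by symmetry.\<close>

lemma ip_P: assumes "x \<in> H 0" "v \<in> H (int n)" shows "ip (int n) (P n x) v = ip 0 x v"
proof -
  obtain w where w: "w \<in> H 0" "v = S n w" using assms H_eq_S by auto
  have "ip (int n) (S n (S n x)) (S n w) = ip 0 (S n x) w" by (intro ip_S S_mem assms w)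
  thus ?thesis using S_symmetric S_S assms w by simp
qed

lemma nrm_0_le: "\<exists>C\<ge>0. \<forall>v\<in>H (int n). nrm 0 v \<le> C * nrm (int n) v"
proof -
  obtain C where C: "C \<ge> 0" "\<forall>y\<in>H 0. nrm 0 (P n y) \<le> C * nrm 0 y" using P_bounded by blast
  have "nrm 0 (S n w) \<le> sqrt C * nrm (int n) (S n w)" if w: "w \<in> H 0" for w
  proof -
    \<comment> \<open>\<open>P n\<close> is the square of the symmetric operator \<open>S n\<close>,
      so Cauchy-Schwarz turns the bound \<open>C\<close> of \<open>P n\<close> into the bound
      \<open>sqrt C\<close> of \<open>S n\<close>.\<close>
    have "(nrm 0 (S n w))\<^sup>2 = Re (ip 0 w (P n w))"
      using w S_symmetric[OF w S_mem[OF w, of n]] by (simp add: H.nrm_sq S_S S_mem)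
    also have "\<dots> \<le> nrm 0 w * nrm 0 (P n w)"
      using H.Cauchy_Schwarz[OF w P_mem[OF w]] complex_Re_le_cmod order_trans by blast
    also have "\<dots> \<le> nrm 0 w * (C * nrm 0 w)" using C w H.nrm_nonneg by (intro mult_left_mono) auto
    also have "\<dots> = (sqrt C * nrm 0 w)\<^sup>2" using C by (simp add: power_mult_distrib power2_eq_square)
    finally show ?thesis unfolding nrm_S[OF w]
      by (rule power2_le_imp_le) (use C w H.nrm_nonneg in auto)
  qed
  thus ?thesis using C by (intro exI[of _ "sqrt C"]) (auto simp: H_eq_S)
qed

text \<open>A bounded operator with dense range maps dense sets to dense sets; hence all powers of \<open>S n\<close>
  have dense range.\<close>

lemma P_dense: assumes "x \<in> H (int n)" "e > 0"
  shows "\<exists>y\<in>H 0. nrm (int n) (x - P n y) < e" "\<exists>y\<in>H 0. nrm (int n) (x - P (n + n) y) < e"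
proof -
  obtain C where C: "C \<ge> 0" "\<forall>v\<in>H (int n). nrm 0 v \<le> C * nrm (int n) v" using nrm_0_le by blast
  have bd: "nrm 0 (S n y) \<le> C * nrm 0 y" if "y \<in> H 0" for y
    using bspec[OF C(2) S_mem_H[OF that]] nrm_S[OF that] by simp
  have step: "\<exists>y\<in>H 0. nrm 0 (x - S n (T y)) < e"
    if T: "\<And>x e. x \<in> H 0 \<Longrightarrow> e > 0 \<Longrightarrow> \<exists>y\<in>H 0. nrm 0 (x - T y) < e" "\<And>y. y \<in> H 0 \<Longrightarrow> T y \<in> H 0"
      and x: "x \<in> H 0" "e > 0" for T x e
  proof -
    obtain y where y: "y \<in> H 0" "nrm 0 (x - S n y) < e / 2" using S_dense[OF x(1), of "e / 2"] x by auto
    \<comment> \<open>The \<open>+ 1\<close> keeps the denominator positive when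
      \<open>C = 0\<close>.\<close>
    have "e / (2 * (C + 1)) > 0" using C x by simp
    then obtain u where u: "u \<in> H 0" "nrm 0 (y - T u) < e / (2 * (C + 1))" using T(1)[OF y(1)] by blast
    have m: "T u \<in> H 0" "S n y \<in> H 0" "S n (T u) \<in> H 0" using T(2) S_mem u y by auto
    have "nrm 0 (S n y - S n (T u)) \<le> C * nrm 0 (y - T u)"
      using bd[of "y - T u"] S_diff y m by (simp add: H.diff_mem)
    also have "\<dots> \<le> (C + 1) * nrm 0 (y - T u)"
      using H.nrm_nonneg[of "y - T u" 0] y m by (simp add: H.diff_mem distrib_right)
    also have "\<dots> < (C + 1) * (e / (2 * (C + 1)))" using u C by (intro mult_strict_left_mono) auto
    also have "\<dots> = e / 2" using C by (simp add: field_simps)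
    finally have "nrm 0 (x - S n (T u)) < e"
      using H.nrm_triangle_diff[OF x(1) m(2) m(3)] y by simp
    thus ?thesis using u by blast
  qed
  have d2: "\<exists>y\<in>H 0. nrm 0 (x - S n (S n y)) < e" if "x \<in> H 0" "e > 0" for x e
    by (rule step[OF S_dense S_mem that])
  \<comment> \<open>For \<open>x = S n w\<close>, approximating \<open>x\<close> in
    \<open>H n\<close> by \<open>P (n + n) y\<close>, which is four factors \<open>S n\<close>,
    amounts to approximating \<open>w\<close> in \<open>H 0\<close> by three.\<close>
  have d3: "\<exists>y\<in>H 0. nrm 0 (x - S n (S n (S n y))) < e" if "x \<in> H 0" "e > 0" for x e
    by (rule step[OF d2 _ that]) (auto simp: S_mem)
  obtain w where w: "w \<in> H 0" "x = S n w" using assms H_eq_S by auto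
  have *: "nrm (int n) (x - S n z) = nrm 0 (w - z)" if "z \<in> H 0" for z
    using that w nrm_S[of "w - z" n] by (simp add: S_diff H.diff_mem)
  obtain y where y: "y \<in> H 0" "nrm 0 (w - S n y) < e" using S_dense[OF w(1) assms(2)] by blast
  thus "\<exists>y\<in>H 0. nrm (int n) (x - P n y) < e" using *[OF S_mem[OF y(1)]] S_S[OF y(1)] by metis
  obtain y where y: "y \<in> H 0" "nrm 0 (w - S n (S n (S n y))) < e" using d3[OF w(1) assms(2)] by blast
  moreover have "P (n + n) y = S n (S n (S n (S n y)))" using y by (simp add: P_add S_S P_mem S_mem)
  ultimately show "\<exists>y\<in>H 0. nrm (int n) (x - P (n + n) y) < e" using *[of "S n (S n (S n y))"] S_mem by metis
qed

section \<open>L - z1 as a unitary map from \<open>H (n + 2)\<close> onto \<open>H n\<close>\<close>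

definition Bres :: "int \<Rightarrow> ('v \<times> 'v) set" where "Bres n = B \<inter> (H (n + 2) \<times> H n)"

text \<open>The closure is taken in the same product topology as in \<open>L_scale\<close>, so that
  only the shift by \<open>z1\<close> separates the two.\<close>

definition U :: "int \<Rightarrow> ('v \<times> 'v) set" where
  "U n = prod_topology (ip_topology (H (n + 2)) (ip (n + 2))) (ip_topology (H n) (ip n)) closure_of Bres n"

lemma Bres_sub: "Bres n \<subseteq> H (n + 2) \<times> H n"
  by (auto simp: Bres_def)

lemma Bres_lin: "lin_rel (Bres n)"
  unfolding Bres_def using B_lin unfolding lin_rel_def by (auto intro: H.add_mem H.scale_mem)

lemma B_mem: "y \<in> H 0 \<Longrightarrow> (Bi y, y) \<in> B" using in_B_iff by blast

lemma Bi_dense: assumes "x \<in> H 0" "e > 0" shows "\<exists>y\<in>H 0. nrm 0 (x - Bi y) < e"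
proof -
  have "ip_topology (H 0) (ip 0) closure_of Domain L = H 0"
    using self_adjoint unfolding self_adjoint_operator_def by blast
  then obtain y y' where y: "(y, y') \<in> L" "nrm 0 (x - y) < e"
    using assms unfolding H.dense_iff by blast
  hence "(y, y' - z1 *\<^sub>C y) \<in> B" by (simp add: in_B)
  thus ?thesis using y in_B_iff by metis
qed

text \<open>The vectors \<open>P (n + 2) y\<close> form a core on which \<open>B\<close> is isometric; the closure of \<open>B\<close> restricted to it
  stays in \<open>B\<close> because both norms dominate that of \<open>H 0\<close>.\<close>

lemma Bres_nonneg_unitary:
  "unitary_rel (H (int n + 2)) (ip (int n + 2)) (H (int n)) (ip (int n)) (Bres (int n))"
proof -
  define T where "T = {(P (n + 2) y, P (n + 1) y) | y. y \<in> H 0}"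
  let ?cl = "prod_topology (ip_topology (H (int n + 2)) (ip (int n + 2))) (ip_topology (H (int n)) (ip (int n))) closure_of T"
  have e: "int n + 2 = int (n + 2)" by simp
  have sub: "T \<subseteq> H (int n + 2) \<times> H (int n)"
    unfolding T_def e using P_mem_H[of _ "n + 2"] P_mem_H[of "Bi _" n] by (auto simp: P_Suc2 Bi_mem)
  have TB: "T \<subseteq> B" unfolding T_def using in_B_iff P_mem Bi_mem by (auto simp: P_Suc)
  have lin: "lin_rel T" unfolding T_def by (rule P_linear)
  have iso: "isometric_rel (ip (int n + 2)) (ip (int n)) T"
  proof -
    have "ip (int n) (P (n + 1) x) (P (n + 1) y) = ip (int n + 2) (P (n + 2) x) (P (n + 2) y)"
      if "x \<in> H 0" "y \<in> H 0" for x y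
    proof -
      have "ip (int n + 2) (P (n + 2) x) (P (n + 2) y) = ip 0 x (P (n + 2) y)"
        unfolding e by (intro ip_P P_mem_H that)
      moreover have "ip (int n) (P n (Bi x)) (P n (Bi y)) = ip 0 (Bi x) (P n (Bi y))"
        by (intro ip_P P_mem_H Bi_mem that)
      ultimately show ?thesis using Bi_symmetric[of x "P n (Bi y)"] that
        by (simp add: P_Suc2[symmetric] P_Suc[symmetric] P_mem Bi_mem)
    qed
    thus ?thesis unfolding isometric_rel_def T_def by auto
  qed
  have d1: "\<forall>x\<in>H (int n + 2). \<forall>e>0. \<exists>y\<in>Domain T. nrm (int n + 2) (x - y) < e"
    unfolding e T_def using P_dense(1)[of _ "n + 2"] by fastforce
  \<comment> \<open>The range of \<open>T\<close> is that of \<open>P (n + 1)\<close>. For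
    \<open>n \<ge> 1\<close> it contains the range of \<open>P (n + n)\<close>, hence the second
    density statement of \<open>P_dense\<close>; for \<open>n = 0\<close> it is the range of
    \<open>Bi\<close>, dense because \<open>L\<close> is densely defined.\<close>
  have "\<exists>y\<in>Range T. nrm (int n) (x - y) < e" if x: "x \<in> H (int n)" "e > 0" for x e
  proof (cases n)
    case 0
    then obtain u where "u \<in> H 0" "nrm 0 (x - Bi u) < e" using Bi_dense[of x e] x by auto
    thus ?thesis using 0 unfolding T_def by (auto simp: P_def)
  next
    case (Suc k)
    obtain y where y: "y \<in> H 0" "nrm (int n) (x - P (n + n) y) < e" using P_dense(2)[OF x] by blast
    have "P (n + n) y = P (n + 1) (P k y)" unfolding P_add[symmetric] by (simp add: Suc)
    thus ?thesis using y P_mem[of y k] unfolding T_def by fastforce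
  qed
  hence d2: "\<forall>x\<in>H (int n). \<forall>e>0. \<exists>y\<in>Range T. nrm (int n) (x - y) < e" by blast
  have un: "unitary_rel (H (int n + 2)) (ip (int n + 2)) (H (int n)) (ip (int n)) ?cl"
    by (rule closure_unitary[OF hilbert hilbert sub lin iso d1 d2])
  have clB: "?cl \<subseteq> B"
  proof (rule subrelI)
    fix x w assume "(x, w) \<in> ?cl"
    then obtain a b where h: "x \<in> H (int n + 2)" "w \<in> H (int n)" "\<And>k. (a k, b k) \<in> T"
      "(\<lambda>k. nrm (int n + 2) (a k - x)) \<longlonglongrightarrow> 0" "(\<lambda>k. nrm (int n) (b k - w)) \<longlonglongrightarrow> 0"
      using HH.in_pair_closure_sequence[OF sub] by metis
    have ab: "a k \<in> H (int n + 2)" "b k \<in> H (int n)" "a k = Bi (b k)" for k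
      using h(3)[of k] sub TB in_B_iff by auto
    have m0: "x \<in> H 0" "w \<in> H 0" "a k \<in> H 0" "b k \<in> H 0" for k
      using h ab[of k] H_nonneg_sub[of n] H_nonneg_sub[of "n + 2"] unfolding e by auto
    obtain C where C: "\<forall>v\<in>H (int n + 2). nrm 0 v \<le> C * nrm (int n + 2) v" using nrm_0_le[of "n + 2"] unfolding e by blast
    obtain D where D: "\<forall>v\<in>H (int n). nrm 0 v \<le> D * nrm (int n) v" using nrm_0_le by blast
    obtain F where F: "\<forall>v\<in>H 0. nrm 0 (Bi v) \<le> F * nrm 0 v" using Bi_bounded by blast
    have "(\<lambda>k. nrm 0 (a k - x)) \<longlonglongrightarrow> 0"
      by (rule tendsto_0_of_bounded[OF C _ _ h(4)])
        (use ab h H_nonneg_sub[of "n + 2"] H.nrm_nonneg in \<open>auto simp: e H.diff_mem simp del: of_nat_add\<close>)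
    moreover have "(\<lambda>k. nrm 0 (b k - w)) \<longlonglongrightarrow> 0"
      by (rule tendsto_0_of_bounded[OF D _ _ h(5)])
        (use ab h H_nonneg_sub[of n] H.nrm_nonneg in \<open>auto simp: H.diff_mem\<close>)
    hence "(\<lambda>k. nrm 0 (Bi (b k - w))) \<longlonglongrightarrow> 0"
      by (rule tendsto_0_of_bounded[OF F, rotated 2]) (use m0 H.nrm_nonneg in \<open>auto simp: H.diff_mem Bi_mem\<close>)
    moreover have "Bi (b k - w) = a k - Bi w" for k
      using lin_rel_diff[OF B_lin, of "Bi (b k)" "b k" "Bi w" w] ab m0 in_B_iff by simp
    ultimately have "x = Bi w"
      using H.tendsto_unique_nrm[of a 0 x "Bi w"] m0 Bi_mem by simp
    thus "(x, w) \<in> B" using in_B_iff m0 by simp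
  qed
  have "?cl \<subseteq> H (int n + 2) \<times> H (int n)" using un by (rule unitary_sub)
  \<comment> \<open>The closure already has the full domain \<open>H (n + 2)\<close> and lies in the
    single-valued \<open>B\<close>, so \<open>Bres\<close> cannot be larger.\<close>
  moreover have "Bres (int n) \<subseteq> ?cl"
  proof (rule subrelI)
    fix x w assume xw: "(x, w) \<in> Bres (int n)"
    then obtain w' where "(x, w') \<in> ?cl" using un Bres_sub unfolding unitary_rel_def by blast
    moreover have "w = w'" using xw calculation clB B_single_valued unfolding Bres_def by blast
    ultimately show "(x, w) \<in> ?cl" by simp
  qed
  ultimately have "?cl = Bres (int n)" using clB unfolding Bres_def by blast
  thus ?thesis using un by simp
qed

section \<open>Continuous embeddings along the scale\<close>

definition embeds :: "int \<Rightarrow> int \<Rightarrow> bool" where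
  "embeds a b \<longleftrightarrow> H b \<subseteq> H a \<and> (\<exists>C\<ge>0. \<forall>x\<in>H b. nrm a x \<le> C * nrm b x)"

lemma embeds_neg: assumes "n < 0" shows "embeds n (n + 1)"
proof -
  obtain C where C: "H (n + 1) \<subseteq> H n" "\<forall>x\<in>H (n + 1). nrm n x \<le> C * nrm (n + 1) x"
    using scale assms unfolding hilbert_scale_def by meson
  have "nrm n x \<le> \<bar>C\<bar> * nrm (n + 1) x" if "x \<in> H (n + 1)" for x
    using C that mult_right_mono[OF abs_ge_self[of C] H.nrm_nonneg[OF that]] by fastforce
  thus ?thesis unfolding embeds_def using C by (intro conjI exI[of _ "\<bar>C\<bar>"]) auto
qed

text \<open>Induction in steps of two. The indices 0 and 1 are settled by bounds of the resolvent;
  for \<open>n = k + 2\<close> the unitary maps transport the embedding of \<open>H (k + 1)\<close>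
  into \<open>H k\<close> two levels up. Below zero the embeddings are part of
  \<open>hilbert_scale\<close>.\<close>

lemma embeds_nonneg: "embeds (int n) (int n + 1)"
proof (induction n rule: less_induct)
  case (less n)
  consider "n = 0" | "n = 1" | k where "n = k + 2" by (metis One_nat_def add_2_eq_Suc' not0_implies_Suc)
  thus ?case
  proof cases
    case 1
    thus ?thesis using H_nonneg_sub[of 1] nrm_0_le[of 1] by (simp add: embeds_def)
  next
    case 2
    have un: "unitary_rel (H 2) (ip 2) (H 0) (ip 0) (Bres 0)" using Bres_nonneg_unitary[of 0] by simp
    have x: "x \<in> H 1 \<and> nrm 1 x \<le> sqrt C * nrm 2 x"
      if C: "C \<ge> 0" "\<forall>y\<in>H 0. nrm 0 (Bi y) \<le> C * nrm 0 y" and x: "x \<in> H 2" for C x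
    proof -
      obtain w where w: "(x, w) \<in> Bres 0" using un x unfolding unitary_rel_def by blast
      hence xw: "x = P 1 w" "w \<in> H 0" using in_B_iff by (auto simp: Bres_def P_def)
      have x1: "x \<in> H 1" using P_mem_H[of w 1] xw by simp
      have nw: "nrm 2 x = nrm 0 w" 
        by (rule unitary_nrm[OF un w])
      have "(nrm 1 x)\<^sup>2 = Re (ip 0 w (Bi w))"
        using ip_P[of w x 1] xw x1 H.nrm_sq[OF x1] by (simp add: P_def)
      also have "\<dots> \<le> nrm 0 w * nrm 0 (Bi w)"
        using H.Cauchy_Schwarz[OF xw(2) Bi_mem[OF xw(2)]] complex_Re_le_cmod order_trans by blast
      also have "\<dots> \<le> nrm 0 w * (C * nrm 0 w)" using C xw H.nrm_nonneg by (intro mult_left_mono) auto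
      also have "\<dots> = (sqrt C * nrm 0 w)\<^sup>2" using C by (simp add: power_mult_distrib power2_eq_square)
      finally have "nrm 1 x \<le> sqrt C * nrm 0 w"
        by (rule power2_le_imp_le) (use C xw H.nrm_nonneg in auto)
      thus ?thesis using x1 nw by simp
    qed
    obtain C where C: "C \<ge> 0" "\<forall>y\<in>H 0. nrm 0 (Bi y) \<le> C * nrm 0 y" using Bi_bounded by blast
    show ?thesis unfolding embeds_def using 2 x[OF C] C by (auto intro!: exI[of _ "sqrt C"])
  next
    case 3
    have un: "unitary_rel (H (int j + 2)) (ip (int j + 2)) (H (int j)) (ip (int j)) (Bres (int j))" for j
      by (rule Bres_nonneg_unitary)
    obtain C where C: "C \<ge> 0" "H (int k + 1) \<subseteq> H (int k)" "\<forall>x\<in>H (int k + 1). nrm (int k) x \<le> C * nrm (int k + 1) x"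
      using less.IH[of k] 3 unfolding embeds_def by fastforce
    have "x \<in> H (int k + 2) \<and> nrm (int k + 2) x \<le> C * nrm (int k + 3) x" if x: "x \<in> H (int k + 3)" for x
    proof -
      have un1: "unitary_rel (H (int k + 3)) (ip (int k + 3)) (H (int k + 1)) (ip (int k + 1)) (Bres (int k + 1))"
        using un[of "k + 1"] by (simp add: algebra_simps)
      hence "x \<in> Domain (Bres (int k + 1))" using x unfolding unitary_rel_def by simp
      then obtain w where w: "(x, w) \<in> Bres (int k + 1)" by blast
      hence wk: "w \<in> H (int k + 1)" "(x, w) \<in> B" by (auto simp: Bres_def)
      then obtain x' where x': "(x', w) \<in> Bres (int k)" using C(2) un[of k] unfolding unitary_rel_def by blast
      \<comment> \<open>The preimages of \<open>w\<close> at both levels are \<open>Bi w\<close>,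
        which is why the two unitary maps fit together.\<close>
      hence "x' = x" using wk in_B_iff by (auto simp: Bres_def)
      hence xk: "(x, w) \<in> Bres (int k)" using x' by simp
      have "nrm (int k + 2) x = nrm (int k) w"
        by (rule unitary_nrm[OF un xk])
      moreover have "nrm (int k + 3) x = nrm (int k + 1) w"
        by (rule unitary_nrm[OF un1 w])
      ultimately show ?thesis using C(3) wk xk by (auto simp: Bres_def)
    qed
    hence "embeds (int k + 2) (int k + 3)" unfolding embeds_def using C(1) by blast
    moreover have "int n = int k + 2" "int n + 1 = int k + 3" using 3 by auto
    ultimately show ?thesis by (simp only:)
  qed
qed

lemma embeds_trans: assumes "embeds a b" "embeds b c" shows "embeds a c"
proof -
  obtain C D where C: "C \<ge> 0" "H b \<subseteq> H a" "\<forall>x\<in>H b. nrm a x \<le> C * nrm b x"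
    and D: "D \<ge> 0" "H c \<subseteq> H b" "\<forall>x\<in>H c. nrm b x \<le> D * nrm c x"
    using assms unfolding embeds_def by blast
  have "nrm a x \<le> C * D * nrm c x" if "x \<in> H c" for x
  proof -
    have "nrm a x \<le> C * nrm b x" using C D that by blast
    also have "\<dots> \<le> C * (D * nrm c x)" using C D that by (intro mult_left_mono) auto
    finally show ?thesis by (simp add: mult.assoc)
  qed
  thus ?thesis unfolding embeds_def using C D by (intro conjI exI[of _ "C * D"]) auto
qed

lemma embeds: assumes "a \<le> b" shows "embeds a b"
proof -
  have "embeds a (a + int k)" for k
  proof (induction k)
    case 0 show ?case by (auto simp: embeds_def intro!: exI[of _ 1])
  next
    case (Suc k)
    have "embeds n (n + 1)" for n
      using embeds_neg[of n] embeds_nonneg[of "nat n"] by (cases "n < 0") auto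
    hence "embeds (a + int k) (a + int k + 1)" .
    thus ?case using embeds_trans[OF Suc] by (simp add: algebra_simps)
  qed
  from this[of "nat (b - a)"] show ?thesis using assms by simp
qed

lemma H_mono: "a \<le> b \<Longrightarrow> x \<in> H b \<Longrightarrow> x \<in> H a"
  using embeds unfolding embeds_def by blast

lemma H0_dense: assumes "n \<le> 0" "x \<in> H n" "e > 0" shows "\<exists>y\<in>H 0. nrm n (x - y) < e"
proof (cases "n = 0")
  case True thus ?thesis using assms by (intro bexI[of _ x]) auto
next
  case False
  hence "ip_topology (H n) (ip n) closure_of H 0 = H n"
    using assms scale unfolding hilbert_scale_def by auto
  thus ?thesis using assms unfolding H.dense_iff by blast
qed

text \<open>Here \<open>n + 2 \<le> 1\<close>, and the domain of \<open>B\<close> lies in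
  \<open>H 1\<close> because it is the range of \<open>P 1\<close>.\<close>

lemma Bres_neg: assumes "n < 0" shows "Bres n = B"
proof -
  have "B \<subseteq> H (n + 2) \<times> H n"
  proof (rule subrelI)
    fix x y assume "(x, y) \<in> B"
    hence y: "y \<in> H 0" "x = P 1 y" using in_B_iff by (auto simp: P_def)
    hence "x \<in> H 1" using P_mem_H[of y 1] by simp
    thus "(x, y) \<in> H (n + 2) \<times> H n" using y assms H_mono[of "n + 2" 1 x] H_mono[of n 0 y] by simp
  qed
  thus ?thesis unfolding Bres_def by blast
qed

text \<open>Both sides are the product in \<open>H 0\<close> of \<open>x\<close> with a power of the
  resolvent applied to \<open>y\<close>. The index -1 is treated apart because
  \<open>n + 2 = 1\<close> is positive there, so that \<open>ip_P\<close> takes the place of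
  \<open>ip_neg\<close> on one side.\<close>

lemma B_isometric_neg: assumes "n < 0" shows "isometric_rel (ip (n + 2)) (ip n) B"
proof -
  have "ip n x y = ip (n + 2) (Bi x) (Bi y)" if xy: "x \<in> H 0" "y \<in> H 0" for x y
  proof (cases "n = -1")
    case True
    have "ip 1 (P 1 x) (P 1 y) = ip 0 x (P 1 y)" using ip_P[of x "P 1 y" 1] P_mem_H[of y 1] xy by simp
    moreover have "ip (-1) x y = ip 0 x (P 1 y)" using ip_neg[of x y 1] xy by simp
    ultimately show ?thesis using True by (simp add: P_def)
  next
    case False
    define k where "k = nat (- n - 2)"
    have k: "n + 2 = - int k" "n = - int (k + 2)" using False assms unfolding k_def by auto
    have "ip (- int k) (Bi x) (Bi y) = ip 0 (Bi x) (P k (Bi y))" by (intro ip_neg Bi_mem xy)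
    also have "\<dots> = ip 0 x (P (k + 2) y)"
      using Bi_symmetric[of x "P k (Bi y)"] xy by (simp add: P_mem Bi_mem P_Suc2[symmetric] P_Suc[symmetric])
    also have "\<dots> = ip (- int (k + 2)) x y" using ip_neg[of x y "k + 2"] xy by simp
    finally show ?thesis using k by simp
  qed
  thus ?thesis unfolding isometric_rel_def using in_B_iff by auto
qed

lemma U_unitary: "unitary_rel (H (n + 2)) (ip (n + 2)) (H n) (ip n) (U n)"
  unfolding U_def
proof (rule closure_unitary[OF hilbert hilbert Bres_sub Bres_lin])
  have nn: "n \<ge> 0 \<Longrightarrow> unitary_rel (H (n + 2)) (ip (n + 2)) (H n) (ip n) (Bres n)"
    using Bres_nonneg_unitary[of "nat n"] by simp
  show "isometric_rel (ip (n + 2)) (ip n) (Bres n)"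
    using nn B_isometric_neg Bres_neg by (cases "n < 0") (auto simp: unitary_rel_def)
  show "\<forall>x\<in>H (n + 2). \<forall>e>0. \<exists>y\<in>Domain (Bres n). nrm (n + 2) (x - y) < e"
  proof (intro ballI allI impI)
    fix x and e :: real assume x: "x \<in> H (n + 2)" and e: "e > 0"
    \<comment> \<open>For \<open>n \<ge> 0\<close> the domain is all of \<open>H (n + 2)\<close>;
      for \<open>n = -1\<close> it is the range of \<open>P 1\<close>, dense in \<open>H 1\<close>;
      for \<open>n \<le> -2\<close> density of \<open>H 0\<close> in \<open>H (n + 2)\<close> is
      combined with density of the domain of \<open>L\<close> in \<open>H 0\<close>.\<close>
    consider "n \<ge> 0" | "n = -1" | "n \<le> -2" by linarith
    thus "\<exists>y\<in>Domain (Bres n). nrm (n + 2) (x - y) < e"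
    proof cases
      case 1
      hence "x \<in> Domain (Bres n)" using nn x unfolding unitary_rel_def by auto
      thus ?thesis using e by (intro bexI[of _ x]) auto
    next
      case 2
      then obtain y where "y \<in> H 0" "nrm (n + 2) (x - P 1 y) < e" using P_dense(1)[of x 1 e] x e by auto
      thus ?thesis using B_mem[of y] 2 Bres_neg[of n] by (auto simp: P_def intro!: bexI[of _ "Bi y"])
    next
      case 3
      obtain C where C: "C \<ge> 0" "\<forall>x\<in>H 0. nrm (n + 2) x \<le> C * nrm 0 x"
        using embeds[of "n + 2" 0] 3 unfolding embeds_def by auto
      obtain y where y: "y \<in> H 0" "nrm (n + 2) (x - y) < e / 2" using H0_dense[of "n + 2" x "e / 2"] 3 x e by auto
      have "e / (2 * (C + 1)) > 0" using C e by simp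
      then obtain u where u: "u \<in> H 0" "nrm 0 (y - Bi u) < e / (2 * (C + 1))" using Bi_dense[OF y(1)] by blast
      have m: "Bi u \<in> H 0" "y \<in> H (n + 2)" "Bi u \<in> H (n + 2)" using u y Bi_mem H_mono[of "n + 2" 0] 3 by auto
      have "nrm (n + 2) (y - Bi u) \<le> C * nrm 0 (y - Bi u)" using C y m by (simp add: H.diff_mem)
      also have "\<dots> \<le> (C + 1) * nrm 0 (y - Bi u)"
        using H.nrm_nonneg[of "y - Bi u" 0] y m by (simp add: H.diff_mem distrib_right)
      also have "\<dots> < (C + 1) * (e / (2 * (C + 1)))" using u C by (intro mult_strict_left_mono) auto
      also have "\<dots> = e / 2" using C by (simp add: field_simps)
      finally have "nrm (n + 2) (x - Bi u) < e"
        using H.nrm_triangle_diff[OF x m(2) m(3)] y by simp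
      thus ?thesis using B_mem[of u] u 3 Bres_neg[of n] by (intro bexI[of _ "Bi u"]) auto
    qed
  qed
  show "\<forall>x\<in>H n. \<forall>e>0. \<exists>y\<in>Range (Bres n). nrm n (x - y) < e"
  proof (intro ballI allI impI)
    fix x and e :: real assume x: "x \<in> H n" and e: "e > 0"
    show "\<exists>y\<in>Range (Bres n). nrm n (x - y) < e"
    proof (cases "n < 0")
      case True
      thus ?thesis using H0_dense[of n x e] x e Bres_neg[of n] B_mem by fastforce
    next
      case False
      hence "x \<in> Range (Bres n)" using nn x unfolding unitary_rel_def by auto
      thus ?thesis using e by (intro bexI[of _ x]) auto
    qed
  qed
qed

lemma Bres_sub_U: "Bres n \<subseteq> U n"
  unfolding U_def using closure_of_subset[of "Bres n"] Bres_sub by simp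

text \<open>\<open>Bres n\<close> already has the full domain \<open>H (n + 2)\<close>, so its
  single-valued extension \<open>U n\<close> adds nothing to it.\<close>

lemma U_nonneg: assumes "n \<ge> 0" shows "U n \<subseteq> B"
proof (rule subrelI)
  fix x w assume xw: "(x, w) \<in> U n"
  hence "x \<in> H (n + 2)" using U_unitary unfolding unitary_rel_def by blast
  then obtain w' where w': "(x, w') \<in> Bres n"
    using Bres_nonneg_unitary[of "nat n"] assms unfolding unitary_rel_def by auto
  hence "w = w'" using unitary_single_valued[OF U_unitary inner xw] Bres_sub_U by blast
  thus "(x, w) \<in> B" using w' unfolding Bres_def by blast
qed

text \<open>Convergence at the higher level implies convergence at the lower one. The extensions are
  therefore compatible, which makes their union an operator.\<close>

lemma U_mono: assumes "k \<le> n" shows "U n \<subseteq> U k"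
proof (rule subrelI)
  fix x w assume "(x, w) \<in> U n"
  then obtain a b where h: "x \<in> H (n + 2)" "w \<in> H n" "\<And>i. (a i, b i) \<in> Bres n"
    "(\<lambda>i. nrm (n + 2) (a i - x)) \<longlonglongrightarrow> 0" "(\<lambda>i. nrm n (b i - w)) \<longlonglongrightarrow> 0"
    unfolding U_def using HH.in_pair_closure_sequence[OF Bres_sub] by metis
  obtain C D where C: "\<forall>x\<in>H (n + 2). nrm (k + 2) x \<le> C * nrm (n + 2) x"
    and D: "\<forall>x\<in>H n. nrm k x \<le> D * nrm n x"
    using embeds[of "k + 2" "n + 2"] embeds[of k n] assms unfolding embeds_def by auto
  have ab: "a i \<in> H (n + 2)" "b i \<in> H n" for i using h(3)[of i] Bres_sub by auto
  have "(a i, b i) \<in> Bres k" for i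
    using h(3)[of i] assms H_mono[of "k + 2" "n + 2"] H_mono[of k n] by (auto simp: Bres_def)
  moreover have "(\<lambda>i. nrm (k + 2) (a i - x)) \<longlonglongrightarrow> 0"
    by (rule tendsto_0_of_bounded[OF C _ _ h(4)])
      (use ab h assms H_mono[of "k + 2" "n + 2"] H.nrm_nonneg in \<open>auto simp: H.diff_mem\<close>)
  moreover have "(\<lambda>i. nrm k (b i - w)) \<longlonglongrightarrow> 0"
    by (rule tendsto_0_of_bounded[OF D _ _ h(5)])
      (use ab h assms H_mono[of k n] H.nrm_nonneg in \<open>auto simp: H.diff_mem\<close>)
  moreover have "x \<in> H (k + 2)" "w \<in> H k" using h H_mono[of "k + 2" "n + 2"] H_mono[of k n] assms by auto
  ultimately show "(x, w) \<in> U k" unfolding U_def by (intro HH.sequence_in_pair_closure[OF Bres_sub])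
qed

text \<open>Adding \<open>c\<close> times the first component to the second is continuous because
  \<open>H (n + 2)\<close> embeds continuously into \<open>H n\<close>. With \<open>c = z1\<close>
  and \<open>c = - z1\<close> this passes between the closures of \<open>L\<close> and of L -
  z1.\<close>

lemma shear_closure:
  assumes T: "T \<subseteq> H (n + 2) \<times> H n" and T': "T' \<subseteq> H (n + 2) \<times> H n"
    and shear: "\<And>a b. (a, b) \<in> T \<Longrightarrow> (a, b + c *\<^sub>C a) \<in> T'"
    and xw: "(x, w) \<in> HH.topology_pair (n + 2) n closure_of T"
  shows "(x, w + c *\<^sub>C x) \<in> HH.topology_pair (n + 2) n closure_of T'"
proof -
  obtain a b where h: "x \<in> H (n + 2)" "w \<in> H n" "\<And>i. (a i, b i) \<in> T"
    "(\<lambda>i. nrm (n + 2) (a i - x)) \<longlonglongrightarrow> 0" "(\<lambda>i. nrm n (b i - w)) \<longlonglongrightarrow> 0"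
    using HH.in_pair_closure_sequence[OF T xw] by metis
  obtain C where C: "\<forall>x\<in>H (n + 2). nrm n x \<le> C * nrm (n + 2) x"
    using embeds[of n "n + 2"] unfolding embeds_def by auto
  have ab: "a i \<in> H (n + 2)" "b i \<in> H n" "a i \<in> H n" for i
    using h(3)[of i] T H_mono[of n "n + 2"] by auto
  have x: "x \<in> H n" using h H_mono[of n "n + 2"] by auto
  have "(\<lambda>i. nrm n (a i - x)) \<longlonglongrightarrow> 0"
    by (rule tendsto_0_of_bounded[OF C _ _ h(4)])
      (use ab h H_mono[of n "n + 2"] H.nrm_nonneg in \<open>auto simp: H.diff_mem\<close>)
  hence "(\<lambda>i. nrm n (b i - w) + cmod c * nrm n (a i - x)) \<longlonglongrightarrow> 0"
    using tendsto_add[OF h(5) tendsto_mult_right_zero] by simp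
  hence lim: "(\<lambda>i. nrm n ((b i + c *\<^sub>C a i) - (w + c *\<^sub>C x))) \<longlonglongrightarrow> 0"
  proof (rule null_squeeze)
    fix i
    have eq: "(b i + c *\<^sub>C a i) - (w + c *\<^sub>C x) = (b i - w) + c *\<^sub>C (a i - x)"
      by (simp add: complex_vector.scale_right_diff_distrib)
    show "\<bar>nrm n ((b i + c *\<^sub>C a i) - (w + c *\<^sub>C x))\<bar> \<le> nrm n (b i - w) + cmod c * nrm n (a i - x)"
      unfolding eq
      using H.nrm_triangle[of "b i - w" n "c *\<^sub>C (a i - x)"] H.nrm_scale[of "a i - x" n c]
        H.nrm_nonneg[of "(b i - w) + c *\<^sub>C (a i - x)" n] ab[of i] h x
      by (simp add: H.diff_mem H.scale_mem H.add_mem)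
  qed
  show ?thesis
    by (rule HH.sequence_in_pair_closure[OF T' _ _ _ h(4) lim])
      (use h x shear in \<open>auto intro!: H.add_mem H.scale_mem\<close>)
qed

lemma L_scale_iff: "(x, x') \<in> L_scale H ip L n \<longleftrightarrow> (x, x' - z1 *\<^sub>C x) \<in> U n"
proof -
  have sub: "L \<inter> H (n + 2) \<times> H n \<subseteq> H (n + 2) \<times> H n" by blast
  have z: "z1 *\<^sub>C a \<in> H n" if "a \<in> H (n + 2)" for a using that H_mono[of n "n + 2"] by auto
  have 1: "(a, b + z1 *\<^sub>C a) \<in> L \<inter> H (n + 2) \<times> H n" if "(a, b) \<in> Bres n" for a b
    using that z by (auto simp: Bres_def in_B)
  have 2: "(a, b + (- complex_of_real z1) *\<^sub>C a) \<in> Bres n" if "(a, b) \<in> L \<inter> H (n + 2) \<times> H n" for a b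
    using that z by (auto simp: Bres_def in_B complex_vector.scale_minus_left H.diff_mem)
  show ?thesis
  proof
    assume "(x, x') \<in> L_scale H ip L n"
    from shear_closure[OF sub Bres_sub 2 this[unfolded L_scale_def]]
    show "(x, x' - z1 *\<^sub>C x) \<in> U n" by (simp add: U_def complex_vector.scale_minus_left)
  next
    assume "(x, x' - z1 *\<^sub>C x) \<in> U n"
    from shear_closure[OF Bres_sub sub 1 this[unfolded U_def]]
    show "(x, x') \<in> L_scale H ip L n" by (simp add: L_scale_def)
  qed
qed

text \<open>\<open>L_ext - z1\<close>, the union of the unitary maps \<open>U n\<close>.\<close>

definition UU :: "('v \<times> 'v) set" where "UU = (\<Union>n. U n)"

section \<open>The union of the extensions, its powers and regularity\<close>

lemma rel_shift_L_ext: "rel_shift (L_ext H ip L) z1 = UU"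
proof -
  have "(x, w) \<in> rel_shift (L_ext H ip L) z1 \<longleftrightarrow> (x, w + z1 *\<^sub>C x) \<in> L_ext H ip L" for x w
    unfolding rel_shift_def by force
  hence "(x, w) \<in> rel_shift (L_ext H ip L) z1 \<longleftrightarrow> (x, w) \<in> UU" for x w
    by (simp add: L_ext_def UU_def L_scale_iff)
  thus ?thesis by auto
qed

lemma UU_common: assumes "(x, x') \<in> UU" "(y, y') \<in> UU" shows "\<exists>n. (x, x') \<in> U n \<and> (y, y') \<in> U n"
proof -
  obtain n k where "(x, x') \<in> U n" "(y, y') \<in> U k" using assms unfolding UU_def by blast
  thus ?thesis using U_mono[of "min n k" n] U_mono[of "min n k" k] by (intro exI[of _ "min n k"]) auto
qed

lemma U_lin: "lin_rel (U n)"
  using U_unitary unfolding unitary_rel_def by blast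

lemma UU_lin: "lin_rel UU"
proof (rule lin_relI)
  show "(0, 0) \<in> UU" using lin_rel_zero[OF U_lin] unfolding UU_def by blast
  show "(x + y, x' + y') \<in> UU" if "(x, x') \<in> UU" "(y, y') \<in> UU" for x x' y y'
    using UU_common[OF that] lin_rel_add[OF U_lin] unfolding UU_def by blast
  show "(a *\<^sub>C x, a *\<^sub>C x') \<in> UU" if "(x, x') \<in> UU" for x x' a
    using that lin_rel_scale[OF U_lin] unfolding UU_def by blast
qed

lemma UU_inj: "(x, y) \<in> UU \<Longrightarrow> (x', y) \<in> UU \<Longrightarrow> x = x'"
  using UU_common[of x y x' y] unitary_inj[OF U_unitary inner] by blast

lemma UU_single_valued: "(x, y) \<in> UU \<Longrightarrow> (x, y') \<in> UU \<Longrightarrow> y = y'"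
  using UU_common[of x y x y'] unitary_single_valued[OF U_unitary inner] by blast

lemma U_sub: "U n \<subseteq> UU" unfolding UU_def by blast

text \<open>Regularity: \<open>U n\<close> is onto \<open>H n\<close>, so a preimage exists at level
  \<open>n\<close>, and by injectivity it is the only one in \<open>UU\<close>.\<close>

lemma UU_range: assumes "(x, y) \<in> UU" "y \<in> H n" shows "(x, y) \<in> U n"
proof -
  obtain x' where "(x', y) \<in> U n" using assms U_unitary[of n] unfolding unitary_rel_def by blast
  thus ?thesis using UU_inj assms U_sub by blast
qed

lemma UU_domain: assumes "(x, y) \<in> UU" "x \<in> H (n + 2)" shows "(x, y) \<in> U n"
proof -
  obtain y' where "(x, y') \<in> U n" using assms U_unitary[of n] unfolding unitary_rel_def by blast
  thus ?thesis using UU_single_valued assms U_sub by blast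
qed

lemma U_mem: "(x, y) \<in> U n \<Longrightarrow> x \<in> H (n + 2) \<and> y \<in> H n"
  using U_unitary[of n] unfolding unitary_rel_def by blast

lemma U_nrm: "(x, y) \<in> U n \<Longrightarrow> nrm (n + 2) x = nrm n y"
  by (rule unitary_nrm[OF U_unitary])

lemma UU_pow_lin: "lin_rel (UU ^^ j)"
proof (induction j)
  case 0 show ?case by (auto simp: lin_rel_def)
next
  case (Suc j)
  show ?case unfolding relpow.simps
    using Suc UU_lin by (intro lin_relI) (blast intro: lin_rel_zero lin_rel_add lin_rel_scale)+
qed

lemma UU_pow_ex: "y \<in> H n \<Longrightarrow> \<exists>x\<in>H (n + 2 * int j). (x, y) \<in> UU ^^ j"
proof (induction j arbitrary: n y)
  case 0 thus ?case by auto
next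
  case (Suc j)
  then obtain w where w: "(w, y) \<in> U n" using U_unitary[of n] unfolding unitary_rel_def by blast
  obtain x where "x \<in> H (n + 2 + 2 * int j)" "(x, w) \<in> UU ^^ j" using Suc.IH[of w "n + 2"] U_mem[OF w] by blast
  thus ?case using w U_sub by (intro bexI[of _ x]) (auto simp: algebra_simps)
qed

lemma UU_pow_inj: "(x, y) \<in> UU ^^ j \<Longrightarrow> (x', y) \<in> UU ^^ j \<Longrightarrow> x = x'"
  by (induction j arbitrary: y) (auto dest: UU_inj)

lemma UU_pow_nrm: "(x, y) \<in> UU ^^ j \<Longrightarrow> y \<in> H n \<Longrightarrow> nrm (n + 2 * int j) x = nrm n y"
proof (induction j arbitrary: n y)
  case 0 thus ?case by auto
next
  case (Suc j)
  then obtain w where w: "(x, w) \<in> UU ^^ j" "(w, y) \<in> UU" by auto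
  hence wU: "(w, y) \<in> U n" using UU_range Suc.prems by blast
  hence "nrm (n + 2 + 2 * int j) x = nrm (n + 2) w" using Suc.IH[OF w(1)] U_mem by blast
  thus ?case using U_nrm[OF wU] by (simp add: algebra_simps)
qed

text \<open>The way back from the h_{sigma j} to the functionals: it lets the independence
  hypothesis on the \<open>\<phi> \<sigma>\<close> act on their preimages at every level.\<close>

lemma UU_pow_down: "(x, y) \<in> UU ^^ j \<Longrightarrow> x \<in> H (n + 2 * int j) \<Longrightarrow> y \<in> H n"
proof (induction j arbitrary: n y)
  case 0 thus ?case by auto
next
  case (Suc j)
  then obtain w where w: "(x, w) \<in> UU ^^ j" "(w, y) \<in> UU" by auto
  have "w \<in> H (n + 2)" using Suc.IH[OF w(1), of "n + 2"] Suc.prems(2) by (simp add: algebra_simps)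
  thus ?case using UU_domain w U_mem by blast
qed

lemma P_UU_pow: "u \<in> H 0 \<Longrightarrow> (P j u, u) \<in> UU ^^ j"
proof (induction j arbitrary: u)
  case 0 thus ?case by auto
next
  case (Suc j)
  have "(Bi u, u) \<in> UU" using B_mem[OF Suc.prems] Bres_neg[of "-1"] Bres_sub_U[of "-1"] U_sub[of "-1"] by auto
  moreover have "(P j (Bi u), Bi u) \<in> UU ^^ j" using Suc Bi_mem by blast
  ultimately show ?case by (auto simp: P_Suc2)
qed

text \<open>In formulas, <psi, (L - z1)^(-1) w> = <(L - z1)^(-m-1) psi, w>_m; the power
  \<open>m + 1\<close> raises the index -m-2 to exactly m. For vectors of \<open>H 0\<close> this is
  \<open>ip_P\<close> together with symmetry of \<open>Bi\<close>, and since the powers of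
  \<open>UU\<close> preserve norms, it passes to the limit.\<close>

lemma pairing_eq:
  assumes \<psi>: "\<psi> \<in> H (- int m - 2)" and x: "(x, \<psi>) \<in> UU ^^ (m + 1)" and f: "(f, w) \<in> U (int m)"
  shows "pairing H ip (int m + 2) \<psi> f = ip (int m) x w"
proof -
  have e: "- (int m + 2) = - int m - 2" "- int m - 2 + 2 * int (m + 1) = int m" by simp_all
  have fw: "(f, w) \<in> B" "w \<in> H (int m)" using f U_nonneg[of "int m"] U_mem by auto
  hence f0: "w \<in> H 0" "f = Bi w" using in_B_iff by auto
  obtain x' where x': "x' \<in> H (int m)" "(x', \<psi>) \<in> UU ^^ (m + 1)" using UU_pow_ex[OF \<psi>, of "m + 1"] unfolding e by blast
  have xm: "x \<in> H (int m)" using x x' UU_pow_inj by blast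
  have lim: "(\<lambda>k. ip 0 (u k) f) \<longlonglongrightarrow> ip (int m) x w"
    if u: "\<And>k. u k \<in> H 0" "(\<lambda>k. nrm (- int m - 2) (u k - \<psi>)) \<longlonglongrightarrow> 0" for u
  proof -
    have Pu: "P (m + 1) (u k) \<in> H (int m)" for k using P_mem_H[of "Bi (u k)" m] Bi_mem u(1) by (simp add: P_Suc2)
    have "nrm (int m) (P (m + 1) (u k) - x) = nrm (- int m - 2) (u k - \<psi>)" for k
    proof -
      have "(P (m + 1) (u k) - x, u k - \<psi>) \<in> UU ^^ (m + 1)"
        by (intro lin_rel_diff UU_pow_lin P_UU_pow u x)
      moreover have "u k - \<psi> \<in> H (- int m - 2)" using u(1) \<psi> H_mono[of "- int m - 2" 0] by (auto intro: H.diff_mem)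
      ultimately show ?thesis using UU_pow_nrm[of _ _ "m + 1" "- int m - 2"] unfolding e by blast
    qed
    hence "(\<lambda>k. nrm (int m) (P (m + 1) (u k) - x)) \<longlonglongrightarrow> 0" using u(2) by simp
    hence "(\<lambda>k. ip (int m) (P (m + 1) (u k)) w) \<longlonglongrightarrow> ip (int m) x w"
      using Pu xm fw by (intro H.ip_tendsto) auto
    moreover have "ip (int m) (P (m + 1) (u k)) w = ip 0 (u k) f" for k
    proof -
      have "ip (int m) (P m (Bi (u k))) w = ip 0 (Bi (u k)) w" by (intro ip_P Bi_mem u fw)
      thus ?thesis using Bi_symmetric[OF u(1)[of k] f0(1)] f0 by (simp add: P_Suc2)
    qed
    ultimately show ?thesis by simp
  qed
  have H0: "H 0 \<subseteq> H (- int m - 2)" using H_mono[of "- int m - 2" 0] by auto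
  have iff: "range u \<subseteq> H 0 \<and> limitin (ip_topology (H (- int m - 2)) (ip (- int m - 2))) u \<psi> sequentially
      \<longleftrightarrow> (\<forall>k. u k \<in> H 0) \<and> (\<lambda>k. nrm (- int m - 2) (u k - \<psi>)) \<longlonglongrightarrow> 0" for u
  proof (cases "range u \<subseteq> H 0")
    case True
    thus ?thesis using H.limitin_iff[of u "- int m - 2" \<psi>] H0 \<psi> by auto
  qed auto
  \<comment> \<open>An approximating sequence has to exist, since otherwise the condition that
    singles out the limit would hold vacuously for every number.\<close>
  obtain u where u: "\<And>k. u k \<in> H 0" "(\<lambda>k. nrm (- int m - 2) (u k - \<psi>)) \<longlonglongrightarrow> 0"
    using H.dense_sequence[of "H 0" "- int m - 2" \<psi>] H0 H0_dense[of "- int m - 2" \<psi>] \<psi> by auto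
  show ?thesis unfolding pairing_def e iff
    by (rule the_equality) (use lim u LIMSEQ_unique in blast)+
qed

end

section \<open>Linear algebra in the finite-dimensional part\<close>

lemma mat_vec_cong: "(\<And>j. j \<in> I \<Longrightarrow> v j = w j) \<Longrightarrow> mat_vec I A v i = mat_vec I A w i"
  by (simp add: mat_vec_def)

lemma mat_vec_add: "mat_vec I A (\<lambda>j. v j + w j) i = mat_vec I A v i + mat_vec I A w i"
  by (simp add: mat_vec_def distrib_left sum.distrib)

lemma mat_vec_diff: "mat_vec I A (\<lambda>j. v j - w j) i = mat_vec I A v i - mat_vec I A w i"
  by (simp add: mat_vec_def right_diff_distrib sum_subtractf)

lemma mat_vec_scale: "mat_vec K A (\<lambda>j. c * v j) i = c * mat_vec K A v i"
  by (simp add: mat_vec_def sum_distrib_left ac_simps)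

lemma mat_vec_zero: "mat_vec I A (\<lambda>j. 0) i = 0"
  by (simp add: mat_vec_def)

lemma mat_vec_mult: "mat_vec I (mat_mult I A B) v i = mat_vec I A (mat_vec I B v) i"
proof -
  have "mat_vec I (mat_mult I A B) v i = (\<Sum>j\<in>I. \<Sum>k\<in>I. A i k * (B k j * v j))"
    by (simp add: mat_vec_def mat_mult_def sum_distrib_right mult.assoc)
  also have "\<dots> = (\<Sum>k\<in>I. \<Sum>j\<in>I. A i k * (B k j * v j))" by (rule sum.swap)
  finally show ?thesis by (simp add: mat_vec_def sum_distrib_left)
qed

definition cdot :: "'i set \<Rightarrow> ('i \<Rightarrow> complex) \<Rightarrow> ('i \<Rightarrow> complex) \<Rightarrow> complex" where
  "cdot I v w = (\<Sum>i\<in>I. cnj (v i) * w i)"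

lemma cdot_cong: "(\<And>i. i \<in> I \<Longrightarrow> v i = v' i) \<Longrightarrow> (\<And>i. i \<in> I \<Longrightarrow> w i = w' i) \<Longrightarrow> cdot I v w = cdot I v' w'"
  by (simp add: cdot_def)

lemma cdot_adj: "cdot I v (mat_vec I (mat_adj A) w) = cdot I (mat_vec I A v) w"
proof -
  have "cdot I v (mat_vec I (mat_adj A) w) = (\<Sum>i\<in>I. \<Sum>j\<in>I. cnj (v i) * (cnj (A j i) * w j))"
    by (simp add: cdot_def mat_vec_def mat_adj_def sum_distrib_left)
  also have "\<dots> = (\<Sum>j\<in>I. \<Sum>i\<in>I. cnj (v i) * (cnj (A j i) * w j))" by (rule sum.swap)
  also have "\<dots> = cdot I (mat_vec I A v) w"
    by (simp add: cdot_def mat_vec_def sum_distrib_right sum_distrib_left ac_simps)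
  finally show ?thesis .
qed

lemma cdot_commute: "cdot I w v = cnj (cdot I v w)"
  by (simp add: cdot_def mult.commute)

lemma cdot_add_right: "cdot I v (\<lambda>i. w i + w' i) = cdot I v w + cdot I v w'"
  by (simp add: cdot_def distrib_left sum.distrib)

lemma cdot_add_left: "cdot I (\<lambda>i. w i + w' i) v = cdot I w v + cdot I w' v"
  by (simp add: cdot_def distrib_right sum.distrib)

lemma cdot_scale_right: "cdot I v (\<lambda>i. a * w i) = a * cdot I v w"
  by (simp add: cdot_def sum_distrib_left ac_simps)

lemma cdot_zero_left: "cdot I (\<lambda>i. 0) v = 0"
  by (simp add: cdot_def)

lemma cdot_self: "Re (cdot I v v) = (\<Sum>i\<in>I. (cmod (v i))\<^sup>2)"
  unfolding cdot_def Re_sum by (intro sum.cong refl) (simp add: cmod_power2, simp add: power2_eq_square)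

lemma cdot_unit: "finite I \<Longrightarrow> j \<in> I \<Longrightarrow> cdot I (\<lambda>i. of_bool (i = j)) w = w j"
  unfolding cdot_def by (subst sum.remove[of I j]) (auto intro!: sum.neutral)

section \<open>The space \<open>H_A\<close>\<close>

locale extension = hscale H ip L z1
  for H :: "int \<Rightarrow> 'v::complex_vector set" and ip L z1 +
  fixes m :: nat
    and \<phi> :: "'s::finite \<Rightarrow> 'v"
    and G :: "'s \<times> nat \<Rightarrow> 's \<times> nat \<Rightarrow> complex"
  assumes m_pos: "m \<ge> 1"
    and phi: "\<And>\<sigma>. \<phi> \<sigma> \<in> H (- int m - 2)"
    and phi_indep: "\<And>c :: complex ^ 's. (\<Sum>\<sigma>\<in>UNIV. (c $ \<sigma>) *\<^sub>C \<phi> \<sigma>) \<in> H (- int m - 1) \<Longrightarrow> c = 0"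
    and G_invertible: "mat_invertible (UNIV \<times> {1..m}) G"
    and G_hermitian: "mat_hermitian (UNIV \<times> {1..m}) G"
    and G_cond: "m \<ge> 2 \<Longrightarrow> G (\<sigma>, m - 1) (\<sigma>', m) = G (\<sigma>, m) (\<sigma>', m - 1)"
begin

abbreviation X :: "'v set" where "X \<equiv> H (int m)"
abbreviation ipm :: "'v \<Rightarrow> 'v \<Rightarrow> complex" where "ipm \<equiv> ip (int m)"
abbreviation I :: "('s \<times> nat) set" where "I \<equiv> idx_A m"
abbreviation h where "h \<equiv> h_elem H ip L z1 \<phi>"
abbreviation hc where "hc \<equiv> h_comb H ip L z1 \<phi>"
abbreviation eta where "eta \<equiv> eta_vec m"
abbreviation KA where "KA \<equiv> K_A H ip L z1 m \<phi>"
abbreviation HA where "HA \<equiv> H_A H ip L z1 m \<phi>"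
abbreviation HAmin where "HAmin \<equiv> H_A_min H ip L z1 m \<phi>"
abbreviation HAperp where "HAperp \<equiv> H_A_perp H ip L z1 m \<phi> G"
abbreviation ipA where "ipA \<equiv> ip_A H ip L z1 m \<phi> G"
abbreviation ips where "ips \<equiv> ip_sum H ip L z1 m \<phi>"
abbreviation Aop where "Aop \<equiv> A_op H ip L z1 m \<phi>"
abbreviation Md where "Md \<equiv> M_d z1 :: 's \<times> nat \<Rightarrow> 's \<times> nat \<Rightarrow> complex"
abbreviation GM where "GM \<equiv> G_M z1 m G"

section \<open>The vectors h_{sigma j} and coordinates in H_A\<close>

lemma finite_I [simp]: "finite I"
  by (simp add: idx_A_def)

lemma top_index [simp]: "(\<sigma>, m) \<in> I"
  using m_pos by (simp add: idx_A_def)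

lemma h_elem_pow: "(h \<sigma> j, \<phi> \<sigma>) \<in> UU ^^ j" and h_elem_mem: "h \<sigma> j \<in> H (- int m - 2 + 2 * int j)"
proof -
  obtain x where x: "x \<in> H (- int m - 2 + 2 * int j)" "(x, \<phi> \<sigma>) \<in> UU ^^ j" using UU_pow_ex[OF phi] by blast
  hence "h \<sigma> j = x" unfolding h_elem_def rel_shift_L_ext using UU_pow_inj by blast
  thus "(h \<sigma> j, \<phi> \<sigma>) \<in> UU ^^ j" "h \<sigma> j \<in> H (- int m - 2 + 2 * int j)" using x by auto
qed

lemma hc_mem: "hc j c \<in> H (- int m - 2 + 2 * int j)"
  unfolding h_comb_def by (intro H.sum_mem H.scale_mem h_elem_mem)

lemma hc_zero [simp]: "hc j 0 = 0"
  by (simp add: h_comb_def)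

text \<open>Applying (L - z1)^j lowers the index by \<open>2 * j\<close> and turns
  \<open>hc j c\<close> into the same combination of the \<open>\<phi> \<sigma>\<close>, which then
  lies in H (-m-1).\<close>

lemma hc_indep: assumes "hc j c \<in> H p" "- int m - 1 + 2 * int j \<le> p" shows "c = 0"
proof -
  have "(hc j c, \<Sum>\<sigma>\<in>UNIV. (c $ \<sigma>) *\<^sub>C \<phi> \<sigma>) \<in> UU ^^ j"
    unfolding h_comb_def by (intro lin_rel_sum lin_rel_scale UU_pow_lin h_elem_pow)
  moreover have "hc j c \<in> H (- int m - 1 + 2 * int j)" using assms H_mono by blast
  ultimately show ?thesis using UU_pow_down phi_indep by blast
qed

text \<open>Inverse of \<open>coord\<close> on \<open>K_A\<close>. Vectors are written as
  \<open>kc d\<close> from here on, so that the definite descriptions behind \<open>coord\<close>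
  and \<open>H_part\<close> are met only where \<open>ip_A\<close>, \<open>ip_sum\<close>,
  \<open>A_op\<close> and \<open>ker_Gamma\<close> are translated.\<close>

definition kc :: "('s \<times> nat \<Rightarrow> complex) \<Rightarrow> 'v" where
  "kc d = (\<Sum>(\<sigma>, j)\<in>I. d (\<sigma>, j) *\<^sub>C h \<sigma> j)"

lemma kc_hc: "kc d = (\<Sum>j\<in>{1..m}. hc j (\<chi> \<sigma>. d (\<sigma>, j)))"
  unfolding kc_def idx_A_def h_comb_def
  by (subst sum.cartesian_product[symmetric], subst sum.swap) simp

text \<open>Blocks below \<open>j\<close> vanish by induction, blocks above \<open>j\<close> lie in
  H (-m-1+2j) anyway; hence so does block \<open>j\<close>, and \<open>hc_indep\<close> applies. For
  \<open>p = m\<close> all blocks are covered, which makes the sum of \<open>H m\<close> and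
  \<open>K_A\<close> direct; for \<open>p = m - 2\<close> exactly block \<open>m\<close> escapes,
  which gives \<open>K_min\<close>.\<close>

lemma kc_coeff_zero:
  assumes k: "kc d \<in> H p" and "j \<in> {1..m}" "- int m - 1 + 2 * int j \<le> p"
  shows "d (\<sigma>, j) = 0"
  using assms(2,3)
proof (induction j arbitrary: \<sigma> rule: less_induct)
  case (less j)
  let ?n = "- int m - 1 + 2 * int j"
  have "hc j' (\<chi> \<sigma>. d (\<sigma>, j')) \<in> H ?n" if "j' \<in> {1..m} - {j}" for j'
  proof (cases "j' < j")
    case True
    hence "(\<chi> \<sigma>. d (\<sigma>, j')) = 0" using less that by (simp add: vec_eq_iff)
    thus ?thesis by simp
  next
    case False
    thus ?thesis using that H_mono[OF _ hc_mem[of j'], of ?n] by simp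
  qed
  hence "(\<Sum>j'\<in>{1..m} - {j}. hc j' (\<chi> \<sigma>. d (\<sigma>, j'))) \<in> H ?n" by (rule H.sum_mem)
  moreover have "kc d \<in> H ?n" using k less.prems H_mono by blast
  moreover have "hc j (\<chi> \<sigma>. d (\<sigma>, j)) = kc d - (\<Sum>j'\<in>{1..m} - {j}. hc j' (\<chi> \<sigma>. d (\<sigma>, j')))"
    unfolding kc_hc using less.prems by (subst sum.remove[of "{1..m}" j]) auto
  ultimately have "hc j (\<chi> \<sigma>. d (\<sigma>, j)) \<in> H ?n" by (simp add: H.diff_mem)
  hence "(\<chi> \<sigma>. d (\<sigma>, j)) = 0" using hc_indep by blast
  thus ?case by (simp add: vec_eq_iff)
qed

lemma kc_cong: "(\<And>i. i \<in> I \<Longrightarrow> d i = e i) \<Longrightarrow> kc d = kc e"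
  unfolding kc_def by (intro sum.cong) auto

lemma kc_add: "kc (\<lambda>i. d i + e i) = kc d + kc e"
  unfolding kc_def by (simp add: sum.distrib[symmetric] complex_vector.scale_left_distrib case_prod_unfold)

lemma kc_diff: "kc (\<lambda>i. d i - e i) = kc d - kc e"
  unfolding kc_def by (simp add: sum_subtractf[symmetric] complex_vector.scale_left_diff_distrib case_prod_unfold)

lemma kc_scale: "kc (\<lambda>i. a * d i) = a *\<^sub>C kc d"
  unfolding kc_def by (simp add: complex_vector.scale_sum_right scaleC_scaleC case_prod_unfold)

lemma kc_zero [simp]: "kc (\<lambda>i. 0) = 0"
  by (simp add: kc_def case_prod_unfold)

lemma kc_mem_X_zero: "kc d \<in> X \<Longrightarrow> i \<in> I \<Longrightarrow> d i = 0"
  using kc_coeff_zero[of d "int m" "snd i" "fst i"] by (auto simp: idx_A_def)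

lemma kc_eta: "kc (eta c) = hc m c"
proof -
  have "hc j (\<chi> \<sigma>. eta c (\<sigma>, j)) = 0" if "j \<noteq> m" for j
  proof -
    have "(\<chi> \<sigma>. eta c (\<sigma>, j)) = 0" using that by (simp add: vec_eq_iff eta_vec_def)
    thus ?thesis by simp
  qed
  moreover have "(\<chi> \<sigma>. eta c (\<sigma>, m)) = c" by (simp add: vec_eq_iff eta_vec_def)
  ultimately show ?thesis
    unfolding kc_hc using m_pos by (subst sum.remove[of "{1..m}" m]) (auto intro!: sum.neutral)
qed

lemma KA_eq: "KA = range kc"
proof
  have base: "h \<sigma> j \<in> complex_vector.span {h \<sigma> j | \<sigma> j. (\<sigma>, j) \<in> I}" if "(\<sigma>, j) \<in> I" for \<sigma> j
    using that by (intro complex_vector.span_base) blast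
  show "range kc \<subseteq> KA"
    unfolding K_A_def kc_def
    by (clarsimp, intro complex_vector.span_sum) (auto intro: complex_vector.span_scale base)
  have "complex_vector.subspace (range kc)"
  proof (rule complex_vector.subspaceI)
    show "0 \<in> range kc" using rangeI[of kc "\<lambda>i. 0"] by simp
    show "x + y \<in> range kc" if "x \<in> range kc" "y \<in> range kc" for x y
      using that by (auto simp: kc_add[symmetric])
    show "c *\<^sub>C x \<in> range kc" if "x \<in> range kc" for c x
      using that by (auto simp: kc_scale[symmetric])
  qed
  moreover have "h \<sigma> j \<in> range kc" if "(\<sigma>, j) \<in> I" for \<sigma> j
  proof -
    have "kc (\<lambda>i. of_bool (i = (\<sigma>, j))) = h \<sigma> j"
      unfolding kc_def using that
      by (subst sum.remove[of I "(\<sigma>, j)"]) (auto simp: scaleC_one intro!: sum.neutral)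
    thus ?thesis using rangeI[of kc "\<lambda>i. of_bool (i = (\<sigma>, j))"] by simp
  qed
  ultimately show "KA \<subseteq> range kc"
    unfolding K_A_def by (intro complex_vector.span_minimal) auto
qed

lemma coord_kc: assumes "i \<in> I" shows "coord H ip L z1 m \<phi> (kc d) i = d i"
proof -
  have "coord H ip L z1 m \<phi> (kc d) = (\<lambda>i. if i \<in> I then d i else 0)"
    unfolding coord_def kc_def[symmetric]
  proof (rule the_equality)
    show "(\<forall>i. i \<notin> I \<longrightarrow> (if i \<in> I then d i else 0) = 0) \<and> kc d = kc (\<lambda>i. if i \<in> I then d i else 0)"
      using kc_cong[of d "\<lambda>i. if i \<in> I then d i else 0"] by simp
    fix e assume e: "(\<forall>i. i \<notin> I \<longrightarrow> e i = 0) \<and> kc d = kc e"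
    hence "kc (\<lambda>i. d i - e i) \<in> X" by (simp add: kc_diff)
    hence "d i - e i = 0" if "i \<in> I" for i using kc_mem_X_zero[of "\<lambda>i. d i - e i"] that by simp
    thus "e = (\<lambda>i. if i \<in> I then d i else 0)" using e by auto
  qed
  thus ?thesis using assms by simp
qed

definition vec :: "'v \<Rightarrow> ('s \<times> nat \<Rightarrow> complex) \<Rightarrow> 'v" where "vec f d = f + kc d"

lemma vec_cong: "(\<And>i. i \<in> I \<Longrightarrow> d i = e i) \<Longrightarrow> vec f d = vec f e"
  using kc_cong unfolding vec_def by metis

lemma vec_eq: assumes "f \<in> X" "f' \<in> X" shows "vec f d = vec f' d' \<longleftrightarrow> f = f' \<and> (\<forall>i\<in>I. d i = d' i)"
proof
  assume "vec f d = vec f' d'"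
  hence e: "kc (\<lambda>i. d i - d' i) = f' - f" unfolding kc_diff vec_def by (simp add: algebra_simps)
  hence "kc (\<lambda>i. d i - d' i) \<in> X" using assms by (simp add: H.diff_mem)
  hence z: "\<forall>i\<in>I. d i - d' i = 0" using kc_mem_X_zero[of "\<lambda>i. d i - d' i"] by simp
  hence "kc (\<lambda>i. d i - d' i) = 0" using kc_cong[of "\<lambda>i. d i - d' i" "\<lambda>i. 0"] by simp
  thus "f = f' \<and> (\<forall>i\<in>I. d i = d' i)" using z e by simp
next
  assume "f = f' \<and> (\<forall>i\<in>I. d i = d' i)"
  thus "vec f d = vec f' d'" using vec_cong by blast
qed

lemma vec_add: "vec f d + vec f' d' = vec (f + f') (\<lambda>i. d i + d' i)"
  by (simp add: vec_def kc_add)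

lemma vec_scale: "a *\<^sub>C vec f d = vec (a *\<^sub>C f) (\<lambda>i. a * d i)"
  by (simp add: vec_def kc_scale complex_vector.scale_right_distrib)

lemma vec_zero: "vec 0 (\<lambda>i. 0) = 0"
  by (simp add: vec_def)

lemma HA_eq: "HA = {vec f d | f d. f \<in> X}"
  unfolding H_A_def KA_eq vec_def by blast

lemma vec_mem_HA: "f \<in> X \<Longrightarrow> vec f d \<in> HA"
  unfolding HA_eq by blast

lemma H_part_vec: assumes "f \<in> X" shows "H_part H ip L z1 m \<phi> (vec f d) = f"
  unfolding H_part_def
proof (rule the_equality)
  show "f \<in> X \<and> vec f d - f \<in> KA" using assms by (simp add: KA_eq vec_def)
  fix f' assume f': "f' \<in> X \<and> vec f d - f' \<in> KA"
  then obtain d' where "vec f d = vec f' d'" unfolding KA_eq vec_def by (metis imageE add_diff_eq diff_add_cancel add.commute)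
  thus "f' = f" using vec_eq assms f' by blast
qed

lemma K_part_vec: "f \<in> X \<Longrightarrow> K_part H ip L z1 m \<phi> (vec f d) = kc d"
  unfolding K_part_def by (simp add: H_part_vec) (simp add: vec_def)

lemma ipA_vec: assumes "f \<in> X" "f' \<in> X"
  shows "ipA (vec f d) (vec f' d') = ipm f f' + cdot I d (mat_vec I G d')"
proof -
  have "cdot I (coord H ip L z1 m \<phi> (kc d)) (mat_vec I G (coord H ip L z1 m \<phi> (kc d'))) = cdot I d (mat_vec I G d')"
    by (intro cdot_cong mat_vec_cong coord_kc)
  thus ?thesis unfolding ip_A_def using assms by (simp add: H_part_vec K_part_vec cdot_def)
qed

lemma ips_vec: assumes "f \<in> X" "f' \<in> X" shows "ips (vec f d) (vec f' d') = ipm f f' + cdot I d d'"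
proof -
  have "cdot I (coord H ip L z1 m \<phi> (kc d)) (coord H ip L z1 m \<phi> (kc d')) = cdot I d d'"
    by (intro cdot_cong coord_kc)
  thus ?thesis unfolding ip_sum_def using assms by (simp add: H_part_vec K_part_vec cdot_def)
qed

lemma K_min_eq: "K_min H ip L z1 m \<phi> = {kc (eta c) | c. True}"
proof
  show "K_min H ip L z1 m \<phi> \<subseteq> {kc (eta c) | c. True}"
  proof
    fix k assume "k \<in> K_min H ip L z1 m \<phi>"
    then obtain d where d: "k = kc d" "kc d \<in> H (int m - 2)" unfolding K_min_def KA_eq by auto
    have "d i = eta (\<chi> \<sigma>. d (\<sigma>, m)) i" if i: "i \<in> I" for i
    proof (cases i)
      case (Pair \<sigma> j)
      show ?thesis
      proof (cases "j = m")
        case False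
        hence "j \<in> {1..m}" "- int m - 1 + 2 * int j \<le> int m - 2" using i Pair by (auto simp: idx_A_def)
        from kc_coeff_zero[OF d(2) this, of \<sigma>] show ?thesis using False Pair by (simp add: eta_vec_def)
      qed (simp add: Pair eta_vec_def)
    qed
    hence "k = kc (eta (\<chi> \<sigma>. d (\<sigma>, m)))" unfolding d(1) by (rule kc_cong)
    thus "k \<in> {kc (eta c) | c. True}" by blast
  qed
  have "hc m c \<in> H (int m - 2)" for c using hc_mem[of m c] by simp
  thus "{kc (eta c) | c. True} \<subseteq> K_min H ip L z1 m \<phi>"
    unfolding K_min_def KA_eq by (auto simp: kc_eta) (simp flip: kc_eta)
qed

lemma HAmin_eq: "HAmin = {vec f (eta c) | f c. f \<in> X}"
  unfolding H_A_min_def K_min_eq vec_def by blast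

lemma vec_mem_HAmin: assumes "f \<in> X" shows "vec f d \<in> HAmin \<longleftrightarrow> (\<exists>c. \<forall>i\<in>I. d i = eta c i)"
  unfolding HAmin_eq using vec_eq[OF assms] assms by blast

lemma cdot_eta: "cdot I (eta c) q = (\<Sum>\<sigma>\<in>UNIV. cnj (c $ \<sigma>) * q (\<sigma>, m))"
proof -
  have "cdot I (eta c) q = (\<Sum>\<sigma>\<in>UNIV. \<Sum>j\<in>{1..m}. cnj (eta c (\<sigma>, j)) * q (\<sigma>, j))"
    unfolding cdot_def idx_A_def sum.cartesian_product by (simp add: case_prod_unfold)
  also have "\<dots> = (\<Sum>\<sigma>\<in>UNIV. cnj (c $ \<sigma>) * q (\<sigma>, m))"
    using m_pos by (intro sum.cong refl, subst sum.remove[of _ m]) (auto simp: eta_vec_def intro!: sum.neutral)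
  finally show ?thesis .
qed

lemma mat_vec_eta: "mat_vec I A (eta c) i = (\<Sum>\<sigma>\<in>UNIV. A i (\<sigma>, m) * c $ \<sigma>)"
proof -
  have "mat_vec I A (eta c) i = cnj (cdot I (eta c) (\<lambda>j. cnj (A i j)))"
    by (simp add: mat_vec_def cdot_def mult.commute)
  thus ?thesis unfolding cdot_eta by (simp add: mult.commute)
qed

text \<open>\<open>gm d\<close> is the paper's \<open>[G d]\<^sub>m\<close>.\<close>

definition gm :: "('s \<times> nat \<Rightarrow> complex) \<Rightarrow> 's \<Rightarrow> complex" where "gm d \<sigma> = mat_vec I G d (\<sigma>, m)"

lemma G_adj: "cdot I v (mat_vec I G w) = cdot I (mat_vec I G v) w"
proof -
  have "mat_vec I G w i = mat_vec I (mat_adj G) w i" if "i \<in> I" for i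
    unfolding mat_vec_def using G_hermitian that unfolding mat_hermitian_def idx_A_def
    by (intro sum.cong) auto
  hence "cdot I v (mat_vec I G w) = cdot I v (mat_vec I (mat_adj G) w)" by (intro cdot_cong) auto
  thus ?thesis by (simp add: cdot_adj)
qed

abbreviation Gi where "Gi \<equiv> mat_inv I G"

lemma G_Gi: "i \<in> I \<Longrightarrow> mat_vec I G (mat_vec I Gi v) i = v i"
  and Gi_G: "i \<in> I \<Longrightarrow> mat_vec I Gi (mat_vec I G v) i = v i"
proof -
  have inv: "mat_inverse_of I G Gi"
    unfolding mat_inv_def using G_invertible unfolding mat_invertible_def idx_A_def by (rule someI_ex)
  have unit: "(\<Sum>j\<in>I. of_bool (i = j) * v j) = v i" if "i \<in> I" for i
    using that by (subst sum.remove[of _ i]) (auto intro!: sum.neutral)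
  show "mat_vec I G (mat_vec I Gi v) i = v i" "mat_vec I Gi (mat_vec I G v) i = v i" if "i \<in> I"
    using inv that unit[OF that] unfolding mat_vec_mult[symmetric] mat_inverse_of_def
    by (simp_all add: mat_vec_def)
qed

text \<open>Testing \<open>vec f d\<close> against \<open>f\<close> itself forces
  \<open>f = 0\<close>, as the form is definite on \<open>H m\<close>; testing against the unit
  vectors of block \<open>m\<close> forces \<open>gm d = 0\<close>.\<close>

lemma HAperp_eq: "HAperp = {vec 0 d | d. \<forall>\<sigma>. gm d \<sigma> = 0}"
proof
  show "HAperp \<subseteq> {vec 0 d | d. \<forall>\<sigma>. gm d \<sigma> = 0}"
  proof
    fix y assume y: "y \<in> HAperp"
    then obtain f d where fd: "y = vec f d" "f \<in> X" unfolding H_A_perp_def HA_eq by auto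
    have 0: "ipm g f + cdot I (eta c) (mat_vec I G d) = 0" if g: "g \<in> X" for g c
    proof -
      have "vec g (eta c) \<in> HAmin" using g unfolding HAmin_eq by blast
      hence "ipA (vec g (eta c)) (vec f d) = 0" using y fd unfolding H_A_perp_def by blast
      thus ?thesis using ipA_vec g fd by simp
    qed
    have "ipm f f = 0" using 0[of f 0] fd by (simp add: cdot_eta)
    hence f0: "f = 0" using H.ip_self_eq_0 fd by blast
    have "gm d \<sigma> = 0" for \<sigma>
      using 0[of 0 "axis \<sigma> 1"] f0 by (simp add: cdot_eta gm_def axis_def if_distrib if_distribR cong: if_cong)
    thus "y \<in> {vec 0 d | d. \<forall>\<sigma>. gm d \<sigma> = 0}" using fd f0 by blast
  qed
  show "{vec 0 d | d. \<forall>\<sigma>. gm d \<sigma> = 0} \<subseteq> HAperp"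
  proof
    fix y assume "y \<in> {vec 0 d | d. \<forall>\<sigma>. gm d \<sigma> = 0}"
    then obtain d where d: "y = vec 0 d" "\<forall>\<sigma>. gm d \<sigma> = 0" by blast
    have "ipA x y = 0" if "x \<in> HAmin" for x
    proof -
      obtain f c where "x = vec f (eta c)" "f \<in> X" using \<open>x \<in> HAmin\<close> unfolding HAmin_eq by auto
      thus ?thesis using d by (simp add: ipA_vec cdot_eta gm_def)
    qed
    thus "y \<in> HAperp" unfolding H_A_perp_def using d vec_mem_HA[of 0] by simp
  qed
qed

text \<open>\<open>J\<close> is \<open>(L - z1)\<^sup>-\<^sup>1\<close> in \<open>H m\<close>.\<close>

definition J :: "'v \<Rightarrow> 'v" where "J w = (THE f. (f, w) \<in> U (int m))"

section \<open>The resolvent in \<open>H m\<close> and the operators expressed by it\<close>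

lemma U_iff_J: "(f, w) \<in> U (int m) \<longleftrightarrow> w \<in> X \<and> f = J w"
proof
  assume fw: "(f, w) \<in> U (int m)"
  hence "J w = f" unfolding J_def using UU_inj U_sub by (blast intro: the_equality)
  thus "w \<in> X \<and> f = J w" using U_mem fw by blast
next
  assume w: "w \<in> X \<and> f = J w"
  then obtain f' where f': "(f', w) \<in> U (int m)" using U_unitary[of "int m"] unfolding unitary_rel_def by blast
  hence "J w = f'" unfolding J_def using UU_inj U_sub by (blast intro: the_equality)
  thus "(f, w) \<in> U (int m)" using f' w by simp
qed

lemma J_mem: "w \<in> X \<Longrightarrow> J w \<in> H (int m + 2)"
  using U_iff_J U_mem by blast

lemma J_mem_X [intro]: "w \<in> X \<Longrightarrow> J w \<in> X"
  using J_mem H_mono[of "int m" "int m + 2"] by simp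

lemma J_surj: "f \<in> H (int m + 2) \<Longrightarrow> \<exists>w\<in>X. f = J w"
  using U_iff_J U_unitary[of "int m"] unfolding unitary_rel_def by blast

lemma J_diff: "w \<in> X \<Longrightarrow> w' \<in> X \<Longrightarrow> J (w - w') = J w - J w'"
  using lin_rel_diff[OF U_lin, of "J w" w "int m" "J w'" w'] U_iff_J by auto

lemma J_zero [simp]: "J 0 = 0"
  using lin_rel_zero[OF U_lin, of "int m"] U_iff_J by auto

lemma J_inj: "w \<in> X \<Longrightarrow> w' \<in> X \<Longrightarrow> J w = J w' \<Longrightarrow> w = w'"
  using U_iff_J UU_single_valued U_sub by blast

lemma J_Bi: "w \<in> X \<Longrightarrow> w \<in> H 0 \<and> J w = Bi w"
  using U_iff_J U_nonneg[of "int m"] in_B_iff by fastforce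

text \<open>On vectors \<open>P m y\<close> the resolvent commutes with \<open>P m\<close>, and
  \<open>ip_P\<close> reduces the claim to symmetry of \<open>Bi\<close> in \<open>H 0\<close>.
  These vectors are dense in \<open>H m\<close>, and \<open>J\<close> is bounded there.\<close>

lemma J_symmetric: assumes w: "w \<in> X" and v: "v \<in> X" shows "ipm (J w) v = ipm w (J v)"
proof -
  obtain C where C: "\<forall>x\<in>H (int m + 2). nrm (int m) x \<le> C * nrm (int m + 2) x"
    using embeds[of "int m" "int m + 2"] unfolding embeds_def by auto
  \<comment> \<open>\<open>J\<close> is isometric from \<open>H m\<close> to
    \<open>H (m + 2)\<close>, so the constant of the embedding bounds it in
    \<open>H m\<close>.\<close>
  have bd: "nrm (int m) (J x) \<le> C * nrm (int m) x" if "x \<in> X" for x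
    using C J_mem[OF that] U_nrm[of "J x" x "int m"] that U_iff_J by auto
  have "\<forall>e>0. \<exists>y\<in>P m ` H 0. nrm (int m) (w - y) < e" using P_dense(1)[OF w] by fast
  then obtain u where u: "\<And>k. u k \<in> P m ` H 0" "(\<lambda>k. nrm (int m) (u k - w)) \<longlonglongrightarrow> 0"
    using H.dense_sequence[of "P m ` H 0" "int m" w] w P_mem_H by blast
  have uX: "u k \<in> X" for k using u(1)[of k] P_mem_H by auto
  have eq: "ipm (J (u k)) v = ipm (u k) (J v)" for k
  proof -
    obtain y where y: "u k = P m y" "y \<in> H 0" using u(1)[of k] by blast
    have "J (u k) = P m (Bi y)" using J_Bi[OF uX[of k]] y by (simp add: P_Suc[symmetric] P_Suc2[symmetric])
    hence "ipm (J (u k)) v = ip 0 (Bi y) v" using ip_P[OF Bi_mem[OF y(2)] v] by simp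
    also have "\<dots> = ip 0 y (J v)" using Bi_symmetric[OF y(2)] J_Bi[OF v] by simp
    also have "\<dots> = ipm (u k) (J v)" using ip_P[OF y(2) J_mem_X[OF v]] y by simp
    finally show ?thesis .
  qed
  have "(\<lambda>k. nrm (int m) (J (u k - w))) \<longlonglongrightarrow> 0"
    by (rule tendsto_0_of_bounded[where V=X and q="\<lambda>x. nrm (int m) (J x)" and p="nrm (int m)" and C=C, OF _ _ _ u(2)])
      (use bd uX w H.nrm_nonneg J_mem_X in \<open>auto simp: H.diff_mem\<close>)
  hence "(\<lambda>k. nrm (int m) (J (u k) - J w)) \<longlonglongrightarrow> 0" using J_diff uX w by simp
  hence "(\<lambda>k. ipm (J (u k)) v) \<longlonglongrightarrow> ipm (J w) v"
    using uX w v J_mem_X by (intro H.ip_tendsto) auto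
  moreover have "(\<lambda>k. ipm (u k) (J v)) \<longlonglongrightarrow> ipm w (J v)"
    using uX w v J_mem_X u(2) by (intro H.ip_tendsto) auto
  ultimately show ?thesis using LIMSEQ_unique unfolding eq by blast
qed

text \<open>The first of the h_{sigma j} to lie in \<open>H m\<close>, since -m-2+2(m+1) = m. By
  \<open>pairing_J\<close> they represent the functionals \<open>\<phi> \<sigma>\<close> composed
  with \<open>J\<close>.\<close>

abbreviation a where "a \<sigma> \<equiv> h \<sigma> (m + 1)"
abbreviation ac where "ac \<equiv> hc (m + 1)"

lemma a_mem [intro]: "a \<sigma> \<in> X" and ac_mem [intro]: "ac c \<in> X"
  using h_elem_mem[of \<sigma> "m + 1"] hc_mem[of "m + 1" c] by auto

lemma ip_ac: "w \<in> X \<Longrightarrow> ipm (ac c) w = (\<Sum>\<sigma>\<in>UNIV. cnj (c $ \<sigma>) * ipm (a \<sigma>) w)"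
  unfolding h_comb_def using H.ip_sum_left[of w "int m" UNIV "\<lambda>\<sigma>. (c $ \<sigma>) *\<^sub>C a \<sigma>"]
  by (simp only: H.ip_scale_left[OF a_mem] H.scale_mem[OF a_mem])

lemma pairing_J: "w \<in> X \<Longrightarrow> pairing H ip (int m + 2) (\<phi> \<sigma>) (J w) = ipm (a \<sigma>) w"
  by (rule pairing_eq[OF phi h_elem_pow]) (simp add: U_iff_J)

text \<open>Writing \<open>f = J w\<close>, the \<open>H m\<close> part of the image becomes
  \<open>w\<close> plus \<open>z1\<close> times the \<open>H m\<close> part of the argument. As
  \<open>z1\<close> is real, this multiple cancels whenever the two sides of an adjoint are
  compared.\<close>

lemma Aop_eq:
  "Aop N = {(vec (J w + ac c) d, vec (w + z1 *\<^sub>C (J w + ac c)) d') | w c d d'.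
     w \<in> X \<and> (\<forall>i\<in>I. d' i = mat_vec I N d i + eta c i)}" (is "_ = ?R")
proof
  show "Aop N \<subseteq> ?R"
  proof
    fix p assume "p \<in> Aop N"
    then obtain f f' c k k' where p: "p = (f + ac c + k, f' + z1 *\<^sub>C ac c + k')"
      "(f, f') \<in> L_scale H ip L (int m)" "k \<in> KA" "k' \<in> KA"
      "\<forall>i\<in>I. coord H ip L z1 m \<phi> k' i = mat_vec I N (coord H ip L z1 m \<phi> k) i + eta c i"
      unfolding A_op_def by blast
    obtain d d' where d: "k = kc d" "k' = kc d'" using p(3,4) unfolding KA_eq by blast
    define w where "w = f' - z1 *\<^sub>C f"
    have w: "w \<in> X" "f = J w" using p(2) unfolding L_scale_iff w_def[symmetric] U_iff_J by auto
    have "f' = w + z1 *\<^sub>C f" by (simp add: w_def)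
    hence f': "f' = w + z1 *\<^sub>C J w" by (simp only: w(2)[symmetric])
    have "\<forall>i\<in>I. d' i = mat_vec I N d i + eta c i"
    proof
      fix i assume i: "i \<in> I"
      have "mat_vec I N (coord H ip L z1 m \<phi> (kc d)) i = mat_vec I N d i" by (rule mat_vec_cong[OF coord_kc])
      thus "d' i = mat_vec I N d i + eta c i" using p(5) i unfolding d by (simp add: coord_kc)
    qed
    moreover have "p = (vec (J w + ac c) d, vec (w + z1 *\<^sub>C (J w + ac c)) d')"
      unfolding p(1) f' d w(2) vec_def by (simp add: complex_vector.scale_right_distrib add.assoc)
    ultimately show "p \<in> ?R" using w(1) by blast
  qed
  show "?R \<subseteq> Aop N"
  proof
    fix p assume "p \<in> ?R"
    then obtain w c d d' where p: "p = (vec (J w + ac c) d, vec (w + z1 *\<^sub>C (J w + ac c)) d')"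
      "w \<in> X" "\<forall>i\<in>I. d' i = mat_vec I N d i + eta c i" by blast
    have co: "\<forall>i\<in>I. coord H ip L z1 m \<phi> (kc d') i = mat_vec I N (coord H ip L z1 m \<phi> (kc d)) i + eta c i"
    proof
      fix i assume i: "i \<in> I"
      have "mat_vec I N (coord H ip L z1 m \<phi> (kc d)) i = mat_vec I N d i" by (rule mat_vec_cong[OF coord_kc])
      thus "coord H ip L z1 m \<phi> (kc d') i = mat_vec I N (coord H ip L z1 m \<phi> (kc d)) i + eta c i"
        using p(3) i by (simp add: coord_kc)
    qed
    have "(J w, w + z1 *\<^sub>C J w) \<in> L_scale H ip L (int m)" using p(2) by (simp add: L_scale_iff U_iff_J)
    moreover have "p = (J w + ac c + kc d, (w + z1 *\<^sub>C J w) + z1 *\<^sub>C ac c + kc d')"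
      by (simp add: p(1) vec_def complex_vector.scale_right_distrib add.assoc)
    ultimately show "p \<in> Aop N" unfolding A_op_def using J_mem[OF p(2)] co KA_eq by blast
  qed
qed

text \<open>\<open>J u\<close> runs through \<open>H (m + 2)\<close>, and \<open>\<langle>\<phi>, J u\<rangle>\<close> has the components \<open>ipm (a \<sigma>) u\<close>.\<close>

lemma ker_Gamma_eq:
  "ker_Gamma H ip L z1 m \<phi> G = {vec (J u) l | u l. u \<in> X \<and> (\<forall>\<sigma>. ipm (a \<sigma>) u = gm l \<sigma>)}" (is "_ = ?R")
proof -
  have co: "mat_vec I G (coord H ip L z1 m \<phi> (kc l)) (\<sigma>, m) = gm l \<sigma>" for l \<sigma>
    unfolding gm_def by (rule mat_vec_cong[OF coord_kc])
  show ?thesis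
  proof (intro equalityI subsetI)
    fix x assume "x \<in> ker_Gamma H ip L z1 m \<phi> G"
    then obtain f c k where x: "x = f + hc (m + 1) c + k" "c = 0" "f \<in> H (int m + 2)" "k \<in> KA"
      "(\<chi> \<sigma>. pairing H ip (int m + 2) (\<phi> \<sigma>) f - mat_vec I G (coord H ip L z1 m \<phi> k) (\<sigma>, m)) = 0"
      unfolding ker_Gamma_def Gamma_rel_def by force
    obtain l where l: "k = kc l" using x unfolding KA_eq by blast
    obtain u where u: "u \<in> X" "f = J u" using J_surj x by blast
    have "ipm (a \<sigma>) u = gm l \<sigma>" for \<sigma>
      using x(5) unfolding u l co pairing_J[OF u(1)] by (simp add: vec_eq_iff)
    thus "x \<in> ?R" using x u l unfolding vec_def by auto
  next
    fix x assume "x \<in> ?R"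
    then obtain u l where x: "x = vec (J u) l" "u \<in> X" "\<forall>\<sigma>. ipm (a \<sigma>) u = gm l \<sigma>" by blast
    hence "(\<chi> \<sigma>. pairing H ip (int m + 2) (\<phi> \<sigma>) (J u) - mat_vec I G (coord H ip L z1 m \<phi> (kc l)) (\<sigma>, m)) = 0"
      unfolding co by (simp add: vec_eq_iff pairing_J[OF x(2)])
    thus "x \<in> ker_Gamma H ip L z1 m \<phi> G"
      unfolding ker_Gamma_def Gamma_rel_def mem_Collect_eq using x J_mem[OF x(2)] KA_eq
      by (intro exI[of _ "J u"] exI[of _ 0] exI[of _ "kc l"]) (simp add: vec_def)
  qed
qed

section \<open>The relations\<close>

text \<open>The corner [G_M]_{m,m} applied to \<open>e\<close>.\<close>

abbreviation \<kappa> :: "complex ^ 's \<Rightarrow> 's \<Rightarrow> complex" where "\<kappa> e \<sigma> \<equiv> mat_vec I GM (eta e) (\<sigma>, m)"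

lemma gm_Md: "gm (mat_vec I Md (eta e)) \<sigma> = \<kappa> e \<sigma>"
  by (simp add: gm_def G_M_def mat_vec_mult)

text \<open>Only the last and, for \<open>m \<ge> 2\<close>, the last but one column of \<open>G\<close> enter, and the hypothesis on \<open>G\<close>
  makes this corner of \<open>G_M\<close> Hermitian.\<close>

lemma GM_corner_hermitian: "GM (\<sigma>, m) (\<tau>, m) = cnj (GM (\<tau>, m) (\<sigma>, m))"
proof -
  have e: "GM (\<sigma>, m) (\<tau>, m) = (\<Sum>j\<in>{1..m}. G (\<sigma>, m) (\<tau>, j) * M_mat z1 j m)" for \<sigma> \<tau>
  proof -
    have "GM (\<sigma>, m) (\<tau>, m) = (\<Sum>\<rho>\<in>UNIV. \<Sum>j\<in>{1..m}. G (\<sigma>, m) (\<rho>, j) * (of_bool (\<rho> = \<tau>) * M_mat z1 j m))"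
      unfolding G_M_def mat_mult_def M_d_def idx_A_def sum.cartesian_product by (simp add: case_prod_unfold)
    also have "\<dots> = (\<Sum>\<rho>\<in>UNIV. if \<rho> = \<tau> then \<Sum>j\<in>{1..m}. G (\<sigma>, m) (\<tau>, j) * M_mat z1 j m else 0)"
      by (intro sum.cong) auto
    finally show ?thesis by simp
  qed
  have "G (\<sigma>, m) (\<tau>, j) * M_mat z1 j m = cnj (G (\<tau>, m) (\<sigma>, j) * M_mat z1 j m)" if j: "j \<in> {1..m}" for j
  proof -
    have herm: "cnj (G (\<tau>, m) (\<sigma>, j)) = G (\<sigma>, j) (\<tau>, m)"
      using G_hermitian j m_pos unfolding mat_hermitian_def mat_adj_def by auto
    \<comment> \<open>Column \<open>m\<close> of \<open>M_mat\<close> has the real entry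
      \<open>z1\<close> in row \<open>m\<close>, the entry 1 in row \<open>m - 1\<close> and zeros
      elsewhere; row \<open>m - 1\<close> is where the hypothesis on \<open>G\<close>
      enters.\<close>
    consider "j = m" | "Suc j = m" | "j \<noteq> m" "Suc j \<noteq> m" by blast
    thus ?thesis
    proof cases
      case 2
      hence "G (\<sigma>, j) (\<tau>, m) = G (\<sigma>, m) (\<tau>, j)" using G_cond[of \<sigma> \<tau>] j by auto
      thus ?thesis using 2 herm by (auto simp: M_mat_def)
    qed (use herm in \<open>auto simp: M_mat_def\<close>)
  qed
  thus ?thesis unfolding e cnj_sum by (intro sum.cong) auto
qed

text \<open>\<open>G\<close> cancels its inverse and leaves the corner of the adjoint of
  \<open>GM\<close>, which is the corner of \<open>GM\<close> itself because that is
  Hermitian.\<close>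

lemma gm_Gi_GM: "gm (mat_vec I (mat_mult I Gi (mat_adj GM)) (eta e)) \<sigma> = \<kappa> e \<sigma>"
proof -
  have "gm (mat_vec I (mat_mult I Gi (mat_adj GM)) (eta e)) \<sigma> = mat_vec I (mat_adj GM) (eta e) (\<sigma>, m)"
    unfolding gm_def mat_vec_mult[abs_def] by (simp add: G_Gi)
  also have "\<dots> = \<kappa> e \<sigma>"
    unfolding mat_vec_eta mat_adj_def by (intro sum.cong refl) (simp flip: GM_corner_hermitian)
  finally show ?thesis .
qed

lemma kappa_hermitian: "(\<Sum>\<sigma>\<in>UNIV. cnj (e' $ \<sigma>) * \<kappa> e \<sigma>) = cnj (\<Sum>\<sigma>\<in>UNIV. cnj (e $ \<sigma>) * \<kappa> e' \<sigma>)"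
proof -
  have "(\<Sum>\<sigma>\<in>UNIV. cnj (e' $ \<sigma>) * \<kappa> e \<sigma>) = (\<Sum>\<sigma>\<in>UNIV. \<Sum>\<tau>\<in>UNIV. cnj (e' $ \<sigma>) * (GM (\<sigma>, m) (\<tau>, m) * e $ \<tau>))"
    by (simp add: mat_vec_eta sum_distrib_left)
  also have "\<dots> = (\<Sum>\<tau>\<in>UNIV. \<Sum>\<sigma>\<in>UNIV. cnj (e' $ \<sigma>) * (GM (\<sigma>, m) (\<tau>, m) * e $ \<tau>))" by (rule sum.swap)
  also have "\<dots> = (\<Sum>\<tau>\<in>UNIV. \<Sum>\<sigma>\<in>UNIV. e $ \<tau> * cnj (GM (\<tau>, m) (\<sigma>, m) * e' $ \<sigma>))"
    by (intro sum.cong refl) (simp flip: GM_corner_hermitian)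
  also have "\<dots> = cnj (\<Sum>\<sigma>\<in>UNIV. cnj (e $ \<sigma>) * \<kappa> e' \<sigma>)"
    by (simp add: mat_vec_eta sum_distrib_left)
  finally show ?thesis .
qed

lemma cdot_G_eta: "cdot I d (mat_vec I G (eta e)) = cnj (\<Sum>\<sigma>\<in>UNIV. cnj (e $ \<sigma>) * gm d \<sigma>)"
proof -
  have "cdot I d (mat_vec I G (eta e)) = cdot I (mat_vec I G d) (eta e)" by (rule G_adj)
  also have "\<dots> = cnj (cdot I (eta e) (mat_vec I G d))" by (rule cdot_commute)
  finally show ?thesis by (simp add: cdot_eta gm_def)
qed

lemma cdot_eta_G: "cdot I (eta e) (mat_vec I G d) = (\<Sum>\<sigma>\<in>UNIV. cnj (e $ \<sigma>) * gm d \<sigma>)"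
  by (simp add: cdot_eta gm_def)

text \<open>The explicit form of \<open>B_max\<close>: lying in \<open>H_A_min\<close> reduces the
  coordinates of the argument to \<open>eta e\<close>, and of the coordinates \<open>d\<close> of
  the image only block \<open>m\<close> of \<open>G d\<close> is prescribed.\<close>

definition BM :: "('v \<times> 'v) set" where
  "BM = {(vec (J w + ac c) (eta e), vec (w + z1 *\<^sub>C (J w + ac c)) d) | w c e d.
    w \<in> X \<and> (\<forall>\<sigma>. gm d \<sigma> = \<kappa> e \<sigma> + gm (eta c) \<sigma>)}"

text \<open>\<open>BM\<close> with \<open>c = 0\<close> and the boundary condition that the second
  component of Gamma vanishes, that is, <phi, J u> = [G eta(e)]_m.\<close>

definition Bm :: "('v \<times> 'v) set" where
  "Bm = {(vec (J u) (eta e), vec (u + z1 *\<^sub>C J u) d) | u e d.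
    u \<in> X \<and> (\<forall>\<sigma>. gm d \<sigma> = \<kappa> e \<sigma>) \<and> (\<forall>\<sigma>. ipm (a \<sigma>) u = gm (eta e) \<sigma>)}"

lemma gm_add: "gm (\<lambda>i. d i + e i) \<sigma> = gm d \<sigma> + gm e \<sigma>"
  and gm_diff: "gm (\<lambda>i. d i - e i) \<sigma> = gm d \<sigma> - gm e \<sigma>"
  and gm_zero: "gm (\<lambda>i. 0) \<sigma> = 0"
  by (simp_all add: gm_def mat_vec_add mat_vec_diff mat_vec_zero)

lemma gm_cong: "(\<And>i. i \<in> I \<Longrightarrow> d i = e i) \<Longrightarrow> gm d \<sigma> = gm e \<sigma>"
  unfolding gm_def by (rule mat_vec_cong)

lemma eta_zero: "eta 0 = (\<lambda>i. 0)"
  by (auto simp: eta_vec_def)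

text \<open>One statement serves \<open>M_d\<close> and G^(-1) G_M^*, which share the corner. The
  set \<open>D\<close> is kept apart from the domain of \<open>Aop N\<close> because
  \<open>A_max'\<close> is to be restricted by means of the domain of \<open>A_max\<close>.\<close>

lemma restrict_Aop_sum_perp:
  assumes N: "\<And>e \<sigma>. gm (mat_vec I N (eta e)) \<sigma> = \<kappa> e \<sigma>" and D: "Domain (Aop N) \<subseteq> D"
  shows "rel_restrict (Aop N) (D \<inter> HAmin) \<oplus>\<^sub>r ({0} \<times> HAperp) = BM"
proof (intro equalityI subsetI)
  fix p assume "p \<in> rel_restrict (Aop N) (D \<inter> HAmin) \<oplus>\<^sub>r ({0} \<times> HAperp)"
  then obtain x y q where p: "p = (x, y + vec 0 q)" "(x, y) \<in> Aop N" "x \<in> HAmin" "\<forall>\<sigma>. gm q \<sigma> = 0"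
    unfolding rel_sum_def rel_restrict_def HAperp_eq by auto
  obtain w c d d' where A: "x = vec (J w + ac c) d" "y = vec (w + z1 *\<^sub>C (J w + ac c)) d'" "w \<in> X"
    "\<forall>i\<in>I. d' i = mat_vec I N d i + eta c i"
    using p(2) unfolding Aop_eq by blast
  obtain e where e: "\<forall>i\<in>I. d i = eta e i"
    using p(3) vec_mem_HAmin[OF H.add_mem[OF J_mem_X[OF A(3)] ac_mem]] A(1) by auto
  have "gm d' \<sigma> = \<kappa> e \<sigma> + gm (eta c) \<sigma>" for \<sigma>
  proof -
    have "mat_vec I N d i = mat_vec I N (eta e) i" for i using e by (intro mat_vec_cong) auto
    hence "gm d' \<sigma> = gm (\<lambda>i. mat_vec I N (eta e) i + eta c i) \<sigma>" using A(4) by (intro gm_cong) auto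
    thus ?thesis by (simp add: gm_add N)
  qed
  hence "gm (\<lambda>i. d' i + q i) \<sigma> = \<kappa> e \<sigma> + gm (eta c) \<sigma>" for \<sigma> using p(4) by (simp add: gm_add)
  moreover have "p = (vec (J w + ac c) (eta e), vec (w + z1 *\<^sub>C (J w + ac c)) (\<lambda>i. d' i + q i))"
    using p(1) A e vec_cong[of d "eta e"] by (simp add: vec_add)
  ultimately show "p \<in> BM" unfolding BM_def using A(3) by blast
next
  fix p assume "p \<in> BM"
  then obtain w c e d where p: "p = (vec (J w + ac c) (eta e), vec (w + z1 *\<^sub>C (J w + ac c)) d)" "w \<in> X"
    "\<forall>\<sigma>. gm d \<sigma> = \<kappa> e \<sigma> + gm (eta c) \<sigma>" unfolding BM_def by blast
  \<comment> \<open>\<open>d'\<close> is what the operator itself prescribes; the block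
    \<open>gm (d - d')\<close> vanishes, so the remainder belongs to \<open>HAperp\<close>.\<close>
  define d' where "d' i = mat_vec I N (eta e) i + eta c i" for i
  have A: "(vec (J w + ac c) (eta e), vec (w + z1 *\<^sub>C (J w + ac c)) d') \<in> Aop N"
    unfolding Aop_eq d'_def using p(2) by blast
  moreover have "vec (J w + ac c) (eta e) \<in> HAmin"
    unfolding HAmin_eq using p(2) J_mem_X[of w] by (blast intro: H.add_mem)
  ultimately have "(vec (J w + ac c) (eta e), vec (w + z1 *\<^sub>C (J w + ac c)) d') \<in> rel_restrict (Aop N) (D \<inter> HAmin)"
    unfolding rel_restrict_def using D by blast
  moreover have "vec 0 (\<lambda>i. d i - d' i) \<in> HAperp"
    unfolding HAperp_eq using p(3) N by (auto simp: gm_diff gm_add d'_def[abs_def])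
  moreover have "p = (vec (J w + ac c) (eta e) + 0, vec (w + z1 *\<^sub>C (J w + ac c)) d' + vec 0 (\<lambda>i. d i - d' i))"
    by (simp add: p(1) vec_add)
  ultimately show "p \<in> rel_restrict (Aop N) (D \<inter> HAmin) \<oplus>\<^sub>r ({0} \<times> HAperp)"
    unfolding rel_sum_def by blast
qed

text \<open>The common form of \<open>A_min\<close> and \<open>A_min'\<close>, with the matrix \<open>N\<close> acting on the coordinates.\<close>

definition Am :: "('s \<times> nat \<Rightarrow> 's \<times> nat \<Rightarrow> complex) \<Rightarrow> ('v \<times> 'v) set" where
  "Am N = {(vec (J u) l, vec (u + z1 *\<^sub>C J u) l') | u l l'.
    u \<in> X \<and> (\<forall>\<sigma>. ipm (a \<sigma>) u = gm l \<sigma>) \<and> (\<forall>i\<in>I. l' i = mat_vec I N l i)}"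

lemma Domain_Am: "Domain (Am N) = ker_Gamma H ip L z1 m \<phi> G"
proof -
  have "\<exists>l'. \<forall>i\<in>I. l' i = mat_vec I N l i" for l by blast
  thus ?thesis unfolding Am_def ker_Gamma_eq by blast
qed

lemma restrict_Am_sum_perp:
  assumes N: "\<And>e \<sigma>. gm (mat_vec I N (eta e)) \<sigma> = \<kappa> e \<sigma>"
  shows "rel_restrict (Am N) (ker_Gamma H ip L z1 m \<phi> G \<inter> HAmin) \<oplus>\<^sub>r ({0} \<times> HAperp) = Bm"
proof (intro equalityI subsetI)
  fix p assume "p \<in> rel_restrict (Am N) (ker_Gamma H ip L z1 m \<phi> G \<inter> HAmin) \<oplus>\<^sub>r ({0} \<times> HAperp)"
  then obtain x y q where p: "p = (x, y + vec 0 q)" "(x, y) \<in> Am N" "x \<in> HAmin" "\<forall>\<sigma>. gm q \<sigma> = 0"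
    unfolding rel_sum_def rel_restrict_def HAperp_eq by auto
  obtain u l l' where A: "x = vec (J u) l" "y = vec (u + z1 *\<^sub>C J u) l'" "u \<in> X"
    "\<forall>\<sigma>. ipm (a \<sigma>) u = gm l \<sigma>" "\<forall>i\<in>I. l' i = mat_vec I N l i"
    using p(2) unfolding Am_def by blast
  obtain e where e: "\<forall>i\<in>I. l i = eta e i"
    using p(3) vec_mem_HAmin[of "J u" l] A J_mem_X[of u] by auto
  have "gm l' \<sigma> = \<kappa> e \<sigma>" for \<sigma>
  proof -
    have "mat_vec I N l i = mat_vec I N (eta e) i" for i using e by (intro mat_vec_cong) auto
    hence "gm l' \<sigma> = gm (mat_vec I N (eta e)) \<sigma>" using A(5) by (intro gm_cong) auto
    thus ?thesis by (simp add: N)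
  qed
  hence "gm (\<lambda>i. l' i + q i) \<sigma> = \<kappa> e \<sigma>" for \<sigma> using p(4) by (simp add: gm_add)
  moreover have "p = (vec (J u) (eta e), vec (u + z1 *\<^sub>C J u) (\<lambda>i. l' i + q i))"
    using p(1) A e vec_cong[of l "eta e"] by (simp add: vec_add)
  moreover have "gm l \<sigma> = gm (eta e) \<sigma>" for \<sigma> using e by (intro gm_cong) auto
  ultimately show "p \<in> Bm" unfolding Bm_def using A(3,4) by auto
next
  fix p assume "p \<in> Bm"
  then obtain u e d where p: "p = (vec (J u) (eta e), vec (u + z1 *\<^sub>C J u) d)" "u \<in> X"
    "\<forall>\<sigma>. gm d \<sigma> = \<kappa> e \<sigma>" "\<forall>\<sigma>. ipm (a \<sigma>) u = gm (eta e) \<sigma>" unfolding Bm_def by blast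
  define d' where "d' = mat_vec I N (eta e)"
  have A: "(vec (J u) (eta e), vec (u + z1 *\<^sub>C J u) d') \<in> Am N"
    unfolding Am_def d'_def using p(2,4) by blast
  moreover have "vec (J u) (eta e) \<in> HAmin"
    unfolding HAmin_eq using p(2) J_mem_X[of u] by blast
  ultimately have "(vec (J u) (eta e), vec (u + z1 *\<^sub>C J u) d') \<in> rel_restrict (Am N) (ker_Gamma H ip L z1 m \<phi> G \<inter> HAmin)"
    unfolding rel_restrict_def Domain_Am[of N, symmetric] by blast
  moreover have "vec 0 (\<lambda>i. d i - d' i) \<in> HAperp"
    unfolding HAperp_eq using p(3) N by (auto simp: gm_diff d'_def)
  moreover have "p = (vec (J u) (eta e) + 0, vec (u + z1 *\<^sub>C J u) d' + vec 0 (\<lambda>i. d i - d' i))"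
    by (simp add: p(1) vec_add)
  ultimately show "p \<in> rel_restrict (Am N) (ker_Gamma H ip L z1 m \<phi> G \<inter> HAmin) \<oplus>\<^sub>r ({0} \<times> HAperp)"
    unfolding rel_sum_def by blast
qed

text \<open>Regularity forces \<open>c = 0\<close>: on the kernel of Gamma the vector
  \<open>ac c\<close> is a difference of two vectors of \<open>H (m + 2)\<close>, whereas nonzero
  combinations of the h_{sigma,m+1} are not even in \<open>H (m + 1)\<close>.\<close>

lemma A_min'_eq: "A_min' H ip L z1 m \<phi> G = Am Md"
proof (intro equalityI subsetI)
  fix p assume "p \<in> A_min' H ip L z1 m \<phi> G"
  then obtain w c d d' where p: "p = (vec (J w + ac c) d, vec (w + z1 *\<^sub>C (J w + ac c)) d')" "w \<in> X"
    "\<forall>i\<in>I. d' i = mat_vec I Md d i + eta c i" "vec (J w + ac c) d \<in> ker_Gamma H ip L z1 m \<phi> G"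
    unfolding A_min'_def A_max_def rel_restrict_def Aop_eq by auto
  obtain u l where u: "vec (J w + ac c) d = vec (J u) l" "u \<in> X" "\<forall>\<sigma>. ipm (a \<sigma>) u = gm l \<sigma>"
    using p(4) unfolding ker_Gamma_eq by blast
  have "J w + ac c \<in> X" by (rule H.add_mem[OF J_mem_X[OF p(2)] ac_mem])
  hence eq: "J w + ac c = J u" "\<forall>i\<in>I. d i = l i" using u vec_eq J_mem_X by blast+
  have "ac c = J u - J w" using eq(1) by (simp add: algebra_simps)
  hence "ac c \<in> H (int m + 2)" using J_mem u(2) p(2) by (simp add: H.diff_mem)
  hence c: "c = 0" by (rule hc_indep) simp
  hence "w = u" using J_inj[OF p(2) u(2)] eq(1) by simp
  moreover have "gm l \<sigma> = gm d \<sigma>" for \<sigma> using eq(2) by (intro gm_cong) auto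
  ultimately show "p \<in> Am Md" unfolding Am_def using p(1,2,3) u(3) c by (auto simp: eta_zero)
next
  fix p assume "p \<in> Am Md"
  then obtain u l l' where p: "p = (vec (J u) l, vec (u + z1 *\<^sub>C J u) l')" "u \<in> X"
    "\<forall>\<sigma>. ipm (a \<sigma>) u = gm l \<sigma>" "\<forall>i\<in>I. l' i = mat_vec I Md l i" unfolding Am_def by blast
  have "vec (J u) l \<in> ker_Gamma H ip L z1 m \<phi> G" unfolding ker_Gamma_eq using p by blast
  moreover have "p = (vec (J u + ac 0) l, vec (u + z1 *\<^sub>C (J u + ac 0)) l')"
    "\<forall>i\<in>I. l' i = mat_vec I Md l i + eta 0 i" using p by (simp_all add: eta_zero)
  hence "p \<in> Aop Md" unfolding Aop_eq using p(2) by blast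
  ultimately show "p \<in> A_min' H ip L z1 m \<phi> G" unfolding A_min'_def A_max_def rel_restrict_def p(1) by simp
qed

section \<open>The indefinite form, the Hilbert sum topology and adjoints in general\<close>

lemma ipA_add_right: assumes "x \<in> HA" "y \<in> HA" "y' \<in> HA" shows "ipA x (y + y') = ipA x y + ipA x y'"
  using assms unfolding HA_eq
  by (auto simp: vec_add ipA_vec H.add_mem H.ip_add_right mat_vec_add[abs_def] cdot_add_right)

lemma ipA_scale_right: assumes "x \<in> HA" "y \<in> HA" shows "ipA x (c *\<^sub>C y) = c * ipA x y"
  using assms unfolding HA_eq
  by (auto simp: vec_scale ipA_vec H.scale_mem H.ip_scale_right mat_vec_scale[abs_def] cdot_scale_right distrib_left)

lemma ipA_commute: assumes "x \<in> HA" "y \<in> HA" shows "ipA y x = cnj (ipA x y)"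
proof -
  obtain f d f' d' where x: "x = vec f d" "f \<in> X" and y: "y = vec f' d'" "f' \<in> X"
    using assms unfolding HA_eq by blast
  have "cdot I d' (mat_vec I G d) = cnj (cdot I d (mat_vec I G d'))"
    using G_adj[of d' d] cdot_commute[of I "mat_vec I G d'" d] by simp
  thus ?thesis using x y H.ip_commute[of f "int m" f'] by (simp add: ipA_vec)
qed

lemma HA_subspace: "complex_vector.subspace HA"
proof (rule complex_vector.subspaceI)
  show "0 \<in> HA" using vec_mem_HA[of 0 "\<lambda>i. 0"] by (simp add: vec_zero)
  show "x + y \<in> HA" if "x \<in> HA" "y \<in> HA" for x y
    using that unfolding HA_eq by (auto simp: vec_add) (metis H.add_mem)
  show "c *\<^sub>C x \<in> HA" if "x \<in> HA" for c x
    using that unfolding HA_eq by (auto simp: vec_scale) (metis H.scale_mem)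
qed

lemma ips_inner: "inner_product_on HA ips"
  unfolding inner_product_on_def
proof (intro conjI ballI allI impI HA_subspace)
  fix x y z assume "x \<in> HA" "y \<in> HA" "z \<in> HA"
  thus "ips x (y + z) = ips x y + ips x z" unfolding HA_eq
    by (auto simp: vec_add ips_vec H.add_mem H.ip_add_right cdot_add_right)
next
  fix x y c assume "x \<in> HA" "y \<in> HA"
  thus "ips x (c *\<^sub>C y) = c * ips x y" unfolding HA_eq
    by (auto simp: vec_scale ips_vec H.scale_mem H.ip_scale_right cdot_scale_right distrib_left)
next
  fix x y assume "x \<in> HA" "y \<in> HA"
  then obtain f d f' d' where x: "x = vec f d" "f \<in> X" and y: "y = vec f' d'" "f' \<in> X"
    unfolding HA_eq by blast
  thus "ips y x = cnj (ips x y)"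
    using H.ip_commute[of f "int m" f'] cdot_commute[of I d' d] by (simp add: ips_vec)
next
  fix x assume "x \<in> HA" "x \<noteq> 0"
  then obtain f d where x: "x = vec f d" "f \<in> X" unfolding HA_eq by blast
  have e: "Re (ips x x) = Re (ipm f f) + (\<Sum>i\<in>I. (cmod (d i))\<^sup>2)"
    using x by (simp add: ips_vec cdot_self)
  have s: "(\<Sum>i\<in>I. (cmod (d i))\<^sup>2) \<ge> 0" by (intro sum_nonneg) auto
  show "0 < Re (ips x x)"
  proof (cases "f = 0")
    case False
    thus ?thesis using H.ip_pos[OF x(2)] e s by simp
  next
    case True
    have "\<exists>i\<in>I. d i \<noteq> 0"
    proof (rule ccontr)
      assume "\<not> (\<exists>i\<in>I. d i \<noteq> 0)"
      hence "x = 0" using x True vec_cong[of d "\<lambda>i. 0" 0] by (simp add: vec_zero)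
      thus False using \<open>x \<noteq> 0\<close> by simp
    qed
    then obtain i where i: "i \<in> I" "d i \<noteq> 0" by blast
    have "(cmod (d i))\<^sup>2 \<le> (\<Sum>i\<in>I. (cmod (d i))\<^sup>2)" using i by (intro member_le_sum) auto
    moreover have "0 < (cmod (d i))\<^sup>2" using i by simp
    ultimately have "0 < (\<Sum>i\<in>I. (cmod (d i))\<^sup>2)" by linarith
    thus ?thesis using e True by simp
  qed
qed

sublocale HA: ip_space HA ips
  by unfold_locales (rule ips_inner)

sublocale HHA: ip_space_pair HA HA ips ips
  by unfold_locales

text \<open>\<open>x'\<close> arises from \<open>x\<close> by applying \<open>G\<close> to its
  coordinates. This makes the indefinite form continuous in its second argument for the Hilbert sum
  topology.\<close>

lemma ipA_eq_ips: assumes "x \<in> HA" shows "\<exists>x'\<in>HA. \<forall>y\<in>HA. ipA x y = ips x' y"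
proof -
  obtain f d where x: "x = vec f d" "f \<in> X" using assms unfolding HA_eq by blast
  have "ipA x y = ips (vec f (mat_vec I G d)) y" if "y \<in> HA" for y
    using that x unfolding HA_eq by (auto simp: ipA_vec ips_vec G_adj)
  thus ?thesis using vec_mem_HA[OF x(2)] by blast
qed

lemma adjoint_linear: assumes "T \<subseteq> HA \<times> HA" shows "linear_relation_on HA (adjoint_rel HA ipA T)"
  unfolding linear_relation_on_iff
proof (intro conjI lin_relI)
  have T: "x \<in> HA" "x' \<in> HA" if "(x, x') \<in> T" for x x' using that assms by auto
  have z: "ipA x 0 = 0" if "x \<in> HA" for x using ipA_scale_right[OF that that, of 0] by simp
  show "adjoint_rel HA ipA T \<subseteq> HA \<times> HA" unfolding adjoint_rel_def by blast
  show "(0, 0) \<in> adjoint_rel HA ipA T" unfolding adjoint_rel_def using T z by auto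
  show "(y + w, y' + w') \<in> adjoint_rel HA ipA T"
    if "(y, y') \<in> adjoint_rel HA ipA T" "(w, w') \<in> adjoint_rel HA ipA T" for y y' w w'
    using that T unfolding adjoint_rel_def by (fastforce simp: ipA_add_right)
  show "(c *\<^sub>C y, c *\<^sub>C y') \<in> adjoint_rel HA ipA T" if "(y, y') \<in> adjoint_rel HA ipA T" for y y' c
    using that T unfolding adjoint_rel_def by (fastforce simp: ipA_scale_right)
qed

text \<open>Each condition that defines the adjoint equates two continuous functionals of the
  pair.\<close>

lemma adjoint_closed: assumes T: "T \<subseteq> HA \<times> HA"
  shows "closed_rel_A H ip L z1 m \<phi> (adjoint_rel HA ipA T)"
proof -
  let ?A = "adjoint_rel HA ipA T"
  have sub: "?A \<subseteq> HA \<times> HA" unfolding adjoint_rel_def by blast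
  have "HHA.topology_pair closure_of ?A \<subseteq> ?A"
  proof (rule subrelI)
    fix y y' assume "(y, y') \<in> HHA.topology_pair closure_of ?A"
    then obtain b b' where h: "y \<in> HA" "y' \<in> HA" "\<And>k. (b k, b' k) \<in> ?A"
      "(\<lambda>k. ip_norm ips (b k - y)) \<longlonglongrightarrow> 0" "(\<lambda>k. ip_norm ips (b' k - y')) \<longlonglongrightarrow> 0"
      using HHA.in_pair_closure_sequence[OF sub] by metis
    have b: "b k \<in> HA" "b' k \<in> HA" for k using h(3)[of k] sub by auto
    have lim: "(\<lambda>k. ipA x (c k)) \<longlonglongrightarrow> ipA x z"
      if l: "x \<in> HA" "\<And>k. c k \<in> HA" "z \<in> HA" "(\<lambda>k. ip_norm ips (c k - z)) \<longlonglongrightarrow> 0" for x c z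
    proof -
      obtain x' where x': "x' \<in> HA" "\<And>y. y \<in> HA \<Longrightarrow> ipA x y = ips x' y" using ipA_eq_ips[OF l(1)] by blast
      have "(\<lambda>k. ips x' (c k)) \<longlonglongrightarrow> ips x' z" using x' l by (intro HA.ip_tendsto) auto
      thus ?thesis using x' l by simp
    qed
    have "ipA x y' = ipA x' y" if "(x, x') \<in> T" for x x'
    proof -
      have "ipA x (b' k) = ipA x' (b k)" for k using h(3)[of k] that unfolding adjoint_rel_def by blast
      moreover have "(\<lambda>k. ipA x (b' k)) \<longlonglongrightarrow> ipA x y'" "(\<lambda>k. ipA x' (b k)) \<longlonglongrightarrow> ipA x' y"
        using that T by (auto intro!: lim b h)
      ultimately show ?thesis using LIMSEQ_unique by simp
    qed
    thus "(y, y') \<in> ?A" unfolding adjoint_rel_def using h by blast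
  qed
  thus ?thesis unfolding closed_rel_A_def closure_of_subset_eq[symmetric] using sub by simp
qed

section \<open>\<open>BM\<close> and \<open>Bm\<close> as adjoints of each other\<close>

lemma BM_sub: "BM \<subseteq> HA \<times> HA"
proof -
  have "J w + ac c \<in> X \<and> w + z1 *\<^sub>C (J w + ac c) \<in> X" if "w \<in> X" for w c
    using H.add_mem[OF J_mem_X[OF that] ac_mem] that by (blast intro: H.add_mem H.scale_mem)
  thus ?thesis unfolding BM_def using vec_mem_HA by blast
qed

lemma Bm_sub_BM: "Bm \<subseteq> BM"
proof
  fix p assume "p \<in> Bm"
  then obtain u e d where p: "p = (vec (J u) (eta e), vec (u + z1 *\<^sub>C J u) d)" "u \<in> X" "\<forall>\<sigma>. gm d \<sigma> = \<kappa> e \<sigma>"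
    unfolding Bm_def by blast
  have "p = (vec (J u + ac 0) (eta e), vec (u + z1 *\<^sub>C (J u + ac 0)) d)"
    "\<forall>\<sigma>. gm d \<sigma> = \<kappa> e \<sigma> + gm (eta 0) \<sigma>" using p by (simp_all add: eta_zero gm_zero)
  thus "p \<in> BM" unfolding BM_def using p(2) by blast
qed

lemma sum_axis: "(\<Sum>\<sigma>\<in>UNIV. cnj (axis \<tau> 1 $ \<sigma>) * q \<sigma>) = (q \<tau> :: complex)"
  by (simp add: axis_def if_distrib if_distribR cong: if_cong)

lemma eq_if_sums_eq:
  assumes "\<And>c :: complex ^ 's. (\<Sum>\<sigma>\<in>UNIV. cnj (c $ \<sigma>) * q \<sigma>) = (\<Sum>\<sigma>\<in>UNIV. cnj (c $ \<sigma>) * r \<sigma>)"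
  shows "q \<sigma> = (r \<sigma> :: complex)"
  using assms[of "axis \<sigma> 1"] by (simp only: sum_axis)

text \<open>In coordinates: what is orthogonal to \<open>H_A_perp\<close> lies in
  \<open>H_A_min\<close>. The test vectors are the images under the inverse of \<open>G\<close> of
  the unit vectors outside block \<open>m\<close>; each of them isolates one entry of
  \<open>l\<close>.\<close>

lemma eta_of_orth_perp:
  assumes "\<And>d. (\<And>\<sigma>. gm d \<sigma> = 0) \<Longrightarrow> cdot I d (mat_vec I G l) = 0"
  shows "\<exists>e. \<forall>i\<in>I. l i = eta e i"
proof (intro exI ballI)
  fix i assume i: "i \<in> I"
  show "l i = eta (\<chi> \<sigma>. l (\<sigma>, m)) i"
  proof (cases "snd i = m")
    case True thus ?thesis by (cases i) (simp add: eta_vec_def)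
  next
    case False
    define d where "d = mat_vec I Gi (\<lambda>j. of_bool (j = i))"
    have Gd: "mat_vec I G d j = of_bool (j = i)" if "j \<in> I" for j unfolding d_def using that by (rule G_Gi)
    have "gm d \<sigma> = 0" for \<sigma> unfolding gm_def using False Gd[OF top_index[of \<sigma>]] by auto
    hence "cdot I d (mat_vec I G l) = 0" by (rule assms)
    moreover have "cdot I (mat_vec I G d) l = cdot I (\<lambda>j. of_bool (j = i)) l" by (intro cdot_cong Gd refl)
    ultimately have "l i = 0" using G_adj[of d l] cdot_unit[OF finite_I i] by simp
    thus ?thesis using False by (cases i) (simp add: eta_vec_def)
  qed
qed

text \<open>Green's identity for the two relations. The multiples of the real \<open>z1\<close>
  agree, \<open>J\<close> is symmetric and the corner is Hermitian; the remaining boundary terms,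
  \<open>ipm (ac c) u\<close> on the left and [G eta(c)]_m against \<open>e'\<close> on the right,
  coincide by the condition on \<open>u\<close>.\<close>

lemma Bm_BM_orthogonal:
  assumes "w \<in> X" "u \<in> X" "\<forall>\<sigma>. gm d \<sigma> = \<kappa> e \<sigma> + gm (eta c) \<sigma>"
    "\<forall>\<sigma>. gm d' \<sigma> = \<kappa> e' \<sigma>" "\<forall>\<sigma>. ipm (a \<sigma>) u = gm (eta e') \<sigma>"
  shows "ipA (vec (J w + ac c) (eta e)) (vec (u + z1 *\<^sub>C J u) d')
    = ipA (vec (w + z1 *\<^sub>C (J w + ac c)) d) (vec (J u) (eta e'))"
proof -
  let ?x = "J w + ac c"
  have x: "?x \<in> X" by (rule H.add_mem[OF J_mem_X[OF assms(1)] ac_mem])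
  note mem = x assms(1,2) J_mem_X[OF assms(1)] J_mem_X[OF assms(2)] ac_mem[of c]
  have "ipm (ac c) u = (\<Sum>\<sigma>\<in>UNIV. cnj (c $ \<sigma>) * gm (eta e') \<sigma>)" using ip_ac[OF assms(2)] assms(5) by simp
  also have "\<dots> = cnj (\<Sum>\<sigma>\<in>UNIV. cnj (e' $ \<sigma>) * gm (eta c) \<sigma>)"
    using cdot_G_eta[of "eta c" e'] cdot_eta_G[of c "eta e'"] by simp
  finally have ac: "ipm (ac c) u = cnj (\<Sum>\<sigma>\<in>UNIV. cnj (e' $ \<sigma>) * gm (eta c) \<sigma>)" .
  have 1: "ipA (vec ?x (eta e)) (vec (u + z1 *\<^sub>C J u) d') = ipm (J w) u + ipm (ac c) u + z1 * ipm ?x (J u)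
      + (\<Sum>\<sigma>\<in>UNIV. cnj (e $ \<sigma>) * \<kappa> e' \<sigma>)"
  proof -
    have "ipm ?x (u + z1 *\<^sub>C J u) = ipm (J w) u + ipm (ac c) u + z1 * ipm ?x (J u)"
      using mem by (simp only: H.ip_add_right H.ip_add_left H.ip_scale_right H.scale_mem)
    moreover have "cdot I (eta e) (mat_vec I G d') = (\<Sum>\<sigma>\<in>UNIV. cnj (e $ \<sigma>) * \<kappa> e' \<sigma>)"
      unfolding cdot_eta_G using assms(4) by simp
    ultimately show ?thesis using ipA_vec[OF x, of "u + z1 *\<^sub>C J u"] mem by (simp only: H.add_mem H.scale_mem)
  qed
  have 2: "ipA (vec (w + z1 *\<^sub>C ?x) d) (vec (J u) (eta e')) = ipm w (J u) + z1 * ipm ?x (J u)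
      + cnj (\<Sum>\<sigma>\<in>UNIV. cnj (e' $ \<sigma>) * \<kappa> e \<sigma>) + ipm (ac c) u"
  proof -
    have "ipm (w + z1 *\<^sub>C ?x) (J u) = ipm w (J u) + cnj z1 * ipm ?x (J u)"
      using mem by (simp only: H.ip_add_left H.ip_scale_left H.scale_mem H.add_mem)
    moreover have "cdot I d (mat_vec I G (eta e')) = cnj (\<Sum>\<sigma>\<in>UNIV. cnj (e' $ \<sigma>) * \<kappa> e \<sigma>) + ipm (ac c) u"
      unfolding cdot_G_eta ac using assms(3) by (simp add: distrib_left sum.distrib)
    ultimately show ?thesis using ipA_vec[of "w + z1 *\<^sub>C ?x" "J u" d "eta e'"] mem
      by (simp add: H.add_mem H.scale_mem)
  qed
  show ?thesis unfolding 1 2 using J_symmetric[OF assms(1,2)] kappa_hermitian[of e e'] by simp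
qed

text \<open>The harder inclusion varies the parameters of \<open>BM\<close> one at a time:
  \<open>d\<close> with \<open>gm d = 0\<close> yields \<open>l = eta e'\<close>, then
  \<open>w\<close> yields \<open>g = J u\<close> for \<open>u = g' - z1 g\<close>, \<open>c\<close>
  the boundary condition on \<open>u\<close>, and \<open>e\<close> the block
  \<open>gm l'\<close>.\<close>

lemma adjoint_BM: "adjoint_rel HA ipA BM = Bm"
proof (intro equalityI subsetI)
  fix p assume "p \<in> Bm"
  then obtain u e' d' where p: "p = (vec (J u) (eta e'), vec (u + z1 *\<^sub>C J u) d')" "u \<in> X"
    "\<forall>\<sigma>. gm d' \<sigma> = \<kappa> e' \<sigma>" "\<forall>\<sigma>. ipm (a \<sigma>) u = gm (eta e') \<sigma>" unfolding Bm_def by blast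
  have "p \<in> HA \<times> HA" using \<open>p \<in> Bm\<close> Bm_sub_BM BM_sub by blast
  moreover have "\<forall>(x, x')\<in>BM. ipA x (snd p) = ipA x' (fst p)"
    unfolding BM_def using p Bm_BM_orthogonal[OF _ p(2) _ p(3,4)] by auto
  ultimately show "p \<in> adjoint_rel HA ipA BM" unfolding adjoint_rel_def by (cases p) auto
next
  fix p assume "p \<in> adjoint_rel HA ipA BM"
  then obtain g l g' l' where p: "p = (vec g l, vec g' l')" "g \<in> X" "g' \<in> X"
    and adj: "\<And>x x'. (x, x') \<in> BM \<Longrightarrow> ipA x (vec g' l') = ipA x' (vec g l)"
    unfolding adjoint_rel_def HA_eq by blast
  have eq: "ipm (J w + ac c) g' + (\<Sum>\<sigma>\<in>UNIV. cnj (e $ \<sigma>) * gm l' \<sigma>) =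
      ipm (w + z1 *\<^sub>C (J w + ac c)) g + cdot I d (mat_vec I G l)"
    if w: "w \<in> X" and d: "\<And>\<sigma>. gm d \<sigma> = \<kappa> e \<sigma> + gm (eta c) \<sigma>" for w c e d
  proof -
    have x: "J w + ac c \<in> X" by (rule H.add_mem[OF J_mem_X[OF w] ac_mem])
    have "(vec (J w + ac c) (eta e), vec (w + z1 *\<^sub>C (J w + ac c)) d) \<in> BM"
      unfolding BM_def using w d by blast
    from adj[OF this] show ?thesis
      unfolding ipA_vec[OF x p(3)] ipA_vec[OF H.add_mem[OF w H.scale_mem[OF x]] p(2)] cdot_eta_G .
  qed
  have k0: "\<kappa> 0 \<sigma> = 0" "gm (eta 0) \<sigma> = 0" for \<sigma> by (simp_all add: eta_zero mat_vec_zero gm_zero)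
  have "cdot I d (mat_vec I G l) = 0" if "\<And>\<sigma>. gm d \<sigma> = 0" for d
    using eq[of 0 d 0 0] that k0 p by simp
  then obtain e' where e': "\<forall>i\<in>I. l i = eta e' i" using eta_of_orth_perp[of l] by blast
  have cl: "cdot I d (mat_vec I G l) = cnj (\<Sum>\<sigma>\<in>UNIV. cnj (e' $ \<sigma>) * gm d \<sigma>)" for d
  proof -
    have "cdot I d (mat_vec I G l) = cdot I d (mat_vec I G (eta e'))"
      using e' by (intro cdot_cong mat_vec_cong) auto
    thus ?thesis by (simp add: cdot_G_eta)
  qed
  define u where "u = g' - z1 *\<^sub>C g"
  have u: "u \<in> X" "g' = u + z1 *\<^sub>C g" unfolding u_def using p by (auto intro: H.diff_mem H.scale_mem)
  have ug: "ipm x g' = ipm x u + z1 * ipm x g" if "x \<in> X" for x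
    unfolding u(2) using that u(1) p by (simp add: H.ip_add_right H.ip_scale_right H.scale_mem)
  have zl: "ipm (w + z1 *\<^sub>C x) g = ipm w g + z1 * ipm x g" if "w \<in> X" "x \<in> X" for w x
    using that p by (simp add: H.ip_add_left H.ip_scale_left H.scale_mem)
  have "ipm w (J u - g) = 0" if w: "w \<in> X" for w
  proof -
    have "ipm (J w) g' = ipm (w + z1 *\<^sub>C J w) g"
      using eq[OF w, of "\<lambda>i. 0" 0 0] by (simp add: k0 gm_zero cdot_zero_left)
    hence "ipm (J w) u = ipm w g" using ug zl w J_mem_X by simp
    thus ?thesis using J_symmetric[OF w u(1)] w u(1) p J_mem_X by (simp add: H.ip_diff_right)
  qed
  hence "J u - g = 0" using H.ip_self_eq_0[of "J u - g" "int m"] u(1) p J_mem_X by (simp add: H.diff_mem)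
  hence g: "g = J u" by simp
  have au: "ipm (a \<sigma>) u = gm (eta e') \<sigma>" for \<sigma>
  proof (rule eq_if_sums_eq)
    fix c :: "complex ^ 's"
    have "ipm (ac c) g' = ipm (z1 *\<^sub>C ac c) g + cdot I (eta c) (mat_vec I G l)"
      using eq[of 0 "eta c" 0 c] by (simp add: k0)
    moreover have "ipm (z1 *\<^sub>C ac c) g = z1 * ipm (ac c) g"
      using H.ip_scale_left[OF ac_mem p(2), of z1 c] by simp
    ultimately have "ipm (ac c) u = cdot I (eta c) (mat_vec I G l)" using ug[OF ac_mem] by simp
    also have "\<dots> = cdot I (eta c) (mat_vec I G (eta e'))"
      using e' by (intro cdot_cong mat_vec_cong) auto
    finally show "(\<Sum>\<sigma>\<in>UNIV. cnj (c $ \<sigma>) * ipm (a \<sigma>) u) = (\<Sum>\<sigma>\<in>UNIV. cnj (c $ \<sigma>) * gm (eta e') \<sigma>)"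
      using ip_ac[OF u(1)] by (simp add: cdot_eta_G)
  qed
  have "gm l' \<sigma> = \<kappa> e' \<sigma>" for \<sigma>
  proof (rule eq_if_sums_eq)
    fix e :: "complex ^ 's"
    \<comment> \<open>\<open>mat_vec I Md (eta e)\<close> serves only as one admissible
      \<open>d\<close>: its block is \<open>\<kappa> e\<close> by \<open>gm_Md\<close>.\<close>
    have "(\<Sum>\<sigma>\<in>UNIV. cnj (e $ \<sigma>) * gm l' \<sigma>) = cdot I (mat_vec I Md (eta e)) (mat_vec I G l)"
      using eq[of 0 "mat_vec I Md (eta e)" e 0] p by (simp add: k0 gm_Md)
    also have "\<dots> = cnj (\<Sum>\<sigma>\<in>UNIV. cnj (e' $ \<sigma>) * \<kappa> e \<sigma>)" unfolding cl gm_Md ..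
    finally show "(\<Sum>\<sigma>\<in>UNIV. cnj (e $ \<sigma>) * gm l' \<sigma>) = (\<Sum>\<sigma>\<in>UNIV. cnj (e $ \<sigma>) * \<kappa> e' \<sigma>)"
      by (simp only: kappa_hermitian[of e e'])
  qed
  moreover have "p = (vec (J u) (eta e'), vec (u + z1 *\<^sub>C J u) l')"
    using p(1) u(2) g e' vec_cong[of l "eta e'"] by simp
  ultimately show "p \<in> Bm" unfolding Bm_def using u(1) au by blast
qed

lemma a_indep: assumes "(\<Sum>\<sigma>\<in>UNIV. c \<sigma> *\<^sub>C a \<sigma>) = 0" shows "c \<sigma> = 0"
proof -
  have "ac (\<chi> \<sigma>. c \<sigma>) \<in> H (int m + 1)" using assms by (simp add: h_comb_def)
  hence "(\<chi> \<sigma>. c \<sigma>) = 0" by (rule hc_indep) simp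
  thus ?thesis by (simp add: vec_eq_iff)
qed

text \<open>One inclusion is \<open>adjoint_BM\<close> read backwards, as the form is Hermitian. In
  the other one the parameters of \<open>Bm\<close> cannot be varied freely, since \<open>u\<close>
  and \<open>e\<close> are tied by the boundary condition.\<close>

lemma adjoint_Bm: "adjoint_rel HA ipA Bm = BM"
proof (intro equalityI subsetI)
  fix p assume pB: "p \<in> BM"
  obtain y y' where p: "p = (y, y')" "y \<in> HA" "y' \<in> HA" using pB BM_sub by blast
  have "ipA x y' = ipA x' y" if x: "(x, x') \<in> Bm" for x x'
  proof -
    have m: "x \<in> HA" "x' \<in> HA" using x Bm_sub_BM BM_sub by auto
    have "ipA y x' = ipA y' x" using x pB p unfolding adjoint_BM[symmetric] adjoint_rel_def by blast
    thus ?thesis using ipA_commute[OF p(2) m(2)] ipA_commute[OF p(3) m(1)] by simp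
  qed
  thus "p \<in> adjoint_rel HA ipA Bm" unfolding adjoint_rel_def using p by blast
next
  fix p assume "p \<in> adjoint_rel HA ipA Bm"
  then obtain f l f' l' where p: "p = (vec f l, vec f' l')" "f \<in> X" "f' \<in> X"
    and adj: "\<And>x x'. (x, x') \<in> Bm \<Longrightarrow> ipA x (vec f' l') = ipA x' (vec f l)"
    unfolding adjoint_rel_def HA_eq by blast
  have eq: "ipm (J u) f' + (\<Sum>\<sigma>\<in>UNIV. cnj (e $ \<sigma>) * gm l' \<sigma>) = ipm (u + z1 *\<^sub>C J u) f + cdot I d (mat_vec I G l)"
    if u: "u \<in> X" "\<And>\<sigma>. ipm (a \<sigma>) u = gm (eta e) \<sigma>" and d: "\<And>\<sigma>. gm d \<sigma> = \<kappa> e \<sigma>" for u e d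
  proof -
    have "(vec (J u) (eta e), vec (u + z1 *\<^sub>C J u) d) \<in> Bm" unfolding Bm_def using u d by blast
    from adj[OF this] show ?thesis
      unfolding ipA_vec[OF J_mem_X[OF u(1)] p(3)]
        ipA_vec[OF H.add_mem[OF u(1) H.scale_mem[OF J_mem_X[OF u(1)]]] p(2)] cdot_eta_G .
  qed
  have k0: "\<kappa> 0 \<sigma> = 0" "gm (eta 0) \<sigma> = 0" for \<sigma> by (simp_all add: eta_zero mat_vec_zero gm_zero)
  have "cdot I d (mat_vec I G l) = 0" if "\<And>\<sigma>. gm d \<sigma> = 0" for d
    using eq[of 0 0 d] that k0 p H.ip_zero_right[OF a_mem] by simp
  then obtain e where e: "\<forall>i\<in>I. l i = eta e i" using eta_of_orth_perp[of l] by blast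
  have cl: "cdot I d (mat_vec I G l) = cnj (\<Sum>\<sigma>\<in>UNIV. cnj (e $ \<sigma>) * gm d \<sigma>)" for d
  proof -
    have "cdot I d (mat_vec I G l) = cdot I d (mat_vec I G (eta e))"
      using e by (intro cdot_cong mat_vec_cong) auto
    thus ?thesis by (simp add: cdot_G_eta)
  qed
  define w where "w = f' - z1 *\<^sub>C f"
  have w: "w \<in> X" "f' = w + z1 *\<^sub>C f" unfolding w_def using p by (auto intro: H.diff_mem H.scale_mem)
  have split: "ipm (J u) f' = ipm u (J w) + z1 * ipm (J u) f" if "u \<in> X" for u
    unfolding w(2) using that w(1) p J_mem_X[OF that] J_symmetric[OF that w(1)]
    by (simp add: H.ip_add_right H.ip_scale_right H.scale_mem)
  have zl: "ipm (u + z1 *\<^sub>C J u) f = ipm u f + z1 * ipm (J u) f" if "u \<in> X" for u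
    using that p J_mem_X[OF that] by (simp add: H.ip_add_left H.ip_scale_left H.scale_mem)
  define q where "q = f - J w"
  have q: "q \<in> X" unfolding q_def using p w(1) J_mem_X by (auto intro: H.diff_mem)
  have orth: "ipm u q = 0" if u: "u \<in> X" "\<And>\<sigma>. ipm (a \<sigma>) u = 0" for u
  proof -
    have "ipm (J u) f' = ipm (u + z1 *\<^sub>C J u) f"
      using eq[OF u(1), of 0 "\<lambda>i. 0"] u(2) by (simp add: k0 gm_zero cdot_zero_left)
    hence "ipm u (J w) = ipm u f" using split zl u(1) by simp
    thus ?thesis unfolding q_def using u(1) p w(1) J_mem_X by (simp add: H.ip_diff_right)
  qed
  obtain c0 where c0: "\<forall>\<sigma>. ipm (a \<sigma>) (q - (\<Sum>\<sigma>\<in>UNIV. c0 \<sigma> *\<^sub>C a \<sigma>)) = 0"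
    using H.projection_on_span[of UNIV a "int m" q] q a_mem by auto
  define c where "c = (\<chi> \<sigma>. c0 \<sigma>)"
  have sc: "(\<Sum>\<sigma>\<in>UNIV. c0 \<sigma> *\<^sub>C a \<sigma>) = ac c" by (simp add: c_def h_comb_def)
  \<comment> \<open>\<open>r\<close> is orthogonal to all \<open>a \<sigma>\<close> and hence an
    admissible \<open>u\<close>; being orthogonal to \<open>q\<close> and to \<open>ac c\<close>, it
    is orthogonal to itself.\<close>
  define r where "r = q - ac c"
  have r: "r \<in> X" "\<And>\<sigma>. ipm (a \<sigma>) r = 0"
    using c0 q H.diff_mem[OF q ac_mem[of c]] unfolding r_def sc by auto
  have "ipm r r = ipm r q - cnj (ipm (ac c) r)"
    using H.ip_diff_right[OF r(1) q ac_mem[of c]] H.ip_commute[OF ac_mem[of c] r(1)] unfolding r_def by simp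
  also have "\<dots> = 0" using orth[OF r] ip_ac[OF r(1)] r(2) by simp
  finally have "r = 0" using H.ip_self_eq_0[OF r(1)] by blast
  hence f: "f = J w + ac c" unfolding r_def q_def by (simp add: algebra_simps)
  have "gm l' \<sigma> = \<kappa> e \<sigma> + gm (eta c) \<sigma>" for \<sigma>
  proof (rule eq_if_sums_eq)
    fix e' :: "complex ^ 's"
    \<comment> \<open>By independence of the \<open>a \<sigma>\<close> every \<open>e'\<close> has a
      partner \<open>u\<close> that satisfies the boundary condition, so \<open>e'\<close> can be
      varied freely after all.\<close>
    obtain u where u: "u \<in> X" "\<And>\<sigma>. ipm (a \<sigma>) u = gm (eta e') \<sigma>"
      using H.prescribed_products[of UNIV a "int m" "gm (eta e')"] a_mem a_indep by auto
    have "ipm u f = ipm u (J w) + cnj (ipm (ac c) u)"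
      using H.ip_add_right[OF u(1) J_mem_X[OF w(1)] ac_mem[of c]] H.ip_commute[OF ac_mem[of c] u(1)]
      unfolding f by simp
    moreover have "ipm (J u) f' + (\<Sum>\<sigma>\<in>UNIV. cnj (e' $ \<sigma>) * gm l' \<sigma>) =
        ipm (u + z1 *\<^sub>C J u) f + cnj (\<Sum>\<sigma>\<in>UNIV. cnj (e $ \<sigma>) * \<kappa> e' \<sigma>)"
      using eq[OF u, of "mat_vec I Md (eta e')"] unfolding cl gm_Md by simp
    ultimately have "(\<Sum>\<sigma>\<in>UNIV. cnj (e' $ \<sigma>) * gm l' \<sigma>) =
        cnj (ipm (ac c) u) + (\<Sum>\<sigma>\<in>UNIV. cnj (e' $ \<sigma>) * \<kappa> e \<sigma>)"
      unfolding kappa_hermitian[of e' e] using split[OF u(1)] zl[OF u(1)] by simp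
    also have "cnj (ipm (ac c) u) = (\<Sum>\<sigma>\<in>UNIV. cnj (e' $ \<sigma>) * gm (eta c) \<sigma>)"
      using ip_ac[OF u(1), of c] u(2) cdot_G_eta[of "eta c" e'] cdot_eta_G[of c "eta e'"]
      by simp
    finally show "(\<Sum>\<sigma>\<in>UNIV. cnj (e' $ \<sigma>) * gm l' \<sigma>) = (\<Sum>\<sigma>\<in>UNIV. cnj (e' $ \<sigma>) * (\<kappa> e \<sigma> + gm (eta c) \<sigma>))"
      by (simp add: distrib_left sum.distrib)
  qed
  moreover have "p = (vec (J w + ac c) (eta e), vec (w + z1 *\<^sub>C (J w + ac c)) l')"
    using p(1) w(2) f e vec_cong[of l "eta e"] by simp
  ultimately show "p \<in> BM" unfolding BM_def using w(1) by blast
qed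

section \<open>The adjoint of \<open>A_max\<close> and the conclusion\<close>

lemma Domain_Aop: "Domain (Aop N) = {vec (J w + ac c) d | w c d. w \<in> X}"
proof (intro equalityI subsetI)
  fix x assume "x \<in> {vec (J w + ac c) d | w c d. w \<in> X}"
  then obtain w c d where x: "x = vec (J w + ac c) d" "w \<in> X" by blast
  have "(x, vec (w + z1 *\<^sub>C (J w + ac c)) (\<lambda>i. mat_vec I N d i + eta c i)) \<in> Aop N"
    unfolding Aop_eq x(1) using x(2) by blast
  thus "x \<in> Domain (Aop N)" by (rule DomainI)
next
  fix x assume "x \<in> Domain (Aop N)"
  thus "x \<in> {vec (J w + ac c) d | w c d. w \<in> X}" unfolding Aop_eq by blast
qed

text \<open>The scheme is that of \<open>adjoint_BM\<close>, but \<open>d\<close> is now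
  unrestricted. Testing with all unit vectors gives G l' = G_M^* l in every row, and the inverse of
  \<open>G\<close> determines \<open>l'\<close> completely.\<close>

lemma adjoint_Aop: "adjoint_rel HA ipA (Aop Md) = Am (mat_mult I Gi (mat_adj GM))"
proof (intro equalityI subsetI)
  fix p assume "p \<in> Am (mat_mult I Gi (mat_adj GM))"
  then obtain u l l' where p: "p = (vec (J u) l, vec (u + z1 *\<^sub>C J u) l')" "u \<in> X"
    "\<forall>\<sigma>. ipm (a \<sigma>) u = gm l \<sigma>" "\<forall>i\<in>I. l' i = mat_vec I Gi (mat_vec I (mat_adj GM) l) i"
    unfolding Am_def mat_vec_mult by blast
  have Gl: "mat_vec I G l' i = mat_vec I (mat_adj GM) l i" if "i \<in> I" for i
  proof -
    have "mat_vec I G l' i = mat_vec I G (mat_vec I Gi (mat_vec I (mat_adj GM) l)) i"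
      using p(4) by (intro mat_vec_cong) blast
    thus ?thesis using G_Gi[OF that] by simp
  qed
  have Ju: "J u \<in> X" and v: "u + z1 *\<^sub>C J u \<in> X" using p(2) J_mem_X by (auto intro!: H.add_mem H.scale_mem)
  have "ipA x (vec (u + z1 *\<^sub>C J u) l') = ipA x' (vec (J u) l)" if xx: "(x, x') \<in> Aop Md" for x x'
  proof -
    obtain w c d d' where A: "x = vec (J w + ac c) d" "x' = vec (w + z1 *\<^sub>C (J w + ac c)) d'" "w \<in> X"
      "\<forall>i\<in>I. d' i = mat_vec I Md d i + eta c i" using xx unfolding Aop_eq by blast
    let ?y = "J w + ac c"
    have y: "?y \<in> X" by (rule H.add_mem[OF J_mem_X[OF A(3)] ac_mem])
    note mem = y A(3) p(2) Ju J_mem_X[OF A(3)] ac_mem[of c]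
    have "ipm ?y (u + z1 *\<^sub>C J u) = ipm w (J u) + ipm (ac c) u + z1 * ipm ?y (J u)"
      using mem J_symmetric[OF A(3) p(2)] by (simp only: H.ip_add_right H.ip_add_left H.ip_scale_right H.scale_mem)
    moreover have "ipm (w + z1 *\<^sub>C ?y) (J u) = ipm w (J u) + cnj z1 * ipm ?y (J u)"
      using mem by (simp only: H.ip_add_left H.ip_scale_left H.scale_mem H.add_mem)
    moreover have "cdot I d (mat_vec I G l') = cdot I (mat_vec I Md d) (mat_vec I G l)"
    proof -
      have "cdot I d (mat_vec I G l') = cdot I d (mat_vec I (mat_adj GM) l)" by (intro cdot_cong Gl refl)
      also have "\<dots> = cdot I (mat_vec I G (mat_vec I Md d)) l"
        by (simp add: cdot_adj G_M_def mat_vec_mult[abs_def])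
      finally show ?thesis by (simp add: G_adj)
    qed
    moreover have "cdot I d' (mat_vec I G l) = cdot I (mat_vec I Md d) (mat_vec I G l) + ipm (ac c) u"
    proof -
      have "cdot I d' (mat_vec I G l) = cdot I (\<lambda>i. mat_vec I Md d i + eta c i) (mat_vec I G l)"
        using A(4) by (intro cdot_cong) auto
      thus ?thesis using ip_ac[OF p(2)] p(3) by (simp add: cdot_add_left cdot_eta_G)
    qed
    ultimately show ?thesis
      unfolding A(1,2) ipA_vec[OF y v] ipA_vec[OF H.add_mem[OF A(3) H.scale_mem[OF y]] Ju] by simp
  qed
  thus "p \<in> adjoint_rel HA ipA (Aop Md)"
    unfolding adjoint_rel_def p(1) using vec_mem_HA[OF Ju] vec_mem_HA[OF v] by blast
next
  fix p assume "p \<in> adjoint_rel HA ipA (Aop Md)"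
  then obtain g l g' l' where p: "p = (vec g l, vec g' l')" "g \<in> X" "g' \<in> X"
    and adj: "\<And>x x'. (x, x') \<in> Aop Md \<Longrightarrow> ipA x (vec g' l') = ipA x' (vec g l)"
    unfolding adjoint_rel_def HA_eq by blast
  have eq: "ipm (J w + ac c) g' + cdot I d (mat_vec I G l') =
      ipm (w + z1 *\<^sub>C (J w + ac c)) g + cdot I (\<lambda>i. mat_vec I Md d i + eta c i) (mat_vec I G l)"
    if w: "w \<in> X" for w c d
  proof -
    have x: "J w + ac c \<in> X" by (rule H.add_mem[OF J_mem_X[OF w] ac_mem])
    have "(vec (J w + ac c) d, vec (w + z1 *\<^sub>C (J w + ac c)) (\<lambda>i. mat_vec I Md d i + eta c i)) \<in> Aop Md"
      unfolding Aop_eq using w by blast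
    from adj[OF this] show ?thesis
      unfolding ipA_vec[OF x p(3)] ipA_vec[OF H.add_mem[OF w H.scale_mem[OF x]] p(2)] .
  qed
  have M0: "mat_vec I Md (\<lambda>i. 0) = (\<lambda>i. 0)" by (simp add: mat_vec_zero fun_eq_iff)
  define u where "u = g' - z1 *\<^sub>C g"
  have u: "u \<in> X" "g' = u + z1 *\<^sub>C g" unfolding u_def using p by (auto intro: H.diff_mem H.scale_mem)
  have ug: "ipm x g' = ipm x u + z1 * ipm x g" if "x \<in> X" for x
    unfolding u(2) using that u(1) p by (simp add: H.ip_add_right H.ip_scale_right H.scale_mem)
  have zl: "ipm (w + z1 *\<^sub>C x) g = ipm w g + z1 * ipm x g" if "w \<in> X" "x \<in> X" for w x
    using that p by (simp add: H.ip_add_left H.ip_scale_left H.scale_mem)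
  have "ipm w (J u - g) = 0" if w: "w \<in> X" for w
  proof -
    have "ipm (J w) g' = ipm (w + z1 *\<^sub>C J w) g"
      using eq[OF w, of 0 "\<lambda>i. 0"] by (simp add: eta_zero M0 cdot_zero_left)
    hence "ipm (J w) u = ipm w g" using ug zl w J_mem_X by simp
    thus ?thesis using J_symmetric[OF w u(1)] w u(1) p J_mem_X by (simp add: H.ip_diff_right)
  qed
  hence "J u - g = 0" using H.ip_self_eq_0[of "J u - g" "int m"] u(1) p J_mem_X by (simp add: H.diff_mem)
  hence g: "g = J u" by simp
  have au: "ipm (a \<sigma>) u = gm l \<sigma>" for \<sigma>
  proof (rule eq_if_sums_eq)
    fix c :: "complex ^ 's"
    have "ipm (ac c) g' = ipm (z1 *\<^sub>C ac c) g + cdot I (eta c) (mat_vec I G l)"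
      using eq[of 0 c "\<lambda>i. 0"] by (simp add: M0 cdot_zero_left)
    moreover have "ipm (z1 *\<^sub>C ac c) g = z1 * ipm (ac c) g"
      using H.ip_scale_left[OF ac_mem p(2), of z1 c] by simp
    ultimately have "ipm (ac c) u = cdot I (eta c) (mat_vec I G l)" using ug[OF ac_mem] by simp
    thus "(\<Sum>\<sigma>\<in>UNIV. cnj (c $ \<sigma>) * ipm (a \<sigma>) u) = (\<Sum>\<sigma>\<in>UNIV. cnj (c $ \<sigma>) * gm l \<sigma>)"
      using ip_ac[OF u(1)] by (simp add: cdot_eta_G)
  qed
  have Gl: "mat_vec I G l' i = mat_vec I (mat_adj GM) l i" if i: "i \<in> I" for i
  proof -
    let ?d = "\<lambda>j. of_bool (j = i) :: complex"
    have "cdot I ?d (mat_vec I G l') = cdot I (mat_vec I Md ?d) (mat_vec I G l)"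
      using eq[of 0 0 ?d] p by (simp add: eta_zero)
    also have "\<dots> = cdot I ?d (mat_vec I (mat_adj GM) l)"
      by (simp add: cdot_adj G_M_def mat_vec_mult[abs_def] G_adj)
    finally show ?thesis using cdot_unit[OF finite_I i] by simp
  qed
  have "l' i = mat_vec I (mat_mult I Gi (mat_adj GM)) l i" if i: "i \<in> I" for i
  proof -
    have "l' i = mat_vec I Gi (mat_vec I G l') i" using Gi_G[OF i] by simp
    also have "\<dots> = mat_vec I Gi (mat_vec I (mat_adj GM) l) i" by (intro mat_vec_cong Gl)
    finally show ?thesis by (simp add: mat_vec_mult)
  qed
  moreover have "p = (vec (J u) l, vec (u + z1 *\<^sub>C J u) l')" using p(1) u(2) g by simp
  ultimately show "p \<in> Am (mat_mult I Gi (mat_adj GM))" unfolding Am_def using u(1) au by blast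
qed

lemma relations:
  shows "B_max H ip L z1 m \<phi> G = BM"
    and "B_min H ip L z1 m \<phi> G = Bm"
    and "rel_restrict (A_max' H ip L z1 m \<phi> G) (Domain (A_max H ip L z1 m \<phi>) \<inter> HAmin) \<oplus>\<^sub>r ({0} \<times> HAperp) = BM"
    and "rel_restrict (A_min H ip L z1 m \<phi> G) (Domain (A_min H ip L z1 m \<phi> G) \<inter> HAmin) \<oplus>\<^sub>r ({0} \<times> HAperp) = Bm"
    and "rel_restrict (A_min' H ip L z1 m \<phi> G) (Domain (A_min H ip L z1 m \<phi> G) \<inter> HAmin) \<oplus>\<^sub>r ({0} \<times> HAperp) = Bm"
proof -
  let ?N = "mat_mult I Gi (mat_adj GM)"
  show B: "B_max H ip L z1 m \<phi> G = BM"
    unfolding B_max_def A_max_def by (rule restrict_Aop_sum_perp[OF gm_Md order_refl])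
  show "B_min H ip L z1 m \<phi> G = Bm"
    unfolding B_min_def B by (rule adjoint_BM)
  show "rel_restrict (A_max' H ip L z1 m \<phi> G) (Domain (A_max H ip L z1 m \<phi>) \<inter> HAmin) \<oplus>\<^sub>r ({0} \<times> HAperp) = BM"
    unfolding A_max'_def A_max_def
    by (rule restrict_Aop_sum_perp[OF gm_Gi_GM]) (simp add: Domain_Aop)
  have A: "A_min H ip L z1 m \<phi> G = Am ?N" unfolding A_min_def A_max_def by (rule adjoint_Aop)
  show "rel_restrict (A_min H ip L z1 m \<phi> G) (Domain (A_min H ip L z1 m \<phi> G) \<inter> HAmin) \<oplus>\<^sub>r ({0} \<times> HAperp) = Bm"
    unfolding A Domain_Am by (rule restrict_Am_sum_perp[OF gm_Gi_GM])
  show "rel_restrict (A_min' H ip L z1 m \<phi> G) (Domain (A_min H ip L z1 m \<phi> G) \<inter> HAmin) \<oplus>\<^sub>r ({0} \<times> HAperp) = Bm"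
    unfolding A Domain_Am A_min'_eq by (rule restrict_Am_sum_perp[OF gm_Md])
qed

end

theorem lemma3p2:
  fixes H :: "int \<Rightarrow> 'v::complex_vector set"
    and ip :: "int \<Rightarrow> 'v \<Rightarrow> 'v \<Rightarrow> complex"
    and L :: "('v \<times> 'v) set"
    and z1 :: real
    and m :: nat
    and \<phi> :: "'s::finite \<Rightarrow> 'v"
    and G :: "'s \<times> nat \<Rightarrow> 's \<times> nat \<Rightarrow> complex"
  assumes hilbert: "hilbert_space_on (H 0) (ip 0)"
    and self_adjoint: "self_adjoint_operator (H 0) (ip 0) L"
    and semibounded: "lower_semibounded (ip 0) L"
    and z1_res: "complex_of_real z1 \<in> resolvent_set (H 0) (ip 0) L"
    and z1_below: "\<forall>w. w \<notin> resolvent_set (H 0) (ip 0) L \<longrightarrow> z1 < Re w"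
    and scale: "hilbert_scale H ip L z1"
    and m_pos: "m \<ge> 1"
    and phi: "\<forall>\<sigma>. \<phi> \<sigma> \<in> H (- int m - 2) - H (- int m - 1)"
    and phi_indep: "\<forall>c :: complex ^ 's.
          (\<Sum>\<sigma>\<in>UNIV. (c $ \<sigma>) *\<^sub>C \<phi> \<sigma>) \<in> H (- int m - 1) \<longrightarrow> c = 0"
    and G_invertible: "mat_invertible (UNIV \<times> {1..m}) G"
    and G_hermitian: "mat_hermitian (UNIV \<times> {1..m}) G"
    and G_cond: "m \<ge> 2 \<Longrightarrow> \<forall>\<sigma> \<sigma>'. G (\<sigma>, m - 1) (\<sigma>', m) = G (\<sigma>, m) (\<sigma>', m - 1)"
  defines "HA \<equiv> H_A H ip L z1 m \<phi>"
    and "HAmin \<equiv> H_A_min H ip L z1 m \<phi>"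
    and "HAperp \<equiv> H_A_perp H ip L z1 m \<phi> G"
    and "ipA \<equiv> ip_A H ip L z1 m \<phi> G"
    and "Amax \<equiv> A_max H ip L z1 m \<phi>"
    and "Amax' \<equiv> A_max' H ip L z1 m \<phi> G"
    and "Amin \<equiv> A_min H ip L z1 m \<phi> G"
    and "Amin' \<equiv> A_min' H ip L z1 m \<phi> G"
    and "Bmax \<equiv> B_max H ip L z1 m \<phi> G"
    and "Bmin \<equiv> B_min H ip L z1 m \<phi> G"
  shows "(Bmax = rel_restrict Amax' (Domain Amax \<inter> HAmin) \<oplus>\<^sub>r ({0} \<times> HAperp)) \<and>
      (Bmin = rel_restrict Amin (Domain Amin \<inter> HAmin) \<oplus>\<^sub>r ({0} \<times> HAperp)) \<and>
      (Bmin = rel_restrict Amin' (Domain Amin \<inter> HAmin) \<oplus>\<^sub>r ({0} \<times> HAperp)) \<and>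
      (linear_relation_on HA Bmin) \<and>
      (closed_rel_A H ip L z1 m \<phi> Bmin) \<and>
      (symmetric_rel HA ipA Bmin) \<and>
      (linear_relation_on HA Bmax) \<and>
      (adjoint_rel HA ipA Bmin = Bmax)"
proof -
  interpret extension H ip L z1 m \<phi> G
  proof (unfold_locales)
    show "\<phi> \<sigma> \<in> H (- int m - 2)" for \<sigma> using phi by blast
    show "c = 0" if "(\<Sum>\<sigma>\<in>UNIV. (c $ \<sigma>) *\<^sub>C \<phi> \<sigma>) \<in> H (- int m - 1)" for c :: "complex ^ 's"
      using phi_indep that by blast
    show "G (\<sigma>, m - 1) (\<sigma>', m) = G (\<sigma>, m) (\<sigma>', m - 1)" if "m \<ge> 2" for \<sigma> \<sigma>'
      using G_cond[OF that] by blast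
  qed (fact self_adjoint z1_res scale m_pos G_invertible G_hermitian)+
  have Bm_sub: "Bm \<subseteq> H_A H ip L z1 m \<phi> \<times> H_A H ip L z1 m \<phi>" using Bm_sub_BM BM_sub by (rule order_trans)
  \<comment> \<open>Each of \<open>Bm\<close> and \<open>BM\<close> is the adjoint of the other, so
    linearity of both and closedness of \<open>Bm\<close> are instances of general facts on
    adjoints; symmetry is \<open>Bm_sub_BM\<close>.\<close>
  show ?thesis
    unfolding HA_def HAmin_def HAperp_def ipA_def Amax_def Amax'_def Amin_def Amin'_def Bmax_def Bmin_def
      relations adjoint_Bm symmetric_rel_def
    using adjoint_linear[OF BM_sub] adjoint_closed[OF BM_sub] adjoint_linear[OF Bm_sub] Bm_sub_BM
    unfolding adjoint_BM adjoint_Bm by (intro conjI refl)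
qed

end
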